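(* Let $N\ge 2$, let $m_1,\dots,m_N>0$ be masses, $G>0$, and let $q_i^0,v_i^0\in\mathbb{R}^3$ ($1\le i\le N$) satisfy $q_i^0\neq q_j^0$ for all $1\le i<j\le N$. Then the solution $(Q(\tau),V(\tau))$ of the time-renormalized equations $$\frac{dQ_i}{d\tau}=s(Q,V)\,V_i,\qquad \frac{dV_i}{d\tau}=s(Q,V)\,g_i(Q),\qquad Q_i(0)=q_i^0,\quad V_i(0)=v_i^0,\qquad i=1,\ldots,N,$$ admits a holomorphic extension as a function of the complex time $\tau$ in the strip $$\{\tau\in\mathbb{C}\ :\ |\mathrm{Im}(\tau)|<\beta\},$$ where $\beta\approx 0.0839968103939379$ is the constant defined in the context.
   Context: $\|\cdot\|$ is the Euclidean norm on $\mathbb{R}^3$. For $Q=(Q_1,\dots,Q_N)$, $V=(V_1,\dots,V_N)$ with $Q_i\ne Q_j$ for $i\neq j$: $$g_i(Q)=\sum_{j\neq i}\frac{G\,m_j}{\|Q_i-Q_j\|^3}(Q_j-Q_i),\qquad K_i(Q)=\sum_{j\neq i}\frac{G\,m_j}{\|Q_i-Q_j\|^2},\qquad M_{ij}(Q)=K_i(Q)+K_j(Q),$$ $$s(Q,V)=\left(\sum_{1\le i<j\le N}\frac{\|V_i-V_j\|^2}{\|Q_i-Q_j\|^2}+\sum_{1\le i<j\le N}\frac{M_{ij}(Q)}{\|Q_i-Q_j\|}\right)^{-1/2}.$$ The constant is $\beta=\int_0^{v_+}g(\sigma)\,d\sigma$ with $$g(\sigma)=\frac{2}{(\sigma^2+2\sigma+2)^2}\sqrt{-\frac{3\sigma^6+18\sigma^5+50\sigma^4+80\sigma^3+76\sigma^2+40\sigma-8}{\sigma^4+4\sigma^3+8\sigma^2+8\sigma+2}},$$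 $$v_+=-1+\frac{\sqrt{502+18\sqrt{777}-5\,(251+9\sqrt{777})^{2/3}+8\,\sqrt[3]{251+9\sqrt{777}}}}{3\,\sqrt[3]{251+9\sqrt{777}}}\approx 0.149902575567304 .$$ *)

theory Defs
  imports "HOL-Analysis.Analysis"
begin

text \<open>
  A configuration of \<open>N\<close> bodies is a function \<open>nat \<Rightarrow> real^3\<close>, of which only the values
  at the indices \<open>1, \<dots>, N\<close> are used; values at other indices are irrelevant.
\<close>

definition accel :: "nat \<Rightarrow> real \<Rightarrow> (nat \<Rightarrow> real) \<Rightarrow> (nat \<Rightarrow> real^3) \<Rightarrow> nat \<Rightarrow> real^3" where
  "accel N G m Q i =
     (\<Sum>j\<in>{1..N} - {i}. (G * m j / norm (Q i - Q j) ^ 3) *\<^sub>R (Q j - Q i))"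

definition K :: "nat \<Rightarrow> real \<Rightarrow> (nat \<Rightarrow> real) \<Rightarrow> (nat \<Rightarrow> real^3) \<Rightarrow> nat \<Rightarrow> real" where
  "K N G m Q i = (\<Sum>j\<in>{1..N} - {i}. G * m j / norm (Q i - Q j) ^ 2)"

definition M :: "nat \<Rightarrow> real \<Rightarrow> (nat \<Rightarrow> real) \<Rightarrow> (nat \<Rightarrow> real^3) \<Rightarrow> nat \<Rightarrow> nat \<Rightarrow> real" where
  "M N G m Q i j = K N G m Q i + K N G m Q j"

definition renorm ::
  "nat \<Rightarrow> real \<Rightarrow> (nat \<Rightarrow> real) \<Rightarrow> (nat \<Rightarrow> real^3) \<Rightarrow> (nat \<Rightarrow> real^3) \<Rightarrow> real" where
  "renorm N G m Q V =
     ((\<Sum>i=1..N. \<Sum>j=i+1..N. norm (V i - V j) ^ 2 / norm (Q i - Q j) ^ 2)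
      + (\<Sum>i=1..N. \<Sum>j=i+1..N. M N G m Q i j / norm (Q i - Q j))) powr (-1/2)"

text \<open>
  \<open>Q\<close> and \<open>V\<close> solve the time-renormalized initial value problem at all times in \<open>T\<close>
  (meant to be an open interval containing \<open>0\<close>). The vector field only makes sense on
  collision-free configurations, so a solution has to stay collision-free.
\<close>

definition renormalized_solution ::
  "nat \<Rightarrow> real \<Rightarrow> (nat \<Rightarrow> real) \<Rightarrow> (nat \<Rightarrow> real^3) \<Rightarrow> (nat \<Rightarrow> real^3) \<Rightarrow> real set
   \<Rightarrow> (real \<Rightarrow> nat \<Rightarrow> real^3) \<Rightarrow> (real \<Rightarrow> nat \<Rightarrow> real^3) \<Rightarrow> bool" where
  "renormalized_solution N G m q0 v0 T Q V \<longleftrightarrow>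
     (\<forall>i\<in>{1..N}. Q 0 i = q0 i \<and> V 0 i = v0 i) \<and>
     (\<forall>\<tau>\<in>T. \<forall>i\<in>{1..N}. \<forall>j\<in>{1..N}. i \<noteq> j \<longrightarrow> Q \<tau> i \<noteq> Q \<tau> j) \<and>
     (\<forall>\<tau>\<in>T. \<forall>i\<in>{1..N}.
        ((\<lambda>t. Q t i) has_vector_derivative renorm N G m (Q \<tau>) (V \<tau>) *\<^sub>R V \<tau> i) (at \<tau>) \<and>
        ((\<lambda>t. V t i) has_vector_derivative
            renorm N G m (Q \<tau>) (V \<tau>) *\<^sub>R accel N G m (Q \<tau>) i) (at \<tau>))"

definition has_holomorphic_extension :: "(real \<Rightarrow> real^3) \<Rightarrow> complex set \<Rightarrow> bool" where
  "has_holomorphic_extension f S \<longleftrightarrow>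
     (\<exists>F :: complex \<Rightarrow> complex^3.
        (\<forall>k. (\<lambda>z. F z $ k) holomorphic_on S) \<and>
        (\<forall>t k. complex_of_real t \<in> S \<and> F (complex_of_real t) $ k = complex_of_real (f t $ k)))"

definition g :: "real \<Rightarrow> real" where
  "g \<sigma> = 2 / (\<sigma>^2 + 2*\<sigma> + 2)^2 *
     sqrt (- ((3*\<sigma>^6 + 18*\<sigma>^5 + 50*\<sigma>^4 + 80*\<sigma>^3 + 76*\<sigma>^2 + 40*\<sigma> - 8)
              / (\<sigma>^4 + 4*\<sigma>^3 + 8*\<sigma>^2 + 8*\<sigma> + 2)))"

definition v_plus :: real where
  "v_plus = -1 +
     sqrt (502 + 18 * sqrt 777 - 5 * (251 + 9 * sqrt 777) powr (2/3)
           + 8 * root 3 (251 + 9 * sqrt 777))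
     / (3 * root 3 (251 + 9 * sqrt 777))"

text \<open>Numerically, \<open>v_plus \<approx> 0.149902575567304\<close> and \<open>beta \<approx> 0.0839968103939379\<close>.\<close>

definition beta :: real where
  "beta = integral {0..v_plus} g"

end

theory Submission
  imports Defs "HOL-Complex_Analysis.Conformal_Mappings"
begin

text \<open>
  To reach complex times, the equations are complexified: squared norms are replaced by the bilinear form
  \<open>\<Sum> x\<^sub>k y\<^sub>k\<close> and \<open>1 / \<parallel>\<cdot>\<parallel>\<close> by the principal branch of its inverse square root. The vector field is holomorphic
  as long as the complexified squares of the distances, and the complexified sum \<open>S = s\<^sup>-\<^sup>2\<close>,
  have positive real part. What has to be shown is that a solution starting at a real
  collision-free state keeps these quantities under control on a disc \<open>|\<tau>| < \<beta>\<close>, for a \<open>\<beta>\<close> that depends neither on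
  the state nor on the masses.

  Let \<open>r\<^sub>i\<^sub>j\<close>, \<open>K\<^sub>i\<close>, \<open>M\<^sub>i\<^sub>j\<close>, \<open>S\<^sub>0\<close> and \<open>s\<^sub>0\<close> belong to the initial state \<open>(q, v)\<close>. Suppose that at some time, for a real
  \<open>\<sigma> \<in> [0, v\<^sub>+)\<close>,
    \<open>\<parallel>V\<^sub>i - v\<^sub>i\<parallel> \<le> s\<^sub>0 K\<^sub>i \<sigma>\<close>  and  \<open>\<parallel>(Q\<^sub>i - Q\<^sub>j) - (q\<^sub>i - q\<^sub>j)\<parallel> \<le> r\<^sub>i\<^sub>j (X - 1)\<close>,
  where \<open>R = 1 + \<sigma> + \<sigma>\<^sup>2 / 2\<close> and \<open>X = (2 - 1 / R\<^sup>2)\<^sup>1\<^sup>/\<^sup>2\<close>. The triangle inequality shows that inverse distances are at most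
  \<open>R / r\<^sub>i\<^sub>j\<close> and accelerations at most \<open>K\<^sub>i X R\<^sup>3\<close>. The definition of \<open>s\<close> gives
  \<open>\<parallel>v\<^sub>i - v\<^sub>j\<parallel>\<^sup>2 / r\<^sub>i\<^sub>j\<^sup>2 + M\<^sub>i\<^sub>j / r\<^sub>i\<^sub>j \<le> S\<^sub>0\<close>, from which \<open>s\<^sub>0 \<parallel>V\<^sub>i - V\<^sub>j\<parallel> \<le> r\<^sub>i\<^sub>j (1 + \<sigma>)\<close> and
  \<open>|S - S\<^sub>0| \<le> S\<^sub>0 (3 R\<^sup>3 - 2 R\<^sup>2 - 1)\<close> follow, and the latter yields \<open>|s| \<le> \<kappa> s\<^sub>0\<close> with
  \<open>\<kappa> = (2 + 2 R\<^sup>2 - 3 R\<^sup>3)\<^sup>-\<^sup>1\<^sup>/\<^sup>2\<close>. Hence the two bounds propagate along rays in the complex time plane if \<open>\<sigma>\<close>, as a function of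
  \<open>|\<tau>|\<close>, solves \<open>\<sigma>' = \<kappa> X R\<^sup>3\<close> with \<open>\<sigma> 0 = 0\<close>, because then \<open>X' = \<kappa> (1 + \<sigma>)\<close>. Now \<open>g = 1 / (\<kappa> X R\<^sup>3)\<close>
  (lemma \<open>g_conv_majorants\<close>) and \<open>\<kappa>\<close> blows up at \<open>v\<^sub>+\<close>, so this scalar equation has a solution up to the time
  \<open>\<integral> g = \<beta>\<close> (lemma \<open>majorant_solution\<close>).

  The Picard iterates respect these bounds, and therefore converge on the whole disc to a holomorphic solution
  (\<open>holomorphic_Picard\<close>, \<open>holomorphic_solution\<close>), which is real on the real axis.
  As the radius \<open>\<beta>\<close> does not depend on the initial state, the real solution can be continued forever in steps of \<open>\<beta> / 2\<close>
  (\<open>global_solution\<close>); it is unique because the vector field is locally Lipschitz (\<open>solves_unique\<close>). The discs of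
  radius \<open>\<beta>\<close> around all real times cover the strip, and the identity theorem glues the local holomorphic solutions
  (\<open>holomorphic_glue_strip\<close>).
\<close>

section \<open>The scalar majorant equation\<close>

text \<open>
  With \<open>\<sigma>\<close> the growth of the velocities in units of \<open>s\<^sub>0 K\<^sub>i\<close>, the functions
  \<open>inv_dist_maj\<close>, \<open>dist_maj\<close> and \<open>renorm_maj\<close> (called \<open>R\<close>, \<open>X\<close> and \<open>\<kappa>\<close> above) bound, relative to
  their initial values, the inverse distances, the distances and the time-renormalization.
  Since \<open>2 - X\<^sup>2 = 1 / R\<^sup>2\<close>, a distance that changes by at most the factor \<open>X - 1\<close> keeps its complexified
  square away from the branch cut of the square root. The quadratic polynomial \<open>R\<close> is what makes
  \<open>X\<close> grow at the rate \<open>\<kappa> (1 + \<sigma>)\<close> when \<open>\<sigma>\<close> grows at the rate \<open>\<kappa> X R\<^sup>3\<close>.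
\<close>

definition inv_dist_maj :: "real \<Rightarrow> real" where
  "inv_dist_maj \<sigma> = 1 + \<sigma> + \<sigma>^2 / 2"

definition dist_maj :: "real \<Rightarrow> real" where
  "dist_maj \<sigma> = sqrt (2 - 1 / inv_dist_maj \<sigma> ^ 2)"

definition renorm_maj :: "real \<Rightarrow> real" where
  "renorm_maj \<sigma> = 1 / sqrt (2 + 2 * inv_dist_maj \<sigma> ^ 2 - 3 * inv_dist_maj \<sigma> ^ 3)"

text \<open>
  The number \<open>v\<^sub>+\<close> is given by Cardano's formula. With \<open>a\<close> the real cube root of \<open>251 + 9 \<surd>777\<close> one has
  \<open>(1 + v\<^sub>+)\<^sup>2 = (2 a\<^sup>2 - 5 a + 8) / (9 a)\<close>, and \<open>a\<^sup>3\<close> is a root of \<open>x\<^sup>2 - 502 x + 64\<close>; the cubic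
  equation for \<open>(1 + v\<^sub>+)\<^sup>2\<close> is a multiple of this quadratic relation. The polynomial on the left is
  increasing and smaller than \<open>17\<close> at \<open>1\<close>, whence \<open>v\<^sub>+ > 0\<close>.
\<close>

lemma v_plus_cubic:
  defines "y \<equiv> (1 + v_plus)^2"
  shows "3 * y^3 + 5 * y^2 + y = 17" and "v_plus > 0"
proof -
  define c where "c = 251 + 9 * sqrt 777"
  define a where "a = root 3 c"
  have c: "c > 0" unfolding c_def by (simp add: add_pos_nonneg)
  have a: "a > 0" using c by (simp add: a_def)
  have a3: "a^3 = c" using c by (simp add: a_def)
  have "c powr (2/3) = (c powr (1/3)) powr 2" by (simp add: powr_powr)
  also have "c powr (1/3) = a" using c by (simp add: a_def root_powr_inverse)
  also have "a powr 2 = a^2" using a by simp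
  finally have pw: "c powr (2/3) = a^2" .
  have v: "1 + v_plus = sqrt (2 * a^3 - 5 * a^2 + 8 * a) / (3 * a)"
  proof -
    have "502 + 18 * sqrt 777 = 2 * a^3" using a3 by (simp add: c_def)
    then show ?thesis using pw unfolding v_plus_def a_def c_def by simp
  qed
  have pos: "2 * a^2 - 5 * a + 8 > 0"
  proof -
    have "2 * a^2 - 5 * a + 8 = 2 * (a - 5/4)^2 + 39/8" by (simp add: power2_eq_square algebra_simps)
    moreover have "(a - 5/4)^2 \<ge> 0" by simp
    ultimately show ?thesis by linarith
  qed
  have fac: "2 * a^3 - 5 * a^2 + 8 * a = a * (2 * a^2 - 5 * a + 8)"
    by (simp add: power2_eq_square power3_eq_cube algebra_simps)
  have y: "y = (2 * a^2 - 5 * a + 8) / (9 * a)"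
  proof -
    have "a * (2 * a^2 - 5 * a + 8) \<ge> 0" using a pos by simp
    then have "y = (a * (2 * a^2 - 5 * a + 8)) / (3 * a)^2"
      unfolding y_def v fac power_divide by simp
    also have "(3 * a)^2 = a * (9 * a)" by (simp add: power2_eq_square)
    finally show ?thesis using a by simp
  qed
  have ypos: "y > 0" using y a pos by simp
  have "(c - 251)^2 = 81 * 777" by (simp add: c_def power_mult_distrib)
  then have a6: "(a^3)^2 = 502 * a^3 - 64" unfolding a3 by (simp add: power2_eq_square algebra_simps)
  (* Clearing denominators turns the cubic in y into 24 times the quadratic relation for a^3. *)
  define b where "b = 9 * a * y"
  have b: "b = 2 * a^2 - 5 * a + 8" using y a by (simp add: b_def)
  have poly: "3 * b^3 + 5 * b^2 * (9 * a) + b * (9 * a)^2 - 17 * (9*a)^3 = 24 * ((a^3)^2 - 502 * a^3 + 64)"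
    unfolding b by algebra
  have "(9*a)^3 * (3 * y^3 + 5 * y^2 + y - 17) = 3 * b^3 + 5 * b^2 * (9 * a) + b * (9 * a)^2 - 17 * (9*a)^3"
    unfolding b_def by algebra
  also have "\<dots> = 0" unfolding poly a6 by simp
  finally have "3 * y^3 + 5 * y^2 + y - 17 = 0" using a by simp
  then show eq: "3 * y^3 + 5 * y^2 + y = 17" by simp
  have "y > 1"
  proof (rule ccontr)
    assume "\<not> y > 1"
    then have "y^3 \<le> 1" "y^2 \<le> 1" "y \<le> 1" using ypos by (auto intro: power_le_one)
    then show False using eq by linarith
  qed
  moreover have "1 + v_plus \<ge> 0" unfolding v fac using a pos by simp
  ultimately show "v_plus > 0" unfolding y_def
    using power_le_one[of "1 + v_plus" 2] by linarith
qed

lemma inv_dist_maj_ge_1: "0 \<le> \<sigma> \<Longrightarrow> inv_dist_maj \<sigma> \<ge> 1"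
  by (simp add: inv_dist_maj_def)

lemma inv_dist_maj_mono: "0 \<le> \<sigma> \<Longrightarrow> \<sigma> \<le> \<tau> \<Longrightarrow> inv_dist_maj \<sigma> \<le> inv_dist_maj \<tau>"
  by (simp add: inv_dist_maj_def add_mono power_mono)

text \<open>
  In terms of \<open>y = (1 + \<sigma>)\<^sup>2\<close> one has \<open>R = (y + 1) / 2\<close>, and \<open>3 R\<^sup>3 - 2 R\<^sup>2 - 2\<close> becomes the cubic of
  \<open>v_plus_cubic\<close>, up to a factor. So \<open>v\<^sub>+\<close> is exactly the point where \<open>renorm_maj\<close> blows up.
\<close>

lemma renorm_slack_pos:
  assumes "0 \<le> \<sigma>" "\<sigma> < v_plus"
  shows "3 * inv_dist_maj \<sigma> ^ 3 < 2 + 2 * inv_dist_maj \<sigma> ^ 2"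
proof -
  define y where "y = (1 + \<sigma>)^2"
  define z where "z = (1 + v_plus)^2"
  have z: "3 * z^3 + 5 * z^2 + z = 17" using v_plus_cubic by (simp add: z_def)
  have y0: "0 \<le> y" by (simp add: y_def)
  have "y < z" unfolding y_def z_def using assms by (intro power_strict_mono) auto
  then have "y^3 < z^3" "y^2 < z^2" using y0 by (auto intro!: power_strict_mono)
  then have "3 * y^3 + 5 * y^2 + y < 17" using z \<open>y < z\<close> by linarith
  moreover have "inv_dist_maj \<sigma> = (y + 1) / 2"
    by (simp add: inv_dist_maj_def y_def power2_eq_square field_simps)
  moreover have "8 * (3 * ((y + 1) / 2)^3 - 2 * ((y + 1) / 2)^2 - 2) = 3 * y^3 + 5 * y^2 + y - 17"
    by (simp add: power2_eq_square power3_eq_cube field_simps)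
  ultimately have "8 * (3 * inv_dist_maj \<sigma> ^ 3 - 2 * inv_dist_maj \<sigma> ^ 2 - 2) < 0"
    by (simp only:)
  then have "3 * inv_dist_maj \<sigma> ^ 3 - 2 * inv_dist_maj \<sigma> ^ 2 - 2 < 0"
    by (simp only: mult_less_0_iff) simp
  then show ?thesis by simp
qed

text \<open>
  The explicit integrand \<open>g\<close> is the reciprocal of the speed at which \<open>\<sigma>\<close> has to grow; this is where
  the constant \<open>\<beta>\<close> comes from. With \<open>w = \<sigma>\<^sup>2 + 2 \<sigma> + 2 = 2 R\<close> its numerator is
  \<open>3 w\<^sup>3 - 4 w\<^sup>2 - 16\<close> and its denominator \<open>w\<^sup>2 - 2\<close>.
\<close>

lemma g_conv_majorants:
  assumes "0 \<le> \<sigma>" "\<sigma> < v_plus"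
  shows "g \<sigma> = 1 / (renorm_maj \<sigma> * dist_maj \<sigma> * inv_dist_maj \<sigma> ^ 3)"
proof -
  define R where "R = inv_dist_maj \<sigma>"
  have R1: "R \<ge> 1" using inv_dist_maj_ge_1 assms by (simp add: R_def)
  have R2: "R^2 \<ge> 1" using R1 by simp
  have slack: "2 + 2 * R^2 - 3 * R^3 > 0" using renorm_slack_pos[OF assms] by (simp add: R_def)
  have s: "2 * R = 2 + 2 * \<sigma> + \<sigma>^2" by (simp add: R_def inv_dist_maj_def)
  have w: "\<sigma>^2 + 2*\<sigma> + 2 = 2 * R" using s by simp
  have num: "3*\<sigma>^6 + 18*\<sigma>^5 + 50*\<sigma>^4 + 80*\<sigma>^3 + 76*\<sigma>^2 + 40*\<sigma> - 8
      = - (8 * (2 + 2 * R^2 - 3 * R^3))"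
  proof -
    have "3*\<sigma>^6 + 18*\<sigma>^5 + 50*\<sigma>^4 + 80*\<sigma>^3 + 76*\<sigma>^2 + 40*\<sigma> - 8
      = 3 * (2 + 2 * \<sigma> + \<sigma>^2)^3 - 4 * (2 + 2 * \<sigma> + \<sigma>^2)^2 - 16" by algebra
    then show ?thesis unfolding s[symmetric] by (simp add: power_mult_distrib)
  qed
  have den: "\<sigma>^4 + 4*\<sigma>^3 + 8*\<sigma>^2 + 8*\<sigma> + 2 = 2 * (2 * R^2 - 1)"
  proof -
    have "\<sigma>^4 + 4*\<sigma>^3 + 8*\<sigma>^2 + 8*\<sigma> + 2 = (2 + 2 * \<sigma> + \<sigma>^2)^2 - 2" by algebra
    then show ?thesis unfolding s[symmetric] by (simp add: power_mult_distrib)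
  qed
  have frac: "- (- (8 * (2 + 2 * R^2 - 3 * R^3)) / (2 * (2 * R^2 - 1)))
     = 2^2 * ((2 + 2 * R^2 - 3 * R^3) / (2 * R^2 - 1))" using R2 by (simp add: field_simps)
  have "g \<sigma> = 2 / (2 * R)^2 * (2 * (sqrt (2 + 2 * R^2 - 3 * R^3) / sqrt (2 * R^2 - 1)))"
    unfolding g_def w num den frac real_sqrt_mult real_sqrt_divide real_sqrt_abs by simp
  have "2 - 1 / R^2 = (2 * R^2 - 1) / R^2" using R1 by (simp add: field_simps)
  then have "dist_maj \<sigma> = sqrt (2 * R^2 - 1) / R"
    using R1 by (simp add: dist_maj_def R_def real_sqrt_divide)
  have "dist_maj \<sigma> * R ^ 3 = R^2 * sqrt (2 * R^2 - 1)"
    using R1 by (simp add: \<open>dist_maj \<sigma> = _\<close> power2_eq_square power3_eq_cube)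
  then show ?thesis
    using \<open>g \<sigma> = _\<close> by (simp add: renorm_maj_def R_def[symmetric] power_mult_distrib)
qed

lemma dist_maj_bounds:
  assumes "0 \<le> \<sigma>"
  shows "1 \<le> dist_maj \<sigma>" "dist_maj \<sigma> ^ 2 = 2 - 1 / inv_dist_maj \<sigma> ^ 2" "dist_maj \<sigma> < 2"
proof -
  have R: "inv_dist_maj \<sigma> \<ge> 1" using inv_dist_maj_ge_1 assms by simp
  then have "1 / inv_dist_maj \<sigma> ^ 2 \<le> 1" "0 < 1 / inv_dist_maj \<sigma> ^ 2" by auto
  then have "1 \<le> 2 - 1 / inv_dist_maj \<sigma> ^ 2" by linarith
  then show "1 \<le> dist_maj \<sigma>" "dist_maj \<sigma> ^ 2 = 2 - 1 / inv_dist_maj \<sigma> ^ 2"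
    unfolding dist_maj_def by (simp_all only: real_sqrt_ge_1_iff, subst real_sqrt_pow2) (linarith, rule refl)
  have "2 - 1 / inv_dist_maj \<sigma> ^ 2 < 2" using \<open>0 < 1 / inv_dist_maj \<sigma> ^ 2\<close> by simp
  then have "2 - 1 / inv_dist_maj \<sigma> ^ 2 < 2^2" by (rule less_trans) simp
  then show "dist_maj \<sigma> < 2" unfolding dist_maj_def
    by (intro real_less_lsqrt) simp_all
qed

lemma dist_maj_mono:
  assumes "0 \<le> \<sigma>" "\<sigma> \<le> \<tau>"
  shows "dist_maj \<sigma> \<le> dist_maj \<tau>"
proof -
  have "1 \<le> inv_dist_maj \<sigma>" "inv_dist_maj \<sigma> \<le> inv_dist_maj \<tau>"
    using assms inv_dist_maj_ge_1 inv_dist_maj_mono by auto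
  then have "1 / inv_dist_maj \<tau> ^ 2 \<le> 1 / inv_dist_maj \<sigma> ^ 2"
    by (intro divide_left_mono power_mono) auto
  then show ?thesis unfolding dist_maj_def by simp
qed

lemma renorm_maj_pos: "0 \<le> \<sigma> \<Longrightarrow> \<sigma> < v_plus \<Longrightarrow> renorm_maj \<sigma> > 0"
  using renorm_slack_pos[of \<sigma>] by (simp add: renorm_maj_def)

lemma dist_maj_deriv:
  assumes "0 \<le> \<sigma>"
  shows "(dist_maj has_real_derivative (1 + \<sigma>) / (dist_maj \<sigma> * inv_dist_maj \<sigma> ^ 3)) (at \<sigma>)"
proof -
  have R: "inv_dist_maj \<sigma> \<ge> 1" using inv_dist_maj_ge_1 assms by simp
  have X: "dist_maj \<sigma> \<ge> 1" using dist_maj_bounds assms by simp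
  have pos: "2 - 1 / inv_dist_maj \<sigma> ^ 2 > 0"
    using dist_maj_bounds[OF assms] by (metis less_le_trans zero_less_one zero_less_power)
  have dR: "(inv_dist_maj has_real_derivative 1 + \<sigma>) (at \<sigma>)"
    unfolding inv_dist_maj_def by (auto intro!: derivative_eq_intros)
  have "((\<lambda>s. 2 - 1 / inv_dist_maj s ^ 2) has_real_derivative
      2 * (1 + \<sigma>) / inv_dist_maj \<sigma> ^ 3) (at \<sigma>)"
    unfolding divide_inverse[of 1] mult_1_left
    by (rule DERIV_cong[OF DERIV_diff[OF DERIV_const DERIV_inverse'[OF DERIV_power[OF dR]]]])
       (use R in \<open>simp_all add: divide_simps power2_eq_square power3_eq_cube\<close>)
  from DERIV_chain2[OF DERIV_real_sqrt[OF pos] this]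
  have "((\<lambda>s. dist_maj s) has_real_derivative
     (1 + \<sigma>) / (dist_maj \<sigma> * inv_dist_maj \<sigma> ^ 3)) (at \<sigma>)"
    unfolding dist_maj_def[symmetric] by (rule DERIV_cong) (use R X in \<open>simp add: field_simps\<close>)
  then show ?thesis by simp
qed

lemma g_pos: "0 \<le> \<sigma> \<Longrightarrow> \<sigma> < v_plus \<Longrightarrow> g \<sigma> > 0"
  using g_conv_majorants[of \<sigma>] renorm_maj_pos[of \<sigma>] dist_maj_bounds(1)[of \<sigma>] inv_dist_maj_ge_1[of \<sigma>]
  by simp

lemma continuous_on_g: "continuous_on {0..} g"
proof -
  have "x^2 + 2*x + 2 > 0" "x^4 + 4*x^3 + 8*x^2 + 8*x + 2 > 0" if "x \<ge> 0" for x :: real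
    using that by (intro add_nonneg_pos add_nonneg_nonneg mult_nonneg_nonneg zero_le_power; simp)+
  then have "x^2 + 2*x + 2 \<noteq> 0" "x^4 + 4*x^3 + 8*x^2 + 8*x + 2 \<noteq> 0" if "x \<in> {0..}" for x :: real
    using that less_irrefl by (metis atLeast_iff)+
  then show ?thesis unfolding g_def by (intro continuous_intros) auto
qed

text \<open>
  The scalar equation \<open>\<sigma>' = 1 / g \<sigma>\<close>, \<open>\<sigma> 0 = 0\<close>, is solved by inverting the primitive of \<open>g\<close>. The
  inverse is defined up to the value of the primitive at \<open>v\<^sub>+\<close>, which is \<open>\<beta>\<close>.
  Differentiability is asserted for positive times only: at \<open>0\<close> the comparison arguments below just need
  continuity.
\<close>

lemma majorant_solution:
  obtains \<sigma> :: "real \<Rightarrow> real" where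
    "beta > 0" "\<sigma> 0 = 0" "continuous_on {0..<beta} \<sigma>" "mono_on {0..<beta} \<sigma>"
    "\<And>t. 0 \<le> t \<Longrightarrow> t < beta \<Longrightarrow> 0 \<le> \<sigma> t \<and> \<sigma> t < v_plus"
    "\<And>t. 0 < t \<Longrightarrow> t < beta \<Longrightarrow>
       (\<sigma> has_real_derivative renorm_maj (\<sigma> t) * dist_maj (\<sigma> t) * inv_dist_maj (\<sigma> t) ^ 3) (at t)"
proof -
  define \<Gamma> where "\<Gamma> = (\<lambda>u. integral {0..u} g)"
  have vp: "v_plus > 0" by (rule v_plus_cubic)
  have cg: "continuous_on {0..v_plus} g"
    by (rule continuous_on_subset[OF continuous_on_g]) auto
  have d\<Gamma>: "(\<Gamma> has_real_derivative g t) (at t within {0..v_plus})" if "t \<in> {0..v_plus}" for t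
    unfolding \<Gamma>_def by (rule integral_has_real_derivative[OF cg that])
  have d\<Gamma>': "(\<Gamma> has_real_derivative g t) (at t)" if "0 < t" "t < v_plus" for t
    using d\<Gamma>[of t] that by (simp add: at_within_Icc_at)
  have c\<Gamma>: "continuous_on {0..v_plus} \<Gamma>"
    using d\<Gamma> by (meson DERIV_continuous_on)
  have \<Gamma>0: "\<Gamma> 0 = 0" by (simp add: \<Gamma>_def)
  have \<Gamma>v: "\<Gamma> v_plus = beta" by (simp add: \<Gamma>_def beta_def)
  have incr: "\<Gamma> a < \<Gamma> b" if "0 \<le> a" "a < b" "b \<le> v_plus" for a b
  proof (rule DERIV_pos_imp_increasing_open[OF \<open>a < b\<close>])
    show "\<exists>y. (\<Gamma> has_real_derivative y) (at x) \<and> 0 < y" if "a < x" "x < b" for x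
      using d\<Gamma>'[of x] g_pos[of x] that \<open>0 \<le> a\<close> \<open>b \<le> v_plus\<close> by auto
    show "continuous_on {a..b} \<Gamma>"
      by (rule continuous_on_subset[OF c\<Gamma>]) (use that in auto)
  qed
  have inj: "inj_on \<Gamma> {0..v_plus}"
    by (rule linorder_inj_onI) (use incr in force)+
  define \<sigma> where "\<sigma> = inv_into {0..v_plus} \<Gamma>"
  have bpos: "beta > 0" using incr[of 0 v_plus] vp \<Gamma>0 \<Gamma>v by simp
  have img: "\<Gamma> ` {0..v_plus} = {0..beta}"
  proof
    have "\<Gamma> x \<in> {0..beta}" if "x \<in> {0..v_plus}" for x
      using incr[of 0 x] incr[of x v_plus] that \<Gamma>0 \<Gamma>v bpos
      by (cases "x = 0"; cases "x = v_plus") auto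
    then show "\<Gamma> ` {0..v_plus} \<subseteq> {0..beta}" by blast
    show "{0..beta} \<subseteq> \<Gamma> ` {0..v_plus}"
    proof
      fix t assume "t \<in> {0..beta}"
      then show "t \<in> \<Gamma> ` {0..v_plus}"
        using IVT'[of \<Gamma> 0 t v_plus] c\<Gamma> \<Gamma>0 \<Gamma>v vp by auto
    qed
  qed
  have \<sigma>\<Gamma>: "\<sigma> (\<Gamma> x) = x" if "x \<in> {0..v_plus}" for x
    unfolding \<sigma>_def using inj that by simp
  have \<Gamma>\<sigma>: "\<Gamma> (\<sigma> t) = t" "\<sigma> t \<in> {0..v_plus}" if "t \<in> {0..beta}" for t
    unfolding \<sigma>_def using that unfolding img[symmetric] by (rule f_inv_into_f inv_into_into)+
  have cs: "continuous_on {0..beta} \<sigma>"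
    using continuous_on_inv[OF c\<Gamma> compact_Icc, of \<sigma>] \<sigma>\<Gamma> unfolding img by blast
  have smono: "\<sigma> s < \<sigma> t" if "0 \<le> s" "s < t" "t \<le> beta" for s t
  proof (rule ccontr)
    assume "\<not> \<sigma> s < \<sigma> t"
    then show False using incr[of "\<sigma> t" "\<sigma> s"] \<Gamma>\<sigma>[of s] \<Gamma>\<sigma>[of t] that
      by (cases "\<sigma> s = \<sigma> t") auto
  qed
  have s0: "\<sigma> 0 = 0" using \<sigma>\<Gamma>[of 0] vp \<Gamma>0 by simp
  have sv: "\<sigma> beta = v_plus" using \<sigma>\<Gamma>[of v_plus] vp \<Gamma>v by simp
  have rng: "0 \<le> \<sigma> t \<and> \<sigma> t < v_plus" if "0 \<le> t" "t < beta" for t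
    using \<Gamma>\<sigma>(2)[of t] smono[of t beta] that sv by auto
  show ?thesis
  proof (rule that[of \<sigma>])
    show "beta > 0" "\<sigma> 0 = 0" by (fact bpos s0)+
    show "0 \<le> \<sigma> t \<and> \<sigma> t < v_plus" if "0 \<le> t" "t < beta" for t by (rule rng[OF that])
    show "continuous_on {0..<beta} \<sigma>"
      by (rule continuous_on_subset[OF cs]) auto
    show "mono_on {0..<beta} \<sigma>"
      by (rule strict_mono_on_imp_mono_on, rule strict_mono_onI) (simp add: smono)
    fix t assume t: "0 < t" "t < beta"
    have st: "0 < \<sigma> t" "\<sigma> t < v_plus" using smono[of 0 t] t s0 rng[of t] by auto
    have "(\<sigma> has_real_derivative inverse (g (\<sigma> t))) (at t)"
    proof (rule DERIV_inverse_function[where a=0 and b=beta])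
      show "(\<Gamma> has_real_derivative g (\<sigma> t)) (at (\<sigma> t))" by (rule d\<Gamma>'[OF st])
      show "g (\<sigma> t) \<noteq> 0" using g_pos[of "\<sigma> t"] st by simp
      show "isCont \<sigma> t"
        using continuous_on_interior[OF cs, of t] t by simp
    qed (use t \<Gamma>\<sigma> in auto)
    then show "(\<sigma> has_real_derivative renorm_maj (\<sigma> t) * dist_maj (\<sigma> t) * inv_dist_maj (\<sigma> t) ^ 3) (at t)"
      using g_conv_majorants[of "\<sigma> t"] st by (simp add: inverse_eq_divide)
  qed
qed

section \<open>Initial value problems with confining sets\<close>

text \<open>
  The mean value inequality on the segment from \<open>0\<close> to \<open>z\<close>: bounds on a derivative that depend on
  \<open>|z|\<close> only integrate to bounds that depend on \<open>|z|\<close> only. It carries majorants from the vector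
  field over to the Picard iterates.
\<close>

lemma radial_bound:
  fixes h :: "complex \<Rightarrow> 'a::real_normed_vector" and \<phi> :: "real \<Rightarrow> real"
  assumes der: "\<And>z. z \<in> ball 0 r \<Longrightarrow> (h has_derivative h' z) (at z)"
    and cont: "continuous_on {0..<r} \<phi>"
    and der\<phi>: "\<And>t. 0 < t \<Longrightarrow> t < r \<Longrightarrow> (\<phi> has_real_derivative \<phi>' t) (at t)"
    and le: "\<And>z v. z \<in> ball 0 r \<Longrightarrow> z \<noteq> 0 \<Longrightarrow> norm (h' z v) \<le> cmod v * \<phi>' (cmod z)"
    and z: "z \<in> ball 0 r"
  shows "norm (h z - h 0) \<le> \<phi> (cmod z) - \<phi> 0"
proof (cases "z = 0")
  case False
  define u where "u = z / of_real (cmod z)"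
  have u: "cmod u = 1" "of_real (cmod z) * u = z" using False by (auto simp: u_def norm_divide)
  have inb: "of_real t * u \<in> ball 0 r" if "0 \<le> t" "t \<le> cmod z" for t
    using that z u by (simp add: norm_mult)
  have d: "((\<lambda>t. h (of_real t * u)) has_vector_derivative h' (of_real t * u) u) (at t)"
    if "0 \<le> t" "t \<le> cmod z" for t
  proof -
    have d1: "((\<lambda>t. of_real t * u) has_derivative (\<lambda>x. of_real x * u)) (at t)"
      by (auto intro!: derivative_eq_intros)
    have lin: "linear (h' (of_real t * u))"
      using der[OF inb[OF that]] has_derivative_linear by blast
    have "h' (of_real t * u) (of_real x * u) = x *\<^sub>R h' (of_real t * u) u" for x
      using linear_scale[OF lin, of x u] by (simp add: scaleR_conv_of_real)
    then show ?thesis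
      using has_derivative_compose[OF d1 der[OF inb[OF that]]] by (simp add: has_vector_derivative_def)
  qed
  have "norm (h (of_real (cmod z) * u) - h (of_real 0 * u)) \<le> \<phi> (cmod z) - \<phi> 0"
  proof (rule differentiable_bound_general[where f="\<lambda>t. h (of_real t * u)" and \<phi>'=\<phi>'
        and f'="\<lambda>t. h' (of_real t * u) u"])
    show "0 < cmod z" using False by simp
    show "continuous_on {0..cmod z} (\<lambda>t. h (of_real t * u))"
      by (rule continuous_at_imp_continuous_on) (use d has_vector_derivative_continuous in force)
    show "continuous_on {0..cmod z} \<phi>"
      by (rule continuous_on_subset[OF cont]) (use z in auto)
    fix t assume t: "0 < t" "t < cmod z"
    show "((\<lambda>t. h (of_real t * u)) has_vector_derivative h' (of_real t * u) u) (at t)"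
      using d[of t] t by simp
    show "(\<phi> has_vector_derivative \<phi>' t) (at t)"
      using der\<phi>[of t] t z by (simp add: has_real_derivative_iff_has_vector_derivative)
    show "norm (h' (of_real t * u) u) \<le> \<phi>' t"
    proof -
      have "of_real t * u \<noteq> 0" using t u by auto
      moreover have "cmod (of_real t * u) = t" using t u by (simp add: norm_mult)
      ultimately show ?thesis using le[OF inb[of t], of u] t u by simp
    qed
  qed
  then show ?thesis using u by simp
qed simp

lemma holomorphic_Picard_step:
  fixes F :: "('i \<Rightarrow> complex) \<Rightarrow> 'i \<Rightarrow> complex"
  assumes hol: "\<And>k. k \<in> I \<Longrightarrow> (\<lambda>z. F (x z) k) holomorphic_on ball 0 r"
  obtains y where "\<And>k z. k \<in> I \<Longrightarrow> z \<in> ball 0 r \<Longrightarrow> ((\<lambda>z. y z k) has_field_derivative F (x z) k) (at z)"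
    "\<And>k. k \<in> I \<Longrightarrow> y 0 k = x0 k"
proof -
  have "\<exists>p. \<forall>z\<in>ball 0 r. (p has_field_derivative F (x z) k) (at z)" if k: "k \<in> I" for k
  proof -
    obtain p where p: "\<And>z. z \<in> ball 0 r \<Longrightarrow> (p has_field_derivative F (x z) k) (at z within ball 0 r)"
      using holomorphic_convex_primitive'[where f="\<lambda>z. F (x z) k" and S="ball 0 r"] hol[OF k] by auto
    then show ?thesis
      by (metis at_within_open open_ball)
  qed
  then obtain p where p: "\<And>k z. k \<in> I \<Longrightarrow> z \<in> ball 0 r \<Longrightarrow> (p k has_field_derivative F (x z) k) (at z)"
    by metis
  show ?thesis
  proof (rule that[of "\<lambda>z k. p k z - p k 0 + x0 k"])
    show "((\<lambda>z. p k z - p k 0 + x0 k) has_field_derivative F (x z) k) (at z)"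
      if "k \<in> I" "z \<in> ball 0 r" for k z
      using p[OF that] by (auto intro!: derivative_eq_intros)
  qed auto
qed

text \<open>
  Picard iteration in the space of holomorphic functions on a disc. Instead of shortening the disc until
  the iteration is a contraction, one prescribes for each \<open>z\<close> a set \<open>D z\<close> of admissible states that the
  iteration respects; a Lipschitz constant on each smaller closed disc is then enough for convergence on
  the whole disc. The sets may depend on \<open>z\<close> itself and not just on \<open>|z|\<close>, so that
  reality on the real axis can be made part of the invariant.
\<close>

proposition holomorphic_Picard:
  fixes F :: "('i \<Rightarrow> complex) \<Rightarrow> 'i \<Rightarrow> complex" and x0 :: "'i \<Rightarrow> complex"
    and D :: "complex \<Rightarrow> ('i \<Rightarrow> complex) set"
  assumes fin: "finite I" and r: "r > 0"
    and start: "\<And>z. z \<in> ball 0 r \<Longrightarrow> x0 \<in> D z"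
    and hol: "\<And>x k. \<lbrakk>\<And>k. k \<in> I \<Longrightarrow> (\<lambda>z. x z k) holomorphic_on ball 0 r;
        \<And>z. z \<in> ball 0 r \<Longrightarrow> x z \<in> D z; k \<in> I\<rbrakk> \<Longrightarrow> (\<lambda>z. F (x z) k) holomorphic_on ball 0 r"
    and inv: "\<And>x y z. \<lbrakk>\<And>z. z \<in> ball 0 r \<Longrightarrow> x z \<in> D z;
        \<And>k z. k \<in> I \<Longrightarrow> z \<in> ball 0 r \<Longrightarrow> ((\<lambda>z. y z k) has_field_derivative F (x z) k) (at z);
        \<And>k. k \<in> I \<Longrightarrow> y 0 k = x0 k; z \<in> ball 0 r\<rbrakk> \<Longrightarrow> y z \<in> D z"
    and lip: "\<And>\<rho>. \<lbrakk>0 < \<rho>; \<rho> < r\<rbrakk> \<Longrightarrow> \<exists>L. \<forall>z\<in>cball 0 \<rho>. \<forall>x\<in>D z. \<forall>y\<in>D z. \<forall>k\<in>I.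
        norm (F x k - F y k) \<le> L * (\<Sum>i\<in>I. norm (x i - y i))"
    and closed: "\<And>X x z. \<lbrakk>z \<in> ball 0 r; \<And>n. X n \<in> D z; \<And>k. k \<in> I \<Longrightarrow> (\<lambda>n. X n k) \<longlonglongrightarrow> x k\<rbrakk> \<Longrightarrow> x \<in> D z"
  obtains y where "\<And>z. z \<in> ball 0 r \<Longrightarrow> y z \<in> D z" "\<And>k. k \<in> I \<Longrightarrow> y 0 k = x0 k"
    "\<And>k z. k \<in> I \<Longrightarrow> z \<in> ball 0 r \<Longrightarrow> ((\<lambda>z. y z k) has_field_derivative F (y z) k) (at z)"
proof -
  define good where "good = (\<lambda>x :: complex \<Rightarrow> 'i \<Rightarrow> complex.
     (\<forall>k\<in>I. (\<lambda>z. x z k) holomorphic_on ball 0 r \<and> x 0 k = x0 k) \<and> (\<forall>z\<in>ball 0 r. x z \<in> D z))"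
  define step where "step = (\<lambda>(x :: complex \<Rightarrow> 'i \<Rightarrow> complex) y.
     \<forall>k\<in>I. \<forall>z\<in>ball 0 r. ((\<lambda>z. y z k) has_field_derivative F (x z) k) (at z))"
  have "\<exists>X. \<forall>n. good (X n) \<and> step (X n) (X (Suc n))"
  proof (rule dependent_nat_choice)
    show "\<exists>x. good x" by (rule exI[of _ "\<lambda>z. x0"]) (auto simp: good_def start)
    fix x and n :: nat assume x: "good x"
    obtain y where y: "\<And>k z. k \<in> I \<Longrightarrow> z \<in> ball 0 r \<Longrightarrow> ((\<lambda>z. y z k) has_field_derivative F (x z) k) (at z)"
       "\<And>k. k \<in> I \<Longrightarrow> y 0 k = x0 k"
      using holomorphic_Picard_step[of I F x r x0] hol x unfolding good_def by blast
    have "good y" unfolding good_def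
    proof (intro conjI ballI)
      fix k assume k: "k \<in> I"
      show "(\<lambda>z. y z k) holomorphic_on ball 0 r" using y(1)[OF k] holomorphic_on_open open_ball by blast
      show "y 0 k = x0 k" using y(2) k by simp
    next
      fix z :: complex assume z: "z \<in> ball 0 r"
      show "y z \<in> D z" by (rule inv[OF _ y z]) (use x good_def in blast)+
    qed
    moreover have "step x y" using y by (simp add: step_def)
    ultimately show "\<exists>y. good y \<and> step x y" by blast
  qed
  then obtain X where X: "\<And>n. good (X n)" "\<And>n. step (X n) (X (Suc n))" by blast
  have XD: "X n z \<in> D z" if "z \<in> ball 0 r" for n z using X(1) that by (simp add: good_def)
  have Xd: "((\<lambda>z. X (Suc n) z k) has_field_derivative F (X n z) k) (at z)"
    if "k \<in> I" "z \<in> ball 0 r" for n k z using X(2) that by (simp add: step_def)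
  have X0: "X n 0 k = x0 k" if "k \<in> I" for n k using X(1) that by (simp add: good_def)
  have Xhol: "(\<lambda>z. X n z k) holomorphic_on ball 0 r" if "k \<in> I" for n k
    using X(1) that by (simp add: good_def)

  have geometric: "\<exists>C. \<forall>n. \<forall>k\<in>I. \<forall>z\<in>ball 0 \<rho>. norm (X (Suc n) z k - X n z k) \<le> C * (1/2)^n"
    if \<rho>: "0 < \<rho>" "\<rho> < r" for \<rho>
  proof -
    obtain L0 where L0: "\<And>z x y k. \<lbrakk>z \<in> cball 0 \<rho>; x \<in> D z; y \<in> D z; k \<in> I\<rbrakk> \<Longrightarrow>
        norm (F x k - F y k) \<le> L0 * (\<Sum>i\<in>I. norm (x i - y i))"
      using lip[OF \<rho>] by meson
    define L where "L = max L0 1"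
    have L: "norm (F x k - F y k) \<le> L * (\<Sum>i\<in>I. norm (x i - y i))"
      if "z \<in> cball 0 \<rho>" "x \<in> D z" "y \<in> D z" "k \<in> I" for z x y k
    proof -
      have "L0 * (\<Sum>i\<in>I. norm (x i - y i)) \<le> L * (\<Sum>i\<in>I. norm (x i - y i))"
        by (intro mult_right_mono) (auto simp: L_def sum_nonneg)
      then show ?thesis using L0[OF that] by linarith
    qed
    (* The factor 2 makes the weight exp (a |z|) gain 1/2 at every step, uniformly on the disc. *)
    define a where "a = 2 * L * (real (card I) + 1)"
    have apos: "a > 0" unfolding a_def L_def by (simp add: max_def add_nonneg_pos)
    have "\<exists>C. \<forall>k\<in>I. \<forall>z\<in>cball 0 \<rho>. norm (X (Suc 0) z k - X 0 z k) \<le> C"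
    proof -
      have "\<exists>C. \<forall>z\<in>cball 0 \<rho>. norm (X (Suc 0) z k - X 0 z k) \<le> C" if "k \<in> I" for k
      proof -
        have "continuous_on (cball 0 \<rho>) (\<lambda>z. X (Suc 0) z k - X 0 z k)"
          using \<rho> that by (intro continuous_intros holomorphic_on_imp_continuous_on
              holomorphic_on_subset[OF Xhol]) auto
        then have "bounded ((\<lambda>z. X (Suc 0) z k - X 0 z k) ` cball 0 \<rho>)"
          by (intro compact_imp_bounded compact_continuous_image) auto
        then show ?thesis unfolding bounded_iff by auto
      qed
      then obtain C where C: "\<And>k z. k \<in> I \<Longrightarrow> z \<in> cball 0 \<rho> \<Longrightarrow> norm (X (Suc 0) z k - X 0 z k) \<le> C k"
        by metis
      have "norm (X (Suc 0) z k - X 0 z k) \<le> (\<Sum>k\<in>I. \<bar>C k\<bar>)" if "k \<in> I" "z \<in> cball 0 \<rho>" for k z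
        using C[OF that] member_le_sum[OF that(1), of "\<lambda>k. \<bar>C k\<bar>"] fin by fastforce
      then show ?thesis by blast
    qed
    then obtain C0 where C0: "\<And>k z. k \<in> I \<Longrightarrow> z \<in> cball 0 \<rho> \<Longrightarrow> norm (X (Suc 0) z k - X 0 z k) \<le> C0"
      by blast
    define C where "C = max C0 0"
    have *: "norm (X (Suc n) z k - X n z k) \<le> C * (1/2)^n * exp (a * cmod z)"
      if "k \<in> I" "z \<in> ball 0 \<rho>" for n k z
      using that
    proof (induction n arbitrary: k z)
      case 0
      have "norm (X (Suc 0) z k - X 0 z k) \<le> C * 1" using C0[of k z] 0 by (simp add: C_def)
      also have "C * 1 \<le> C * exp (a * cmod z)" using apos by (intro mult_left_mono) (auto simp: C_def)
      finally show ?case by simp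
    next
      case (Suc n)
      define h where "h = (\<lambda>z. X (Suc (Suc n)) z k - X (Suc n) z k)"
      have dh: "(h has_derivative (\<lambda>v. (F (X (Suc n) w) k - F (X n w) k) * v)) (at w)"
        if "w \<in> ball 0 \<rho>" for w
      proof -
        have "(h has_field_derivative (F (X (Suc n) w) k - F (X n w) k)) (at w)"
          unfolding h_def using that \<rho> Suc.prems by (intro DERIV_diff Xd) auto
        then show ?thesis by (simp add: has_field_derivative_def)
      qed
      define \<phi> where "\<phi> = (\<lambda>t. C * (1/2)^(Suc n) * exp (a * t))"
      have "norm (h z - h 0) \<le> \<phi> (cmod z) - \<phi> 0"
      proof (rule radial_bound[OF dh, where \<phi>'="\<lambda>t. C * (1/2)^(Suc n) * (a * exp (a * t))"])
        show "continuous_on {0..<\<rho>} \<phi>" unfolding \<phi>_def by (intro continuous_intros)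
        show "(\<phi> has_real_derivative C * (1/2)^(Suc n) * (a * exp (a * t))) (at t)" for t
          unfolding \<phi>_def by (auto intro!: derivative_eq_intros)
        fix w v :: complex assume w: "w \<in> ball 0 \<rho>"
        have "norm (F (X (Suc n) w) k - F (X n w) k) \<le> L * (\<Sum>i\<in>I. norm (X (Suc n) w i - X n w i))"
          using w \<rho> Suc.prems by (intro L[of w] XD) auto
        also have "\<dots> \<le> L * (\<Sum>i\<in>I. C * (1/2)^n * exp (a * cmod w))"
          using Suc.IH w by (intro mult_left_mono sum_mono) (auto simp: L_def)
        also have "\<dots> = (real (card I) * L) * (C * (1/2)^n * exp (a * cmod w))" by simp
        also have "\<dots> \<le> (a / 2) * (C * (1/2)^n * exp (a * cmod w))"
          by (intro mult_right_mono) (auto simp: a_def C_def L_def algebra_simps)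
        also have "\<dots> = C * (1/2)^(Suc n) * (a * exp (a * cmod w))" by simp
        finally show "norm ((F (X (Suc n) w) k - F (X n w) k) * v)
            \<le> cmod v * (C * (1/2)^(Suc n) * (a * exp (a * cmod w)))"
          unfolding norm_mult by (subst mult.commute) (rule mult_left_mono, auto)
      qed (use Suc.prems in auto)
      moreover have "h 0 = 0" using X0 Suc.prems by (simp add: h_def)
      moreover have "\<phi> 0 \<ge> 0" by (simp add: \<phi>_def C_def)
      ultimately show ?case by (simp add: h_def \<phi>_def)
    qed
    have "norm (X (Suc n) z k - X n z k) \<le> (C * exp (a * \<rho>)) * (1/2)^n"
      if "k \<in> I" "z \<in> ball 0 \<rho>" for n k z
    proof -
      have "C * (1/2)^n * exp (a * cmod z) \<le> C * (1/2)^n * exp (a * \<rho>)"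
        using that apos by (intro mult_left_mono) (auto simp: C_def)
      then show ?thesis using *[OF that, of n] by (simp add: mult_ac)
    qed
    then show ?thesis by blast
  qed

  define y where "y = (\<lambda>z k. X 0 z k + (\<Sum>i. X (Suc i) z k - X i z k))"
  have ulim: "uniform_limit (ball 0 \<rho>) (\<lambda>n z. X n z k) (\<lambda>z. y z k) sequentially"
    if \<rho>: "0 < \<rho>" "\<rho> < r" and k: "k \<in> I" for \<rho> k
  proof -
    obtain C where C: "\<And>n z. z \<in> ball 0 \<rho> \<Longrightarrow> norm (X (Suc n) z k - X n z k) \<le> C * (1/2)^n"
      using geometric[OF \<rho>] k by blast
    have "uniform_limit (ball 0 \<rho>) (\<lambda>n z. \<Sum>i<n. X (Suc i) z k - X i z k)
       (\<lambda>z. \<Sum>i. X (Suc i) z k - X i z k) sequentially"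
      by (rule Weierstrass_m_test[OF C]) (auto intro!: summable_mult summable_geometric)
    then have "uniform_limit (ball 0 \<rho>) (\<lambda>n z. X 0 z k + (\<Sum>i<n. X (Suc i) z k - X i z k))
       (\<lambda>z. X 0 z k + (\<Sum>i. X (Suc i) z k - X i z k)) sequentially"
      by (intro uniform_limit_intros)
    moreover have "X 0 z k + (\<Sum>i<n. X (Suc i) z k - X i z k) = X n z k" for n z
      by (simp add: sum_lessThan_telescope[of "\<lambda>n. X n z k"])
    ultimately show ?thesis by (simp only: y_def)
  qed
  have inside: "cmod z < (cmod z + r) / 2" "0 < (cmod z + r) / 2" "(cmod z + r) / 2 < r"
    if "z \<in> ball 0 r" for z
    using that r by (auto simp: add_nonneg_pos)
  have lim: "(\<lambda>n. X n z k) \<longlonglongrightarrow> y z k" if "k \<in> I" "z \<in> ball 0 r" for k z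
    using tendsto_uniform_limitI[OF ulim[OF inside(2,3) that(1)], of z z] inside(1) that by simp
  have yD: "y z \<in> D z" if "z \<in> ball 0 r" for z
    by (rule closed[OF that XD[OF that] lim]) (use that in auto)
  have Flim: "(\<lambda>n. F (X n z) k) \<longlonglongrightarrow> F (y z) k" if k: "k \<in> I" and z: "z \<in> ball 0 r" for k z
  proof -
    obtain L where "\<forall>z\<in>cball 0 ((cmod z + r) / 2). \<forall>x\<in>D z. \<forall>y\<in>D z. \<forall>k\<in>I.
        norm (F x k - F y k) \<le> L * (\<Sum>i\<in>I. norm (x i - y i))"
      using lip[OF inside(2,3)[OF z]] by blast
    moreover have "z \<in> cball 0 ((cmod z + r) / 2)" using inside(1)[OF z] by simp
    ultimately have L: "norm (F x k - F y k) \<le> L * (\<Sum>i\<in>I. norm (x i - y i))"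
      if "x \<in> D z" "y \<in> D z" for x y using that k by blast
    have "(\<lambda>n. L * (\<Sum>i\<in>I. norm (X n z i - y z i))) \<longlonglongrightarrow> L * (\<Sum>i\<in>I. norm (y z i - y z i))"
      by (intro tendsto_intros lim z)
    then have "(\<lambda>n. L * (\<Sum>i\<in>I. norm (X n z i - y z i))) \<longlonglongrightarrow> 0" by simp
    then have "(\<lambda>n. F (X n z) k - F (y z) k) \<longlonglongrightarrow> 0"
      by (rule Lim_null_comparison[rotated]) (intro always_eventually allI L XD yD z)
    then show ?thesis by (simp add: LIM_zero_iff)
  qed
  show ?thesis
  proof (rule that[of y])
    show "y 0 k = x0 k" if "k \<in> I" for k
      using lim[OF that, of 0] r by (simp add: X0[OF that] LIMSEQ_const_iff)
    fix k and z :: complex assume k: "k \<in> I" and z: "z \<in> ball 0 r"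
    have "\<exists>g'. \<forall>z\<in>ball 0 r. ((\<lambda>z. y z k) has_field_derivative g' z) (at z) \<and> (\<lambda>n. F (X n z) k) \<longlonglongrightarrow> g' z"
    proof (rule has_complex_derivative_uniform_sequence[OF open_ball, where f="\<lambda>n z. X (Suc n) z k"])
      fix z :: complex assume z: "z \<in> ball 0 r"
      obtain d where d: "d > 0" "cball z d \<subseteq> ball 0 ((cmod z + r) / 2)"
        using open_contains_cball_eq[OF open_ball[of 0 "(cmod z + r) / 2"]] inside(1)[OF z]
        by (metis mem_ball_0)
      have "uniform_limit (cball z d) (\<lambda>n z. X n z k) (\<lambda>z. y z k) sequentially"
        by (rule uniform_limit_on_subset[OF ulim[OF inside(2,3)[OF z] k] d(2)])
      then have "uniform_limit (cball z d) (\<lambda>n z. X (Suc n) z k) (\<lambda>z. y z k) sequentially"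
        by (rule filterlim_compose[OF _ filterlim_Suc])
      then show "\<exists>d>0. cball z d \<subseteq> ball 0 r \<and>
          uniform_limit (cball z d) (\<lambda>n z. X (Suc n) z k) (\<lambda>z. y z k) sequentially"
        using d inside(3)[OF z] subset_ball[of "(cmod z + r) / 2" r 0] by (intro exI[of _ d]) auto
    qed (use Xd k in auto)
    then obtain d where d: "((\<lambda>z. y z k) has_field_derivative d) (at z)" "(\<lambda>n. F (X n z) k) \<longlonglongrightarrow> d"
      using z by blast
    then show "((\<lambda>z. y z k) has_field_derivative F (y z) k) (at z)"
      using LIMSEQ_unique[OF d(2) Flim[OF k z]] by simp
  qed (rule yD)
qed

text \<open>
  On an interval of length \<open>\<epsilon>\<close> around \<open>a\<close>, the largest distance \<open>e s\<close> of two solutions satisfies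
  \<open>e s \<le> L card I \<epsilon> e s\<close>; for small \<open>\<epsilon>\<close> this forces \<open>e s = 0\<close>.
\<close>

lemma ode_locally_unique:
  fixes x y :: "real \<Rightarrow> 'i \<Rightarrow> complex"
  assumes fin: "finite I" and \<delta>: "\<delta> > 0"
    and lip: "\<And>u v k. \<lbrakk>u \<in> D; v \<in> D; k \<in> I\<rbrakk> \<Longrightarrow> norm (F u k - F v k) \<le> L * (\<Sum>i\<in>I. norm (u i - v i))"
    and inD: "\<And>t. \<bar>t - a\<bar> < \<delta> \<Longrightarrow> x t \<in> D \<and> y t \<in> D"
    and dx: "\<And>t k. \<lbrakk>\<bar>t - a\<bar> < \<delta>; k \<in> I\<rbrakk> \<Longrightarrow> ((\<lambda>t. x t k) has_vector_derivative F (x t) k) (at t)"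
    and dy: "\<And>t k. \<lbrakk>\<bar>t - a\<bar> < \<delta>; k \<in> I\<rbrakk> \<Longrightarrow> ((\<lambda>t. y t k) has_vector_derivative F (y t) k) (at t)"
    and init: "\<And>k. k \<in> I \<Longrightarrow> x a k = y a k"
  obtains \<epsilon> where "\<epsilon> > 0" "\<And>t k. \<bar>t - a\<bar> < \<epsilon> \<Longrightarrow> k \<in> I \<Longrightarrow> x t k = y t k"
proof -
  define c where "c = \<bar>L\<bar> * real (card I) + 1"
  have c: "c > 0" by (simp add: c_def add_nonneg_pos)
  (* With this choice c times \<epsilon> is at most 1/2, and \<bar>L\<bar> * card I < c. *)
  define \<epsilon> where "\<epsilon> = min (\<delta> / 2) (1 / (2 * c))"
  have \<epsilon>: "\<epsilon> > 0" "\<epsilon> < \<delta>" "\<epsilon> \<le> 1 / (2 * c)" using \<delta> c by (auto simp: \<epsilon>_def)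
  define e where "e = (\<lambda>t. \<Sum>k\<in>I. norm (x t k - y t k))"
  have near: "\<bar>t - a\<bar> < \<delta>" if "t \<in> cball a \<epsilon>" for t
    using that \<epsilon> by (simp add: dist_real_def abs_minus_commute)
  have "continuous_on (cball a \<epsilon>) (\<lambda>t. x t k - y t k)" if "k \<in> I" for k
    by (intro continuous_at_imp_continuous_on ballI continuous_diff
         has_vector_derivative_continuous[OF dx] has_vector_derivative_continuous[OF dy] near that)
  then have "continuous_on (cball a \<epsilon>) e"
    unfolding e_def by (intro continuous_on_sum continuous_on_norm)
  then obtain s where s: "s \<in> cball a \<epsilon>" "\<And>t. t \<in> cball a \<epsilon> \<Longrightarrow> e t \<le> e s"
    using continuous_attains_sup[of "cball a \<epsilon>" e] \<epsilon> by auto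
  have e0: "e t \<ge> 0" for t by (simp add: e_def sum_nonneg)
  have bound: "norm (x t k - y t k) \<le> \<bar>L\<bar> * e s * \<epsilon>" if k: "k \<in> I" and t: "t \<in> cball a \<epsilon>" for k t
  proof -
    have "norm ((x t k - y t k) - (x a k - y a k)) \<le> \<bar>L\<bar> * e s * norm (t - a)"
    proof (rule differentiable_bound[where S="cball a \<epsilon>"
          and f'="\<lambda>u h. h *\<^sub>R (F (x u) k - F (y u) k)"])
      fix u assume u: "u \<in> cball a \<epsilon>"
      have "((\<lambda>t. x t k - y t k) has_vector_derivative (F (x u) k - F (y u) k)) (at u)"
        by (intro has_vector_derivative_diff dx dy near u k)
      then show "((\<lambda>t. x t k - y t k) has_derivative (\<lambda>h. h *\<^sub>R (F (x u) k - F (y u) k)))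
          (at u within cball a \<epsilon>)"
        unfolding has_vector_derivative_def by (rule has_derivative_at_withinI)
      have "norm (F (x u) k - F (y u) k) \<le> L * e u"
        unfolding e_def using inD[OF near[OF u]] k by (intro lip) auto
      also have "\<dots> \<le> \<bar>L\<bar> * e s" using s(2)[OF u] e0 by (intro mult_mono) auto
      finally show "onorm (\<lambda>h. h *\<^sub>R (F (x u) k - F (y u) k)) \<le> \<bar>L\<bar> * e s"
        by (intro onorm_le) (simp add: mult.commute mult_left_mono)
    qed (use t \<epsilon> in auto)
    also have "\<dots> \<le> \<bar>L\<bar> * e s * \<epsilon>"
      using t e0[of s] by (intro mult_left_mono) (auto simp: dist_real_def abs_minus_commute)
    finally show ?thesis using init[OF k] by simp
  qed
  have "e s \<le> (\<Sum>k\<in>I. \<bar>L\<bar> * e s * \<epsilon>)" by (subst e_def) (intro sum_mono bound s(1))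
  also have "\<dots> = (\<bar>L\<bar> * real (card I)) * e s * \<epsilon>" by simp
  also have "\<dots> \<le> c * e s * (1 / (2 * c))"
    using e0[of s] \<epsilon> c by (intro mult_mono) (auto simp: c_def)
  also have "\<dots> = e s / 2" using c by simp
  finally have es: "e s = 0" using e0[of s] by simp
  show ?thesis
  proof (rule that[OF \<epsilon>(1)])
    fix t k assume "\<bar>t - a\<bar> < \<epsilon>" "k \<in> I"
    then show "x t k = y t k"
      using bound[of k t] es by (simp add: dist_real_def abs_minus_commute)
  qed
qed

section \<open>Majorants for complex numbers\<close>

text \<open>
  A complex number \<open>a\<close> perturbs a real number \<open>c\<close> by at most \<open>A - c\<close>. This form of the estimate, rather
  than a bound on the error itself, is compatible with sums, products and \<open>1 / \<surd>\<close>: apply the same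
  operations to \<open>c\<close> and \<open>A\<close>, with the reflection \<open>c - (A - c)\<close> in place of \<open>A\<close> under \<open>1 / \<surd>\<close>.
\<close>

definition majorized :: "complex \<Rightarrow> real \<Rightarrow> real \<Rightarrow> bool" where
  "majorized a c A \<longleftrightarrow> cmod (a - of_real c) \<le> A - c"

lemma majorized_le: "majorized a c A \<Longrightarrow> c \<le> A"
  unfolding majorized_def using norm_ge_zero[of "a - of_real c"] by linarith

lemma majorized_norm_le: "majorized a c A \<Longrightarrow> c \<ge> 0 \<Longrightarrow> cmod a \<le> A"
  unfolding majorized_def using norm_triangle_sub[of a "of_real c"] by simp

lemma majorized_mono: "majorized a c A \<Longrightarrow> A \<le> B \<Longrightarrow> majorized a c B"
  by (simp add: majorized_def)

lemma majorized_of_real: "majorized (of_real c) c c"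
  by (simp add: majorized_def)

lemma majorized_add: "majorized a c A \<Longrightarrow> majorized b d B \<Longrightarrow> majorized (a + b) (c + d) (A + B)"
  unfolding majorized_def using norm_triangle_ineq[of "a - of_real c" "b - of_real d"]
  by (simp add: algebra_simps)

lemma majorized_sum:
  "(\<And>i. i \<in> I \<Longrightarrow> majorized (a i) (c i) (A i)) \<Longrightarrow> majorized (sum a I) (sum c I) (sum A I)"
  by (induction I rule: infinite_finite_induct)
     (auto simp: majorized_add majorized_of_real[of 0, simplified])

lemma majorized_mult:
  assumes a: "majorized a c A" and b: "majorized b d B" and "c \<ge> 0" "d \<ge> 0"
  shows "majorized (a * b) (c * d) (A * B)"
proof -
  have "a * b - of_real (c * d) = (a - of_real c) * (b - of_real d)
      + of_real c * (b - of_real d) + of_real d * (a - of_real c)"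
    by (simp add: algebra_simps)
  also have "cmod \<dots> \<le> cmod (a - of_real c) * cmod (b - of_real d)
      + c * cmod (b - of_real d) + d * cmod (a - of_real c)"
    using assms(3,4) by (intro norm_triangle_le add_mono) (auto simp: norm_mult)
  also have "\<dots> \<le> (A - c) * (B - d) + c * (B - d) + d * (A - c)"
    using assms majorized_le[OF a] majorized_le[OF b] unfolding majorized_def
    by (intro add_mono mult_mono mult_left_mono) auto
  also have "\<dots> = A * B - c * d" by (simp add: algebra_simps)
  finally show ?thesis by (simp add: majorized_def)
qed

lemma majorized_power: "majorized a c A \<Longrightarrow> c \<ge> 0 \<Longrightarrow> majorized (a ^ n) (c ^ n) (A ^ n)"
  by (induction n) (auto simp: majorized_mult majorized_of_real[of 1, simplified])

text \<open>
  The holomorphic version of \<open>1 / \<surd>x\<close> in which all distances and the renormalization are expressed.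
\<close>

definition rsqrt :: "complex \<Rightarrow> complex" where
  "rsqrt z = 1 / csqrt z"

lemma rsqrt_of_real: "x \<ge> 0 \<Longrightarrow> rsqrt (of_real x) = of_real (1 / sqrt x)"
  by (simp add: rsqrt_def csqrt_of_real)

lemma Re_csqrt_ge:
  assumes "0 \<le> c" "c \<le> Re z"
  shows "sqrt c \<le> Re (csqrt z)"
proof -
  have "c \<le> (cmod z + Re z) / 2" using assms complex_Re_le_cmod[of z] by simp
  then have "sqrt c \<le> sqrt ((cmod z + Re z) / 2)" by simp
  then show ?thesis by simp
qed

lemma rsqrt_diff:
  assumes "Re a > 0" "Re b > 0"
  shows "rsqrt a - rsqrt b = (b - a) * rsqrt a * rsqrt b / (csqrt a + csqrt b)"
proof -
  have nz: "csqrt a \<noteq> 0" "csqrt b \<noteq> 0" using assms by auto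
  have "Re (csqrt a) > 0" "Re (csqrt b) > 0"
    using Re_csqrt_ge[of "Re a" a] Re_csqrt_ge[of "Re b" b] assms
    by (meson less_le_trans order_refl real_sqrt_gt_zero less_imp_le)+
  then have nz': "csqrt a + csqrt b \<noteq> 0"
    by (metis add_pos_pos less_irrefl plus_complex.simps(1) zero_complex.simps(1))
  have "b - a = (csqrt b - csqrt a) * (csqrt a + csqrt b)"
    by (simp add: algebra_simps flip: power2_eq_square)
  then show ?thesis using nz nz' by (simp add: rsqrt_def divide_simps)
qed

lemma majorized_imp_Re:
  assumes "majorized a c C"
  shows "2 * c - C \<le> Re a"
  using assms complex_Re_le_cmod[of "of_real c - a"] unfolding majorized_def
  by (simp add: norm_minus_commute)

text \<open>
  The difference of \<open>1 / \<surd>a\<close> and \<open>1 / \<surd>c\<close> is \<open>(c - a) / (\<surd>a \<surd>c (\<surd>a + \<surd>c))\<close>, and each factor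
  of the denominator is smallest when \<open>a\<close> is the leftmost point \<open>e = 2 c - C\<close> of the disc around \<open>c\<close>.
\<close>

lemma majorized_rsqrt:
  assumes m: "majorized a c C" and c: "c > 0" and C: "C < 2 * c"
  shows "majorized (rsqrt a) (1 / sqrt c) (1 / sqrt (2 * c - C))"
proof -
  define e where "e = 2 * c - C"
  have e: "0 < e" "e \<le> c" using C majorized_le[OF m] by (auto simp: e_def)
  have Re: "e \<le> Re a" using majorized_imp_Re[OF m] by (simp add: e_def)
  have "rsqrt a - of_real (1 / sqrt c) = rsqrt a - rsqrt (of_real c)"
    using c by (simp add: rsqrt_of_real)
  also have "\<dots> = (of_real c - a) * rsqrt a * rsqrt (of_real c) / (csqrt a + csqrt (of_real c))"
    using Re e c by (intro rsqrt_diff) auto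
  also have "cmod \<dots> = cmod (of_real c - a) / (sqrt (cmod a) * sqrt c * cmod (csqrt a + of_real (sqrt c)))"
    using c by (simp add: norm_mult norm_divide rsqrt_def csqrt_of_real)
  also have "\<dots> \<le> (c - e) / (sqrt e * sqrt c * (sqrt e + sqrt c))"
  proof (rule frac_le)
    show "cmod (of_real c - a) \<le> c - e"
      using m by (simp add: majorized_def e_def norm_minus_commute)
    have "sqrt e \<le> sqrt (cmod a)" using Re complex_Re_le_cmod[of a] by (intro real_sqrt_le_mono) linarith
    moreover have "sqrt e + sqrt c \<le> cmod (csqrt a + of_real (sqrt c))"
    proof -
      have "sqrt e + sqrt c \<le> Re (csqrt a + of_real (sqrt c))"
        using Re_csqrt_ge[of e a] Re e by (simp del: csqrt.simps)
      then show ?thesis using complex_Re_le_cmod order_trans by blast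
    qed
    ultimately show "sqrt e * sqrt c * (sqrt e + sqrt c)
        \<le> sqrt (cmod a) * sqrt c * cmod (csqrt a + of_real (sqrt c))"
      using e c by (intro mult_mono) auto
    show "0 < sqrt e * sqrt c * (sqrt e + sqrt c)" using e c by (simp add: add_pos_pos)
  qed (use e in simp)
  also have "\<dots> = 1 / sqrt e - 1 / sqrt c"
  proof -
    have "c - e = (sqrt c - sqrt e) * (sqrt e + sqrt c)"
      using c e by (simp add: algebra_simps)
    moreover have "sqrt e + sqrt c > 0" using c e by (simp add: add_pos_pos)
    ultimately show ?thesis using c e by (simp add: divide_simps)
  qed
  finally show ?thesis by (simp add: majorized_def e_def)
qed

text \<open>
  The bilinear (not Hermitian) extension of the inner product, so that it depends
  holomorphically on its arguments.
\<close>

definition dotc :: "complex^3 \<Rightarrow> complex^3 \<Rightarrow> complex" where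
  "dotc a b = (\<Sum>k\<in>UNIV. a $ k * b $ k)"

definition cvec :: "real^3 \<Rightarrow> complex^3" where
  "cvec v = (\<chi> k. of_real (v $ k))"

lemma cvec_nth [simp]: "cvec v $ k = of_real (v $ k)"
  by (simp add: cvec_def)

lemma cvec_diff: "cvec (a - b) = cvec a - cvec b"
  by (simp add: vec_eq_iff)

lemma norm_cvec [simp]: "norm (cvec v) = norm v"
  by (simp add: norm_vec_def)

lemma dotc_cvec: "dotc (cvec a) (cvec b) = of_real (a \<bullet> b)"
  by (simp add: dotc_def inner_vec_def)

lemma norm_dotc_le: "cmod (dotc a b) \<le> norm a * norm b"
proof -
  have "cmod (dotc a b) \<le> (\<Sum>k\<in>UNIV. \<bar>cmod (a $ k)\<bar> * \<bar>cmod (b $ k)\<bar>)"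
    unfolding dotc_def by (rule order_trans[OF norm_sum]) (simp add: norm_mult)
  also have "\<dots> \<le> norm a * norm b"
    unfolding norm_vec_def by (rule L2_set_mult_ineq)
  finally show ?thesis .
qed

lemma majorized_dotc_self:
  assumes "norm (a - cvec v) \<le> A - norm v"
  shows "majorized (dotc a a) (norm v ^ 2) (A ^ 2)"
proof -
  define d where "d = a - cvec v"
  have A: "A \<ge> norm v" using assms norm_ge_zero[of "a - cvec v"] by linarith
  have "dotc a a - of_real (norm v ^ 2) = 2 * dotc (cvec v) d + dotc d d"
  proof -
    have "of_real (norm v ^ 2) = dotc (cvec v) (cvec v)" by (simp add: dotc_cvec power2_norm_eq_inner)
    moreover have "dotc a a = dotc (cvec v) (cvec v) + 2 * dotc (cvec v) d + dotc d d"
      unfolding dotc_def d_def sum_distrib_left sum.distrib[symmetric]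
      by (rule sum.cong) (auto simp: algebra_simps)
    ultimately show ?thesis by simp
  qed
  also have "cmod \<dots> \<le> 2 * (norm v * norm d) + norm d * norm d"
    using norm_dotc_le[of "cvec v" d] norm_dotc_le[of d d]
    by (intro norm_triangle_le) (simp add: norm_mult)
  also have "\<dots> \<le> 2 * (norm v * (A - norm v)) + (A - norm v) * (A - norm v)"
    using assms A unfolding d_def by (intro add_mono mult_left_mono mult_mono) auto
  also have "\<dots> = A ^ 2 - norm v ^ 2" by (simp add: algebra_simps power2_eq_square)
  finally show ?thesis by (simp add: majorized_def)
qed

lemma has_derivative_vec_componentwise:
  fixes h :: "complex \<Rightarrow> complex^'n"
  assumes "\<And>k. ((\<lambda>z. h z $ k) has_field_derivative d $ k) (at z)"
  shows "(h has_derivative (\<lambda>v. v *s d)) (at z)"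
proof -
  have "((\<lambda>z. \<Sum>k\<in>UNIV. axis k (h z $ k)) has_derivative (\<lambda>v. \<Sum>k\<in>UNIV. axis k (v * d $ k))) (at z)"
  proof (rule has_derivative_sum)
    fix k :: 'n
    have "bounded_linear (axis k :: complex \<Rightarrow> complex^'n)"
      unfolding linear_conv_bounded_linear[symmetric]
      by (rule linearI) (auto simp: axis_def vec_eq_iff)
    from bounded_linear.has_derivative[OF this assms[of k, unfolded has_field_derivative_def]]
    show "((\<lambda>z. axis k (h z $ k)) has_derivative (\<lambda>v. axis k (v * d $ k))) (at z)"
      by (simp only: mult.commute)
  qed
  moreover have "(\<Sum>k\<in>UNIV. axis k (w $ k)) = w" for w :: "complex^'n"
    by (simp add: vec_eq_iff axis_def if_distrib[of "\<lambda>f. f $ _"] cong: if_cong)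
  moreover have "(\<Sum>k\<in>UNIV. axis k (v * d $ k)) = v *s d" for v
    by (simp add: vec_eq_iff axis_def)
  ultimately show ?thesis by simp
qed

lemma norm_vector_smult: "norm (c *s (v :: complex^'n)) = cmod c * norm v"
  by (simp add: norm_vec_def norm_mult L2_set_right_distrib)

lemma radial_bound_vec:
  fixes h h' :: "complex \<Rightarrow> complex^'n" and \<phi> :: "real \<Rightarrow> real"
  assumes "\<And>z k. z \<in> ball 0 r \<Longrightarrow> ((\<lambda>z. h z $ k) has_field_derivative h' z $ k) (at z)"
    and "continuous_on {0..<r} \<phi>"
    and "\<And>t. 0 < t \<Longrightarrow> t < r \<Longrightarrow> (\<phi> has_real_derivative \<phi>' t) (at t)"
    and "\<And>z. z \<in> ball 0 r \<Longrightarrow> z \<noteq> 0 \<Longrightarrow> norm (h' z) \<le> \<phi>' (cmod z)"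
    and "z \<in> ball 0 r"
  shows "norm (h z - h 0) \<le> \<phi> (cmod z) - \<phi> 0"
  by (rule radial_bound[OF has_derivative_vec_componentwise[OF assms(1)] assms(2,3) _ assms(5)])
     (simp_all add: norm_vector_smult mult_left_mono assms(4))

section \<open>Lipschitz functions of the state\<close>

text \<open>
  Boundedness is included because products of Lipschitz functions are Lipschitz only when the factors are
  bounded; with it, the class is closed under all operations from which the vector field is built.
\<close>

definition lipschitz_bounded :: "'a set \<Rightarrow> ('a \<Rightarrow> 'a \<Rightarrow> real) \<Rightarrow> ('a \<Rightarrow> complex) \<Rightarrow> bool" where
  "lipschitz_bounded D d f \<longleftrightarrow> (\<exists>L B. \<forall>x\<in>D. cmod (f x) \<le> B \<and>
     (\<forall>y\<in>D. 0 \<le> d x y \<and> cmod (f x - f y) \<le> L * d x y))"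

lemma lipschitz_boundedE:
  assumes "lipschitz_bounded D d f"
  obtains L B where "L \<ge> 0" "B \<ge> 0" "\<And>x. x \<in> D \<Longrightarrow> cmod (f x) \<le> B"
    "\<And>x y. x \<in> D \<Longrightarrow> y \<in> D \<Longrightarrow> 0 \<le> d x y"
    "\<And>x y. x \<in> D \<Longrightarrow> y \<in> D \<Longrightarrow> cmod (f x - f y) \<le> L * d x y"
proof -
  obtain L B where *: "\<And>x. x \<in> D \<Longrightarrow> cmod (f x) \<le> B" "\<And>x y. x \<in> D \<Longrightarrow> y \<in> D \<Longrightarrow> 0 \<le> d x y"
    "\<And>x y. x \<in> D \<Longrightarrow> y \<in> D \<Longrightarrow> cmod (f x - f y) \<le> L * d x y"
    using assms unfolding lipschitz_bounded_def by blast
  show ?thesis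
  proof (rule that[of "\<bar>L\<bar>" "\<bar>B\<bar>"])
    show "cmod (f x - f y) \<le> \<bar>L\<bar> * d x y" if "x \<in> D" "y \<in> D" for x y
      using *(3)[OF that] mult_right_mono[OF abs_ge_self *(2)[OF that], of L] by linarith
    show "cmod (f x) \<le> \<bar>B\<bar>" if "x \<in> D" for x using *(1)[OF that] by linarith
  qed (use *(2) in auto)
qed

lemma lipschitz_boundedI:
  assumes "\<And>x. x \<in> D \<Longrightarrow> cmod (f x) \<le> B" "\<And>x y. x \<in> D \<Longrightarrow> y \<in> D \<Longrightarrow> 0 \<le> d x y"
    "\<And>x y. x \<in> D \<Longrightarrow> y \<in> D \<Longrightarrow> cmod (f x - f y) \<le> L * d x y"
  shows "lipschitz_bounded D d f"
  using assms unfolding lipschitz_bounded_def by blast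

lemma lipschitz_bounded_add:
  assumes "lipschitz_bounded D d f" "lipschitz_bounded D d h"
  shows "lipschitz_bounded D d (\<lambda>x. f x + h x)"
proof -
  obtain L B where f: "L \<ge> 0" "B \<ge> 0" "\<And>x. x \<in> D \<Longrightarrow> cmod (f x) \<le> B"
    "\<And>x y. x \<in> D \<Longrightarrow> y \<in> D \<Longrightarrow> 0 \<le> d x y"
    "\<And>x y. x \<in> D \<Longrightarrow> y \<in> D \<Longrightarrow> cmod (f x - f y) \<le> L * d x y"
    using assms(1) by (rule lipschitz_boundedE) blast
  obtain L' B' where h: "L' \<ge> 0" "B' \<ge> 0" "\<And>x. x \<in> D \<Longrightarrow> cmod (h x) \<le> B'"
    "\<And>x y. x \<in> D \<Longrightarrow> y \<in> D \<Longrightarrow> cmod (h x - h y) \<le> L' * d x y"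
    using assms(2) by (rule lipschitz_boundedE) blast
  show ?thesis
  proof (rule lipschitz_boundedI[where B="B + B'" and L="L + L'"])
    show "cmod (f x + h x) \<le> B + B'" if "x \<in> D" for x
      by (intro norm_triangle_le add_mono f h that)
    fix x y assume xy: "x \<in> D" "y \<in> D"
    have "cmod ((f x - f y) + (h x - h y)) \<le> L * d x y + L' * d x y"
      by (intro norm_triangle_le add_mono f h xy)
    then show "cmod (f x + h x - (f y + h y)) \<le> (L + L') * d x y"
      by (simp add: algebra_simps)
  qed (rule f(4))
qed

lemma lipschitz_bounded_mult:
  assumes "lipschitz_bounded D d f" "lipschitz_bounded D d h"
  shows "lipschitz_bounded D d (\<lambda>x. f x * h x)"
proof -
  obtain L B where f: "L \<ge> 0" "B \<ge> 0" "\<And>x. x \<in> D \<Longrightarrow> cmod (f x) \<le> B"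
    "\<And>x y. x \<in> D \<Longrightarrow> y \<in> D \<Longrightarrow> 0 \<le> d x y"
    "\<And>x y. x \<in> D \<Longrightarrow> y \<in> D \<Longrightarrow> cmod (f x - f y) \<le> L * d x y"
    using assms(1) by (rule lipschitz_boundedE) blast
  obtain L' B' where h: "L' \<ge> 0" "B' \<ge> 0" "\<And>x. x \<in> D \<Longrightarrow> cmod (h x) \<le> B'"
    "\<And>x y. x \<in> D \<Longrightarrow> y \<in> D \<Longrightarrow> cmod (h x - h y) \<le> L' * d x y"
    using assms(2) by (rule lipschitz_boundedE) blast
  show ?thesis
  proof (rule lipschitz_boundedI[where B="B * B'" and L="B * L' + L * B'"])
    show "cmod (f x * h x) \<le> B * B'" if "x \<in> D" for x
      unfolding norm_mult by (intro mult_mono f h that norm_ge_zero)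
    fix x y assume xy: "x \<in> D" "y \<in> D"
    have "cmod (f x * (h x - h y) + (f x - f y) * h y) \<le> B * (L' * d x y) + (L * d x y) * B'"
      by (intro norm_triangle_le add_mono; unfold norm_mult; intro mult_mono f h xy norm_ge_zero mult_nonneg_nonneg)
    then show "cmod (f x * h x - f y * h y) \<le> (B * L' + L * B') * d x y"
      by (simp add: algebra_simps)
  qed (rule f(4))
qed

lemma lipschitz_bounded_rsqrt:
  assumes "lipschitz_bounded D d f" and c: "c > 0" and Re: "\<And>x. x \<in> D \<Longrightarrow> c \<le> Re (f x)"
  shows "lipschitz_bounded D d (\<lambda>x. rsqrt (f x))"
proof -
  obtain L B where f: "L \<ge> 0" "B \<ge> 0" "\<And>x. x \<in> D \<Longrightarrow> cmod (f x) \<le> B"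
    "\<And>x y. x \<in> D \<Longrightarrow> y \<in> D \<Longrightarrow> 0 \<le> d x y"
    "\<And>x y. x \<in> D \<Longrightarrow> y \<in> D \<Longrightarrow> cmod (f x - f y) \<le> L * d x y"
    using assms(1) by (rule lipschitz_boundedE) blast
  have rs: "cmod (rsqrt (f x)) \<le> 1 / sqrt c" if "x \<in> D" for x
  proof -
    have "sqrt c \<le> sqrt (cmod (f x))"
      using Re[OF that] complex_Re_le_cmod[of "f x"] by (intro real_sqrt_le_mono) linarith
    then show ?thesis using c by (simp add: rsqrt_def norm_divide frac_le)
  qed
  show ?thesis
  proof (rule lipschitz_boundedI[where B="1 / sqrt c" and L="L * (1 / sqrt c) * (1 / sqrt c) * (1 / sqrt c)"])
    fix x y assume xy: "x \<in> D" "y \<in> D"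
    have "sqrt c \<le> Re (csqrt (f x) + csqrt (f y))"
      using Re_csqrt_ge[of c "f x"] Re_csqrt_ge[of c "f y"] Re_csqrt[of "f y"] Re xy c
      by (simp del: csqrt.simps)
    then have "sqrt c \<le> cmod (csqrt (f x) + csqrt (f y))"
      using complex_Re_le_cmod order_trans by blast
    then have inv: "1 / cmod (csqrt (f x) + csqrt (f y)) \<le> 1 / sqrt c"
      using c by (intro frac_le) auto
    have "0 < Re (f x)" "0 < Re (f y)" using Re[OF xy(1)] Re[OF xy(2)] c by auto
    then have "cmod (rsqrt (f x) - rsqrt (f y))
      = cmod (f x - f y) * cmod (rsqrt (f x)) * cmod (rsqrt (f y)) * (1 / cmod (csqrt (f x) + csqrt (f y)))"
      by (simp add: rsqrt_diff norm_mult norm_divide norm_minus_commute)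
    also have "\<dots> \<le> (L * d x y) * (1 / sqrt c) * (1 / sqrt c) * (1 / sqrt c)"
      using f c xy by (intro mult_mono rs inv) auto
    finally show "cmod (rsqrt (f x) - rsqrt (f y)) \<le> L * (1 / sqrt c) * (1 / sqrt c) * (1 / sqrt c) * d x y"
      by (simp add: mult_ac)
  qed (use rs f(4) in auto)
qed

lemma lipschitz_bounded_const:
  assumes "\<And>x y. x \<in> D \<Longrightarrow> y \<in> D \<Longrightarrow> 0 \<le> d x y"
  shows "lipschitz_bounded D d (\<lambda>x. c)"
  by (rule lipschitz_boundedI[where B="cmod c" and L=0]) (use assms in auto)

lemma lipschitz_bounded_sum:
  assumes "\<And>x y. x \<in> D \<Longrightarrow> y \<in> D \<Longrightarrow> 0 \<le> d x y"
    and "\<And>i. i \<in> I \<Longrightarrow> lipschitz_bounded D d (f i)"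
  shows "lipschitz_bounded D d (\<lambda>x. \<Sum>i\<in>I. f i x)"
  using assms(2) by (induction I rule: infinite_finite_induct)
    (auto intro!: lipschitz_bounded_const lipschitz_bounded_add assms(1))

lemma lipschitz_bounded_power:
  assumes "\<And>x y. x \<in> D \<Longrightarrow> y \<in> D \<Longrightarrow> 0 \<le> d x y" and "lipschitz_bounded D d f"
  shows "lipschitz_bounded D d (\<lambda>x. f x ^ n)"
  by (induction n) (auto intro!: lipschitz_bounded_const lipschitz_bounded_mult assms)

lemma holomorphic_on_rsqrt:
  assumes "f holomorphic_on S" "\<And>z. z \<in> S \<Longrightarrow> Re (f z) > 0"
  shows "(\<lambda>z. rsqrt (f z)) holomorphic_on S"
proof -
  have "f z \<notin> \<real>\<^sub>\<le>\<^sub>0" "f z \<noteq> 0" if "z \<in> S" for z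
    using assms(2)[OF that] by (auto simp: complex_nonpos_Reals_iff)
  then show ?thesis
    unfolding rsqrt_def using assms(1) by (intro holomorphic_intros) auto
qed

text \<open>
  The imaginary part has derivative zero along the real axis.
\<close>

lemma real_on_real_axis:
  fixes h h' :: "complex \<Rightarrow> complex"
  assumes der: "\<And>z. z \<in> ball 0 r \<Longrightarrow> (h has_field_derivative h' z) (at z)"
    and real': "\<And>t. \<bar>t\<bar> < r \<Longrightarrow> h' (of_real t) \<in> \<real>" and "h 0 \<in> \<real>" and t: "\<bar>t\<bar> < r"
  shows "h (of_real t) \<in> \<real>"
proof -
  have "\<exists>c. \<forall>u\<in>ball 0 r. Im (h (of_real u)) = c"
  proof (rule has_field_derivative_zero_constant)
    fix u :: real assume u: "u \<in> ball 0 r"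
    have "((\<lambda>u. h (of_real u)) has_vector_derivative h' (of_real u)) (at u)"
      using u by (intro has_vector_derivative_real_field der) simp
    then have "((\<lambda>u. Im (h (of_real u))) has_vector_derivative Im (h' (of_real u))) (at u)"
      by (rule bounded_linear.has_vector_derivative[OF bounded_linear_Im])
    moreover have "Im (h' (of_real u)) = 0" using real'[of u] u by (auto elim: Reals_cases)
    ultimately show "((\<lambda>u. Im (h (of_real u))) has_field_derivative 0) (at u within ball 0 r)"
      by (simp add: has_real_derivative_iff_has_vector_derivative has_vector_derivative_at_within)
  qed simp
  then have "Im (h (of_real t)) = Im (h (of_real 0))" using t
    by (metis abs_ge_zero abs_zero mem_ball_0 order_le_less_trans real_norm_def)
  then show ?thesis using \<open>h 0 \<in> \<real>\<close> by (simp add: complex_is_Real_iff)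
qed

section \<open>The complexified system\<close>

text \<open>
  The coordinates \<open>(False, i, k)\<close> and \<open>(True, i, k)\<close> of a state are the \<open>k\<close>-th components of the position
  and of the velocity of body \<open>i\<close>. Scalar coordinates suit the Picard iteration, the vectors
  \<open>posn\<close> and \<open>vel\<close> suit the estimates.
\<close>

type_synonym state = "bool \<times> nat \<times> 3 \<Rightarrow> complex"

definition posn :: "state \<Rightarrow> nat \<Rightarrow> complex^3" where
  "posn x i = (\<chi> k. x (False, i, k))"

definition vel :: "state \<Rightarrow> nat \<Rightarrow> complex^3" where
  "vel x i = (\<chi> k. x (True, i, k))"

lemma posn_nth [simp]: "posn x i $ k = x (False, i, k)"
  and vel_nth [simp]: "vel x i $ k = x (True, i, k)"
  by (simp_all add: posn_def vel_def)

definition real_state :: "(nat \<Rightarrow> real^3) \<Rightarrow> (nat \<Rightarrow> real^3) \<Rightarrow> state" where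
  "real_state Q V = (\<lambda>(b, i, k). of_real ((if b then V i else Q i) $ k))"

lemma posn_real_state [simp]: "posn (real_state Q V) i = cvec (Q i)"
  and vel_real_state [simp]: "vel (real_state Q V) i = cvec (V i)"
  by (simp_all add: vec_eq_iff real_state_def)

locale nbody =
  fixes N :: nat and G :: real and m :: "nat \<Rightarrow> real"
  assumes N: "N \<ge> 2" and G: "G > 0" and m: "\<And>i. i \<in> {1..N} \<Longrightarrow> m i > 0"
begin

definition coords :: "(bool \<times> nat \<times> 3) set" where
  "coords = UNIV \<times> {1..N} \<times> UNIV"

lemma finite_coords: "finite coords"
  by (simp add: coords_def)

lemma coords_iff [simp]: "(b, i, k) \<in> coords \<longleftrightarrow> i \<in> {1..N}"
  by (simp add: coords_def)

text \<open>
  The constants \<open>inv_distC\<close>, \<open>KC\<close>, \<open>SC\<close> and \<open>accelC\<close> are the holomorphic extensions of \<open>1 / \<parallel>Q\<^sub>i - Q\<^sub>j\<parallel>\<close>, of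
  \<open>K\<^sub>i\<close>, of \<open>s\<^sup>-\<^sup>2\<close> and of the acceleration. All of them are polynomials in the inverse distances, the
  velocities and the positions.
\<close>

definition inv_distC :: "(nat \<Rightarrow> complex^3) \<Rightarrow> nat \<Rightarrow> nat \<Rightarrow> complex" where
  "inv_distC Q i j = rsqrt (dotc (Q i - Q j) (Q i - Q j))"

definition KC :: "(nat \<Rightarrow> complex^3) \<Rightarrow> nat \<Rightarrow> complex" where
  "KC Q i = (\<Sum>j\<in>{1..N} - {i}. of_real (G * m j) * inv_distC Q i j ^ 2)"

definition SC :: "(nat \<Rightarrow> complex^3) \<Rightarrow> (nat \<Rightarrow> complex^3) \<Rightarrow> complex" where
  "SC Q V = (\<Sum>i=1..N. \<Sum>j=i+1..N. dotc (V i - V j) (V i - V j) * inv_distC Q i j ^ 2)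
     + (\<Sum>i=1..N. \<Sum>j=i+1..N. (KC Q i + KC Q j) * inv_distC Q i j)"

definition accelC :: "(nat \<Rightarrow> complex^3) \<Rightarrow> nat \<Rightarrow> complex^3" where
  "accelC Q i = (\<Sum>j\<in>{1..N} - {i}. (of_real (G * m j) * inv_distC Q i j ^ 3) *s (Q j - Q i))"

definition field :: "state \<Rightarrow> state" where
  "field x = (\<lambda>(b, i, k). rsqrt (SC (posn x) (vel x)) * (if b then accelC (posn x) i $ k else vel x i $ k))"

definition SR :: "(nat \<Rightarrow> real^3) \<Rightarrow> (nat \<Rightarrow> real^3) \<Rightarrow> real" where
  "SR Q V = (\<Sum>i=1..N. \<Sum>j=i+1..N. norm (V i - V j) ^ 2 / norm (Q i - Q j) ^ 2)
      + (\<Sum>i=1..N. \<Sum>j=i+1..N. M N G m Q i j / norm (Q i - Q j))"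

definition collision_free :: "(nat \<Rightarrow> real^3) \<Rightarrow> bool" where
  "collision_free Q \<longleftrightarrow> (\<forall>i\<in>{1..N}. \<forall>j\<in>{1..N}. i \<noteq> j \<longrightarrow> Q i \<noteq> Q j)"

lemma Gm_nonneg: "i \<in> {1..N} \<Longrightarrow> G * m i \<ge> 0"
  using G m[of i] by simp

lemma K_nonneg: "K N G m Q i \<ge> 0"
  unfolding K_def by (intro sum_nonneg divide_nonneg_nonneg Gm_nonneg) auto

lemma M_nonneg: "M N G m Q i j \<ge> 0"
  by (simp add: M_def K_nonneg)

lemma K_pos:
  assumes "collision_free Q" "i \<in> {1..N}"
  shows "K N G m Q i > 0"
proof -
  have "\<exists>j. j \<in> {1..N} - {i}"
    by (rule exI[of _ "if i = 1 then 2 else 1"]) (use N in simp)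
  then obtain j where j: "j \<in> {1..N} - {i}" by blast
  have "0 < G * m j / norm (Q i - Q j) ^ 2"
    using j assms G m unfolding collision_free_def by auto
  also have "\<dots> \<le> K N G m Q i"
    unfolding K_def using j by (intro member_le_sum divide_nonneg_nonneg Gm_nonneg) auto
  finally show ?thesis .
qed

lemma SR_alt: "SR Q V = (\<Sum>i=1..N. \<Sum>j=i+1..N.
    (norm (V i - V j) / norm (Q i - Q j)) ^ 2 + M N G m Q i j / norm (Q i - Q j))"
  by (simp add: SR_def sum.distrib power_divide)

text \<open>
  The sum defining \<open>s\<^sup>-\<^sup>2\<close> dominates each of its pair terms; this is why the time-renormalization slows down
  with every close encounter and with every fast relative motion.
\<close>

lemma pair_le_SR:
  assumes "i \<in> {1..N}" "j \<in> {1..N}" "i \<noteq> j"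
  shows "(norm (V i - V j) / norm (Q i - Q j)) ^ 2 + M N G m Q i j / norm (Q i - Q j) \<le> SR Q V"
proof -
  define f where "f = (\<lambda>i j. (norm (V i - V j) / norm (Q i - Q j)) ^ 2 + M N G m Q i j / norm (Q i - Q j))"
  have f0: "f i j \<ge> 0" for i j by (simp add: f_def M_nonneg)
  have *: "f i j \<le> SR Q V" if "i \<in> {1..N}" "j \<in> {i+1..N}" for i j
  proof -
    have "f i j \<le> (\<Sum>j=i+1..N. f i j)" using that f0 by (intro member_le_sum) auto
    also have "\<dots> \<le> (\<Sum>i=1..N. \<Sum>j=i+1..N. f i j)"
      using that f0 by (intro member_le_sum[where f="\<lambda>i. \<Sum>j=i+1..N. f i j"] sum_nonneg) auto
    finally show ?thesis by (simp add: SR_alt f_def)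
  qed
  have sym: "f i j = f j i" by (simp add: f_def M_def norm_minus_commute add.commute)
  have "f i j \<le> SR Q V"
    using *[of i j] *[of j i] assms sym by (cases "i < j") auto
  then show ?thesis by (simp add: f_def)
qed

lemma SR_pos:
  assumes "collision_free Q"
  shows "SR Q V > 0"
proof -
  have "M N G m Q 1 2 / norm (Q 1 - Q 2) > 0"
    using K_pos[OF assms, of 1] K_nonneg[of Q 2] assms N unfolding M_def collision_free_def
    by (intro divide_pos_pos add_pos_nonneg) auto
  then have "0 < (norm (V 1 - V 2) / norm (Q 1 - Q 2)) ^ 2 + M N G m Q 1 2 / norm (Q 1 - Q 2)"
    by (intro add_nonneg_pos) auto
  then show ?thesis using pair_le_SR[of 1 2 V Q] N by auto
qed

lemma renorm_eq: "collision_free Q \<Longrightarrow> renorm N G m Q V = 1 / sqrt (SR Q V)"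
  using SR_pos[of Q V] unfolding renorm_def SR_def[symmetric]
  by (simp add: powr_minus_divide powr_half_sqrt)

lemma inv_distC_real:
  assumes "P i = cvec (Q i)" "P j = cvec (Q j)"
  shows "inv_distC P i j = of_real (1 / norm (Q i - Q j))"
  unfolding inv_distC_def assms cvec_diff[symmetric] dotc_cvec
  by (simp add: rsqrt_of_real norm_eq_sqrt_inner)

lemma KC_real:
  assumes "\<And>i. i \<in> {1..N} \<Longrightarrow> P i = cvec (Q i)" "i \<in> {1..N}"
  shows "KC P i = of_real (K N G m Q i)"
  unfolding KC_def K_def of_real_sum
  by (rule sum.cong) (use assms in \<open>auto simp: inv_distC_real[of P _ Q] power_divide\<close>)

lemma SC_real:
  assumes P: "\<And>i. i \<in> {1..N} \<Longrightarrow> P i = cvec (Q i)" and W: "\<And>i. i \<in> {1..N} \<Longrightarrow> W i = cvec (V i)"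
  shows "SC P W = of_real (SR Q V)"
proof -
  have "dotc (W i - W j) (W i - W j) * inv_distC P i j ^ 2 = of_real (norm (V i - V j) ^ 2 / norm (Q i - Q j) ^ 2)"
    "(KC P i + KC P j) * inv_distC P i j = of_real (M N G m Q i j / norm (Q i - Q j))"
    if "i \<in> {1..N}" "j \<in> {i+1..N}" for i j
  proof -
    have ij: "i \<in> {1..N}" "j \<in> {1..N}" using that by auto
    have inv: "inv_distC P i j = of_real (1 / norm (Q i - Q j))"
      by (rule inv_distC_real[OF P[OF ij(1)] P[OF ij(2)]])
    have "dotc (W i - W j) (W i - W j) = of_real (norm (V i - V j) ^ 2)"
      unfolding W[OF ij(1)] W[OF ij(2)] cvec_diff[symmetric] dotc_cvec power2_norm_eq_inner ..
    then show "dotc (W i - W j) (W i - W j) * inv_distC P i j ^ 2 = of_real (norm (V i - V j) ^ 2 / norm (Q i - Q j) ^ 2)"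
      unfolding inv by (simp add: power_divide)
    show "(KC P i + KC P j) * inv_distC P i j = of_real (M N G m Q i j / norm (Q i - Q j))"
      unfolding inv KC_real[of P Q, OF P ij(1), simplified] KC_real[of P Q, OF P ij(2), simplified] by (simp add: M_def)
  qed
  then show ?thesis unfolding SC_def SR_def by simp
qed

lemma accelC_real:
  assumes P: "\<And>i. i \<in> {1..N} \<Longrightarrow> P i = cvec (Q i)" and "i \<in> {1..N}"
  shows "accelC P i = cvec (accel N G m Q i)"
proof -
  have "accelC P i $ k = cvec (accel N G m Q i) $ k" for k
    unfolding accelC_def accel_def sum_component of_real_sum cvec_nth
    by (rule sum.cong)
       (use assms in \<open>auto simp: inv_distC_real[of P _ Q] power_divide right_diff_distrib diff_divide_distrib\<close>)
  then show ?thesis by (simp add: vec_eq_iff)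
qed

lemma field_real:
  assumes P: "\<And>i. i \<in> {1..N} \<Longrightarrow> posn x i = cvec (Q i)" and W: "\<And>i. i \<in> {1..N} \<Longrightarrow> vel x i = cvec (V i)"
    and cf: "collision_free Q" and i: "i \<in> {1..N}"
  shows "field x (b, i, k) = of_real ((renorm N G m Q V *\<^sub>R (if b then accel N G m Q i else V i)) $ k)"
proof -
  have S: "SC (posn x) (vel x) = of_real (SR Q V)" by (rule SC_real) (fact P W)+
  have A: "accelC (posn x) i = cvec (accel N G m Q i)" by (rule accelC_real) (fact P i)+
  have "rsqrt (SC (posn x) (vel x)) = of_real (renorm N G m Q V)"
    unfolding S using SR_pos[OF cf, of V] renorm_eq[OF cf, of V] by (simp add: rsqrt_of_real)
  then show ?thesis by (simp add: field_def A W[OF i] del: vel_nth)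
qed

end

section \<open>A priori bounds near an initial state\<close>

text \<open>
  From here on \<open>q0\<close> and \<open>v0\<close> are the data at time \<open>0\<close> of a disc in the complex time plane; later they will be
  instantiated with the state of the real solution at an arbitrary real time.
\<close>

locale nbody_initial = nbody +
  fixes q0 v0 :: "nat \<Rightarrow> real^3"
  assumes cf: "collision_free q0"
begin

definition s0 :: real where "s0 = renorm N G m q0 v0"

lemma s0: "s0 > 0" "s0 ^ 2 * SR q0 v0 = 1"
proof -
  have "SR q0 v0 > 0" by (rule SR_pos[OF cf])
  then show "s0 > 0" "s0 ^ 2 * SR q0 v0 = 1"
    by (simp_all add: s0_def renorm_eq[OF cf] power_divide)
qed

lemma dist_pos: "i \<in> {1..N} \<Longrightarrow> j \<in> {1..N} \<Longrightarrow> i \<noteq> j \<Longrightarrow> norm (q0 i - q0 j) > 0"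
  using cf by (simp add: collision_free_def)

lemma pair_bounds:
  assumes ij: "i \<in> {1..N}" "j \<in> {1..N}" "i \<noteq> j"
  shows "s0 * (norm (v0 i - v0 j) / norm (q0 i - q0 j)) \<le> 1"
    and "s0 ^ 2 * (M N G m q0 i j / norm (q0 i - q0 j)) \<le> 1"
proof -
  define a where "a = norm (v0 i - v0 j) / norm (q0 i - q0 j)"
  define b where "b = M N G m q0 i j / norm (q0 i - q0 j)"
  have nn: "a \<ge> 0" "b \<ge> 0" by (simp_all add: a_def b_def M_nonneg)
  have ab: "a ^ 2 + b \<le> SR q0 v0" using pair_le_SR[OF ij] by (simp add: a_def b_def)
  then have le: "a ^ 2 \<le> SR q0 v0" "b \<le> SR q0 v0" using nn by (auto intro: order_trans[rotated])
  have "(s0 * a) ^ 2 \<le> 1 ^ 2"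
    using mult_left_mono[OF le(1), of "s0 ^ 2"] s0 by (simp add: power_mult_distrib)
  then show "s0 * (norm (v0 i - v0 j) / norm (q0 i - q0 j)) \<le> 1"
    unfolding a_def[symmetric] by (rule power2_le_imp_le) simp
  show "s0 ^ 2 * (M N G m q0 i j / norm (q0 i - q0 j)) \<le> 1"
    unfolding b_def[symmetric] using mult_left_mono[OF le(2), of "s0 ^ 2"] s0 by simp
qed

text \<open>
  The region in which the complexified solution is confined while the majorant has a value at most \<open>\<sigma>\<close>.
  Only the relative positions are controlled, since only they enter the vector field.
\<close>

definition Dom :: "real \<Rightarrow> state set" where
  "Dom \<sigma> = {x. (\<forall>i\<in>{1..N}. norm (vel x i - cvec (v0 i)) \<le> s0 * K N G m q0 i * \<sigma>) \<and>
     (\<forall>i\<in>{1..N}. \<forall>j\<in>{1..N}. i \<noteq> j \<longrightarrow>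
        norm (posn x i - posn x j - cvec (q0 i - q0 j)) \<le> norm (q0 i - q0 j) * (dist_maj \<sigma> - 1))}"

lemma DomD:
  assumes "x \<in> Dom \<sigma>" "i \<in> {1..N}"
  shows "norm (vel x i - cvec (v0 i)) \<le> s0 * K N G m q0 i * \<sigma>"
    and "j \<in> {1..N} \<Longrightarrow> i \<noteq> j \<Longrightarrow>
        norm (posn x i - posn x j - cvec (q0 i - q0 j)) \<le> norm (q0 i - q0 j) * (dist_maj \<sigma> - 1)"
  using assms by (auto simp: Dom_def)

lemma Dom_mono:
  assumes "0 \<le> \<sigma>" "\<sigma> \<le> \<tau>"
  shows "Dom \<sigma> \<subseteq> Dom \<tau>"
proof
  fix x assume x: "x \<in> Dom \<sigma>"
  have "s0 * K N G m q0 i * \<sigma> \<le> s0 * K N G m q0 i * \<tau>" for i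
    using s0 K_nonneg assms by (intro mult_left_mono) auto
  moreover have "norm (q0 i - q0 j) * (dist_maj \<sigma> - 1) \<le> norm (q0 i - q0 j) * (dist_maj \<tau> - 1)" for i j
    using dist_maj_mono[OF assms] by (intro mult_left_mono) auto
  ultimately show "x \<in> Dom \<tau>"
    unfolding Dom_def by (auto intro: order_trans[OF DomD(1)[OF x]] order_trans[OF DomD(2)[OF x]])
qed

lemma initial_in_Dom: "0 \<le> \<sigma> \<Longrightarrow> real_state q0 v0 \<in> Dom \<sigma>"
  using s0 K_nonneg dist_maj_bounds(1)[of \<sigma>] by (simp add: Dom_def cvec_diff)

lemma vel_diff_bound:
  assumes x: "x \<in> Dom \<sigma>" and ij: "i \<in> {1..N}" "j \<in> {1..N}"
  shows "norm (vel x i - vel x j - cvec (v0 i - v0 j)) \<le> s0 * M N G m q0 i j * \<sigma>"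
proof -
  have "vel x i - vel x j - cvec (v0 i - v0 j) = (vel x i - cvec (v0 i)) - (vel x j - cvec (v0 j))"
    by (simp add: cvec_diff)
  also have "norm \<dots> \<le> s0 * K N G m q0 i * \<sigma> + s0 * K N G m q0 j * \<sigma>"
    by (rule order_trans[OF norm_triangle_ineq4]) (intro add_mono DomD[OF x] ij)
  finally show ?thesis by (simp add: M_def algebra_simps)
qed

lemma majorized_dist_sq:
  assumes x: "x \<in> Dom \<sigma>" and ij: "i \<in> {1..N}" "j \<in> {1..N}" "i \<noteq> j"
  shows "majorized (dotc (posn x i - posn x j) (posn x i - posn x j)) (norm (q0 i - q0 j) ^ 2)
    ((norm (q0 i - q0 j) * dist_maj \<sigma>) ^ 2)"
  by (rule majorized_dotc_self) (use DomD(2)[OF x ij] in \<open>simp add: algebra_simps\<close>)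

lemma dist_sq_slack:
  assumes "0 \<le> \<sigma>"
  shows "2 * r ^ 2 - (r * dist_maj \<sigma>) ^ 2 = (r / inv_dist_maj \<sigma>) ^ 2"
  unfolding power_mult_distrib dist_maj_bounds(2)[OF assms] by (simp add: power_divide algebra_simps)

lemma majorized_inv_dist:
  assumes x: "x \<in> Dom \<sigma>" and \<sigma>: "0 \<le> \<sigma>" and ij: "i \<in> {1..N}" "j \<in> {1..N}" "i \<noteq> j"
  shows "majorized (inv_distC (posn x) i j) (1 / norm (q0 i - q0 j)) (inv_dist_maj \<sigma> / norm (q0 i - q0 j))"
proof -
  define r where "r = norm (q0 i - q0 j)"
  have r: "r > 0" using dist_pos[OF ij] by (simp add: r_def)
  have R: "inv_dist_maj \<sigma> \<ge> 1" by (rule inv_dist_maj_ge_1[OF \<sigma>])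
  have pos: "(r / inv_dist_maj \<sigma>) ^ 2 > 0" using r R by simp
  have "majorized (rsqrt (dotc (posn x i - posn x j) (posn x i - posn x j)))
     (1 / sqrt (r ^ 2)) (1 / sqrt (2 * r ^ 2 - (r * dist_maj \<sigma>) ^ 2))"
  proof (rule majorized_rsqrt)
    show "majorized (dotc (posn x i - posn x j) (posn x i - posn x j)) (r ^ 2) ((r * dist_maj \<sigma>) ^ 2)"
      unfolding r_def by (rule majorized_dist_sq[OF x ij])
    show "(r * dist_maj \<sigma>) ^ 2 < 2 * r ^ 2" using dist_sq_slack[OF \<sigma>, of r] pos by linarith
  qed (use r in simp)
  then show ?thesis
    unfolding dist_sq_slack[OF \<sigma>] inv_distC_def r_def[symmetric] using r R by (simp add: real_sqrt_divide)
qed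

lemma majorized_K:
  assumes x: "x \<in> Dom \<sigma>" and \<sigma>: "0 \<le> \<sigma>" and i: "i \<in> {1..N}"
  shows "majorized (KC (posn x) i) (K N G m q0 i) (K N G m q0 i * inv_dist_maj \<sigma> ^ 2)"
proof -
  have "majorized (KC (posn x) i) (\<Sum>j\<in>{1..N} - {i}. (G * m j) * (1 / norm (q0 i - q0 j)) ^ 2)
      (\<Sum>j\<in>{1..N} - {i}. (G * m j) * (inv_dist_maj \<sigma> / norm (q0 i - q0 j)) ^ 2)"
    unfolding KC_def using i
    by (intro majorized_sum majorized_mult majorized_of_real majorized_power majorized_inv_dist[OF x \<sigma>]
        Gm_nonneg) auto
  then show ?thesis by (simp add: K_def sum_distrib_right power_divide)
qed

text \<open>
  The contribution of one pair to the majorant of \<open>s\<^sup>-\<^sup>2\<close>, where \<open>a\<close> stands for \<open>\<parallel>v\<^sub>i - v\<^sub>j\<parallel> / r\<^sub>i\<^sub>j\<close> and \<open>b\<close>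
  for \<open>M\<^sub>i\<^sub>j / r\<^sub>i\<^sub>j\<close>. The squared velocity exceeds \<open>a\<^sup>2\<close> by at most \<open>b (2 \<sigma> + \<sigma>\<^sup>2) = 2 b (R - 1)\<close>, so the
  contribution is at most \<open>a\<^sup>2 R\<^sup>2 + b (3 R\<^sup>3 - 2 R\<^sup>2)\<close>; the first coefficient is the smaller one as \<open>R \<ge> 1\<close>.
\<close>

lemma pair_term_le:
  fixes a b s \<sigma> :: real
  assumes nn: "a \<ge> 0" "b \<ge> 0" "s \<ge> 0" "\<sigma> \<ge> 0" and a: "s * a \<le> 1" and b: "s ^ 2 * b \<le> 1"
  defines "R \<equiv> inv_dist_maj \<sigma>"
  shows "(a + s * b * \<sigma>) ^ 2 * R ^ 2 + b * R ^ 3 \<le> (a ^ 2 + b) * (3 * R ^ 3 - 2 * R ^ 2)"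
proof -
  have R: "R \<ge> 1" unfolding R_def by (rule inv_dist_maj_ge_1[OF nn(4)])
  have "(a + s * b * \<sigma>) ^ 2 = a ^ 2 + (s * a) * (2 * b * \<sigma>) + (s ^ 2 * b) * (b * \<sigma> ^ 2)"
    by (simp add: power2_eq_square algebra_simps)
  also have "\<dots> \<le> a ^ 2 + 1 * (2 * b * \<sigma>) + 1 * (b * \<sigma> ^ 2)"
    using nn a b by (intro add_mono mult_right_mono order_refl) auto
  also have "\<dots> = a ^ 2 + 2 * b * (R - 1)" by (simp add: R_def inv_dist_maj_def algebra_simps)
  finally have "(a + s * b * \<sigma>) ^ 2 * R ^ 2 + b * R ^ 3 \<le> (a ^ 2 + 2 * b * (R - 1)) * R ^ 2 + b * R ^ 3"
    using R by (intro add_mono mult_right_mono) auto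
  also have "\<dots> = a ^ 2 * R ^ 2 + b * (3 * R ^ 3 - 2 * R ^ 2)"
    by (simp add: power2_eq_square power3_eq_cube algebra_simps)
  also have "a ^ 2 * R ^ 2 \<le> a ^ 2 * (3 * R ^ 3 - 2 * R ^ 2)"
  proof (rule mult_left_mono)
    have "R ^ 2 * 1 \<le> R ^ 2 * R" using R by (intro mult_left_mono) auto
    then show "R ^ 2 \<le> 3 * R ^ 3 - 2 * R ^ 2" by (simp add: power2_eq_square power3_eq_cube)
  qed simp
  finally show ?thesis by (simp add: algebra_simps)
qed

text \<open>
  Summing the pair terms: relative to its initial value, the complexified \<open>s\<^sup>-\<^sup>2\<close> changes by at most
  \<open>3 R\<^sup>3 - 2 R\<^sup>2 - 1\<close>, a number below \<open>1\<close> as long as \<open>\<sigma> < v\<^sub>+\<close>.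
\<close>

lemma majorized_S:
  assumes x: "x \<in> Dom \<sigma>" and \<sigma>: "0 \<le> \<sigma>"
  defines "R \<equiv> inv_dist_maj \<sigma>"
  shows "majorized (SC (posn x) (vel x)) (SR q0 v0) (SR q0 v0 * (3 * R ^ 3 - 2 * R ^ 2))"
proof -
  define r where "r = (\<lambda>i j. norm (q0 i - q0 j))"
  define v where "v = (\<lambda>i j. norm (v0 i - v0 j))"
  define \<mu> where "\<mu> = M N G m q0"
  have "majorized (SC (posn x) (vel x))
     ((\<Sum>i=1..N. \<Sum>j=i+1..N. v i j ^ 2 * (1 / r i j) ^ 2)
        + (\<Sum>i=1..N. \<Sum>j=i+1..N. (K N G m q0 i + K N G m q0 j) * (1 / r i j)))
     ((\<Sum>i=1..N. \<Sum>j=i+1..N. (v i j + s0 * \<mu> i j * \<sigma>) ^ 2 * (R / r i j) ^ 2)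
        + (\<Sum>i=1..N. \<Sum>j=i+1..N. (K N G m q0 i * R ^ 2 + K N G m q0 j * R ^ 2) * (R / r i j)))"
    unfolding SC_def
  proof (intro majorized_add majorized_sum)
    fix i j assume "i \<in> {1..N}" "j \<in> {i+1..N}"
    then have ij: "i \<in> {1..N}" "j \<in> {1..N}" "i \<noteq> j" by auto
    have inv: "majorized (inv_distC (posn x) i j) (1 / r i j) (R / r i j)"
      unfolding r_def R_def by (rule majorized_inv_dist[OF x \<sigma> ij])
    have "majorized (dotc (vel x i - vel x j) (vel x i - vel x j)) (v i j ^ 2) ((v i j + s0 * \<mu> i j * \<sigma>) ^ 2)"
      unfolding v_def \<mu>_def by (rule majorized_dotc_self) (use vel_diff_bound[OF x ij(1,2)] in simp)
    then show "majorized (dotc (vel x i - vel x j) (vel x i - vel x j) * inv_distC (posn x) i j ^ 2)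
       (v i j ^ 2 * (1 / r i j) ^ 2) ((v i j + s0 * \<mu> i j * \<sigma>) ^ 2 * (R / r i j) ^ 2)"
      using inv by (intro majorized_mult majorized_power) (auto simp: r_def)
    show "majorized ((KC (posn x) i + KC (posn x) j) * inv_distC (posn x) i j)
       ((K N G m q0 i + K N G m q0 j) * (1 / r i j)) ((K N G m q0 i * R ^ 2 + K N G m q0 j * R ^ 2) * (R / r i j))"
      unfolding R_def
      by (intro majorized_mult majorized_add majorized_K[OF x \<sigma>] ij inv[unfolded R_def] add_nonneg_nonneg K_nonneg)
         (simp add: r_def)
  qed
  moreover have "(\<Sum>i=1..N. \<Sum>j=i+1..N. v i j ^ 2 * (1 / r i j) ^ 2)
        + (\<Sum>i=1..N. \<Sum>j=i+1..N. (K N G m q0 i + K N G m q0 j) * (1 / r i j)) = SR q0 v0"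
    by (simp add: SR_def v_def r_def M_def power_divide)
  moreover have "(\<Sum>i=1..N. \<Sum>j=i+1..N. (v i j + s0 * \<mu> i j * \<sigma>) ^ 2 * (R / r i j) ^ 2)
        + (\<Sum>i=1..N. \<Sum>j=i+1..N. (K N G m q0 i * R ^ 2 + K N G m q0 j * R ^ 2) * (R / r i j))
      \<le> SR q0 v0 * (3 * R ^ 3 - 2 * R ^ 2)"
    unfolding SR_alt sum_distrib_right sum.distrib[symmetric]
  proof (intro sum_mono)
    fix i j assume "i \<in> {1..N}" "j \<in> {i+1..N}"
    then have ij: "i \<in> {1..N}" "j \<in> {1..N}" "i \<noteq> j" by auto
    have r: "r i j > 0" using dist_pos[OF ij] by (simp add: r_def)
    have "(v i j + s0 * \<mu> i j * \<sigma>) ^ 2 * (R / r i j) ^ 2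
        + (K N G m q0 i * R ^ 2 + K N G m q0 j * R ^ 2) * (R / r i j)
      = (v i j / r i j + s0 * (\<mu> i j / r i j) * \<sigma>) ^ 2 * R ^ 2 + (\<mu> i j / r i j) * R ^ 3"
      unfolding \<mu>_def M_def using r by (simp add: field_simps power2_eq_square power3_eq_cube)
    also have "\<dots> \<le> ((v i j / r i j) ^ 2 + \<mu> i j / r i j) * (3 * R ^ 3 - 2 * R ^ 2)"
      unfolding R_def using pair_bounds[OF ij] s0 r \<sigma>
      by (intro pair_term_le) (auto simp: v_def r_def \<mu>_def M_nonneg)
    finally show "(v i j + s0 * \<mu> i j * \<sigma>) ^ 2 * (R / r i j) ^ 2
        + (K N G m q0 i * R ^ 2 + K N G m q0 j * R ^ 2) * (R / r i j)
      \<le> ((norm (v0 i - v0 j) / norm (q0 i - q0 j)) ^ 2 + M N G m q0 i j / norm (q0 i - q0 j)) * (3 * R ^ 3 - 2 * R ^ 2)"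
      by (simp add: v_def r_def \<mu>_def)
  qed
  ultimately show ?thesis using majorized_mono by simp
qed

lemma S_slack:
  assumes "0 \<le> \<sigma>" "\<sigma> < v_plus"
  defines "R \<equiv> inv_dist_maj \<sigma>"
  shows "2 * SR q0 v0 - SR q0 v0 * (3 * R ^ 3 - 2 * R ^ 2) = SR q0 v0 * (2 + 2 * R ^ 2 - 3 * R ^ 3)"
    and "SR q0 v0 * (2 + 2 * R ^ 2 - 3 * R ^ 3) > 0"
proof -
  show "2 * SR q0 v0 - SR q0 v0 * (3 * R ^ 3 - 2 * R ^ 2) = SR q0 v0 * (2 + 2 * R ^ 2 - 3 * R ^ 3)"
    by (simp add: algebra_simps)
  show "SR q0 v0 * (2 + 2 * R ^ 2 - 3 * R ^ 3) > 0"
    using renorm_slack_pos[OF assms(1,2)] SR_pos[OF cf, of v0] by (simp add: R_def)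
qed

lemma norm_renormC_le:
  assumes x: "x \<in> Dom \<sigma>" and \<sigma>: "0 \<le> \<sigma>" "\<sigma> < v_plus"
  shows "cmod (rsqrt (SC (posn x) (vel x))) \<le> s0 * renorm_maj \<sigma>"
proof -
  define R where "R = inv_dist_maj \<sigma>"
  note slack = S_slack[OF \<sigma>, folded R_def]
  have "majorized (rsqrt (SC (posn x) (vel x))) (1 / sqrt (SR q0 v0))
     (1 / sqrt (2 * SR q0 v0 - SR q0 v0 * (3 * R ^ 3 - 2 * R ^ 2)))"
    by (rule majorized_rsqrt[OF majorized_S[OF x \<sigma>(1), folded R_def] SR_pos[OF cf]])
       (use slack in linarith)
  then have "cmod (rsqrt (SC (posn x) (vel x))) \<le> 1 / sqrt (SR q0 v0 * (2 + 2 * R ^ 2 - 3 * R ^ 3))"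
    unfolding slack(1) by (rule majorized_norm_le) (use SR_pos[OF cf, of v0] in simp)
  also have "\<dots> = s0 * renorm_maj \<sigma>"
    by (simp add: s0_def renorm_eq[OF cf] renorm_maj_def R_def real_sqrt_mult)
  finally show ?thesis .
qed

text \<open>
  In each summand \<open>G m\<^sub>j (Q\<^sub>j - Q\<^sub>i) / \<parallel>Q\<^sub>i - Q\<^sub>j\<parallel>\<^sup>3\<close> the numerator grows by at most the factor \<open>X\<close> and the inverse
  cube of the distance by at most \<open>R\<^sup>3\<close>.
\<close>

lemma norm_accelC_le:
  assumes x: "x \<in> Dom \<sigma>" and \<sigma>: "0 \<le> \<sigma>" and i: "i \<in> {1..N}"
  shows "norm (accelC (posn x) i) \<le> K N G m q0 i * (dist_maj \<sigma> * inv_dist_maj \<sigma> ^ 3)"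
proof -
  have "norm (accelC (posn x) i) \<le> (\<Sum>j\<in>{1..N} - {i}. G * m j / norm (q0 i - q0 j) ^ 2 * (dist_maj \<sigma> * inv_dist_maj \<sigma> ^ 3))"
    unfolding accelC_def
  proof (rule sum_norm_le)
    fix j assume j: "j \<in> {1..N} - {i}"
    then have ij: "i \<in> {1..N}" "j \<in> {1..N}" "i \<noteq> j" using i by auto
    define r where "r = norm (q0 i - q0 j)"
    have r: "r > 0" using dist_pos[OF ij] by (simp add: r_def)
    have c: "cmod (inv_distC (posn x) i j) \<le> inv_dist_maj \<sigma> / r"
      using majorized_norm_le[OF majorized_inv_dist[OF x \<sigma> ij]] by (simp add: r_def)
    have "norm (posn x j - posn x i) \<le> norm (cvec (q0 i - q0 j)) + norm (posn x i - posn x j - cvec (q0 i - q0 j))"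
      using norm_triangle_ineq[of "cvec (q0 i - q0 j)" "posn x i - posn x j - cvec (q0 i - q0 j)"]
      by (simp add: norm_minus_commute)
    also have "\<dots> \<le> r * dist_maj \<sigma>" using DomD(2)[OF x ij] by (simp add: r_def algebra_simps)
    finally have p: "norm (posn x j - posn x i) \<le> r * dist_maj \<sigma>" .
    define w where "w = G * m j"
    have Gm: "w \<ge> 0" unfolding w_def using Gm_nonneg[of j] j by simp
    have "norm ((of_real (w) * inv_distC (posn x) i j ^ 3) *s (posn x j - posn x i))
        = w * cmod (inv_distC (posn x) i j) ^ 3 * norm (posn x j - posn x i)"
      unfolding norm_vector_smult norm_mult norm_power norm_of_real using Gm by simp
    also have "\<dots> \<le> w * (inv_dist_maj \<sigma> / r) ^ 3 * (r * dist_maj \<sigma>)"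
      using Gm r inv_dist_maj_ge_1[OF \<sigma>] by (intro mult_mono power_mono mult_nonneg_nonneg c p) auto
    also have "\<dots> = w / norm (q0 i - q0 j) ^ 2 * (dist_maj \<sigma> * inv_dist_maj \<sigma> ^ 3)"
      using r by (simp add: r_def[symmetric] field_simps power2_eq_square power3_eq_cube)
    finally show "norm ((of_real (G * m j) * inv_distC (posn x) i j ^ 3) *s (posn x j - posn x i))
       \<le> G * m j / norm (q0 i - q0 j) ^ 2 * (dist_maj \<sigma> * inv_dist_maj \<sigma> ^ 3)"
      unfolding w_def .
  qed
  then show ?thesis by (simp add: K_def sum_distrib_right)
qed

text \<open>
  Here the choice of \<open>s\<close> pays off: \<open>pair_bounds\<close> turns the relative velocity into a multiple of
  \<open>r\<^sub>i\<^sub>j\<close> that is the same for all pairs.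
\<close>

lemma norm_vel_diff_le:
  assumes x: "x \<in> Dom \<sigma>" and \<sigma>: "0 \<le> \<sigma>" and ij: "i \<in> {1..N}" "j \<in> {1..N}" "i \<noteq> j"
  shows "s0 * norm (vel x i - vel x j) \<le> norm (q0 i - q0 j) * (1 + \<sigma>)"
proof -
  define r where "r = norm (q0 i - q0 j)"
  have r: "r > 0" using dist_pos[OF ij] by (simp add: r_def)
  have "norm (vel x i - vel x j) \<le> norm (v0 i - v0 j) + s0 * M N G m q0 i j * \<sigma>"
    using vel_diff_bound[OF x ij(1,2)] norm_triangle_sub[of "vel x i - vel x j" "cvec (v0 i - v0 j)"] by simp
  then have "s0 * norm (vel x i - vel x j) \<le> s0 * (norm (v0 i - v0 j) + s0 * M N G m q0 i j * \<sigma>)"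
    using s0 by (intro mult_left_mono) auto
  also have "\<dots> = r * (s0 * (norm (v0 i - v0 j) / r)) + r * (s0 ^ 2 * (M N G m q0 i j / r)) * \<sigma>"
    using r by (simp add: algebra_simps power2_eq_square)
  also have "\<dots> \<le> r * 1 + r * 1 * \<sigma>"
    using pair_bounds[OF ij] r \<sigma> unfolding r_def
    by (intro add_mono mult_left_mono mult_right_mono) auto
  finally show ?thesis by (simp add: r_def algebra_simps)
qed

end

section \<open>Holomorphic solutions on a disc of radius beta\<close>

context nbody_initial
begin

definition state_dist :: "state \<Rightarrow> state \<Rightarrow> real" where
  "state_dist x y = (\<Sum>k\<in>coords. cmod (x k - y k))"

lemma state_dist_nonneg: "0 \<le> state_dist x y"
  by (simp add: state_dist_def sum_nonneg)

lemma coord_le_state_dist: "k \<in> coords \<Longrightarrow> cmod (x k - y k) \<le> state_dist x y"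
  unfolding state_dist_def using finite_coords by (intro member_le_sum) auto

lemma lipschitz_vel:
  assumes i: "i \<in> {1..N}"
  shows "lipschitz_bounded (Dom \<sigma>) state_dist (\<lambda>x. vel x i $ k)"
proof (rule lipschitz_boundedI[where L=1])
  fix x assume x: "x \<in> Dom \<sigma>"
  have "cmod (vel x i $ k) \<le> norm (vel x i)" by (rule Finite_Cartesian_Product.norm_nth_le)
  also have "\<dots> \<le> norm (v0 i) + s0 * K N G m q0 i * \<sigma>"
    using DomD(1)[OF x i] norm_triangle_sub[of "vel x i" "cvec (v0 i)"] by simp
  finally show "cmod (vel x i $ k) \<le> norm (v0 i) + s0 * K N G m q0 i * \<sigma>" .
next
  show "cmod (vel x i $ k - vel y i $ k) \<le> 1 * state_dist x y" for x y
    using coord_le_state_dist[of "(True, i, k)" x y] i by simp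
qed (rule state_dist_nonneg)

lemma lipschitz_posn_diff:
  assumes ij: "i \<in> {1..N}" "j \<in> {1..N}" "i \<noteq> j"
  shows "lipschitz_bounded (Dom \<sigma>) state_dist (\<lambda>x. (posn x i - posn x j) $ k)"
proof (rule lipschitz_boundedI[where L=2])
  fix x assume x: "x \<in> Dom \<sigma>"
  have "cmod ((posn x i - posn x j) $ k) \<le> norm (posn x i - posn x j)" by (rule Finite_Cartesian_Product.norm_nth_le)
  also have "\<dots> \<le> norm (q0 i - q0 j) + norm (q0 i - q0 j) * (dist_maj \<sigma> - 1)"
    using DomD(2)[OF x ij] norm_triangle_sub[of "posn x i - posn x j" "cvec (q0 i - q0 j)"] by simp
  finally show "cmod ((posn x i - posn x j) $ k)
     \<le> norm (q0 i - q0 j) + norm (q0 i - q0 j) * (dist_maj \<sigma> - 1)" .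
next
  fix x y
  have "cmod ((x (False,i,k) - y (False,i,k)) - (x (False,j,k) - y (False,j,k))) \<le> state_dist x y + state_dist x y"
    by (rule order_trans[OF norm_triangle_ineq4]) (intro add_mono coord_le_state_dist, use ij in auto)
  then show "cmod ((posn x i - posn x j) $ k - (posn y i - posn y j) $ k) \<le> 2 * state_dist x y"
    by (simp add: algebra_simps)
qed (rule state_dist_nonneg)

lemma lipschitz_dotc:
  assumes "\<And>k. lipschitz_bounded D state_dist (\<lambda>x. f x $ k)" "\<And>k. lipschitz_bounded D state_dist (\<lambda>x. h x $ k)"
  shows "lipschitz_bounded D state_dist (\<lambda>x. dotc (f x) (h x))"
  unfolding dotc_def by (intro lipschitz_bounded_sum lipschitz_bounded_mult assms state_dist_nonneg)

lemma Re_dist_sq_ge: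
  assumes x: "x \<in> Dom \<sigma>" and \<sigma>: "0 \<le> \<sigma>" and ij: "i \<in> {1..N}" "j \<in> {1..N}" "i \<noteq> j"
  shows "(norm (q0 i - q0 j) / inv_dist_maj \<sigma>) ^ 2 \<le> Re (dotc (posn x i - posn x j) (posn x i - posn x j))"
  using majorized_imp_Re[OF majorized_dist_sq[OF x ij]] unfolding dist_sq_slack[OF \<sigma>] .

lemma dist_sq_lower_pos:
  assumes \<sigma>: "0 \<le> \<sigma>" and ij: "i \<in> {1..N}" "j \<in> {1..N}" "i \<noteq> j"
  shows "(norm (q0 i - q0 j) / inv_dist_maj \<sigma>) ^ 2 > 0"
  using dist_pos[OF ij] inv_dist_maj_ge_1[OF \<sigma>] by simp

lemma Re_S_ge:
  assumes x: "x \<in> Dom \<sigma>" and \<sigma>: "0 \<le> \<sigma>" "\<sigma> < v_plus"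
  shows "SR q0 v0 * (2 + 2 * inv_dist_maj \<sigma> ^ 2 - 3 * inv_dist_maj \<sigma> ^ 3) \<le> Re (SC (posn x) (vel x))"
  using majorized_imp_Re[OF majorized_S[OF x \<sigma>(1)]] unfolding S_slack(1)[OF \<sigma>] .

lemma lipschitz_inv_dist:
  assumes \<sigma>: "0 \<le> \<sigma>" and ij: "i \<in> {1..N}" "j \<in> {1..N}" "i \<noteq> j"
  shows "lipschitz_bounded (Dom \<sigma>) state_dist (\<lambda>x. inv_distC (posn x) i j)"
  unfolding inv_distC_def
  by (rule lipschitz_bounded_rsqrt[OF _ dist_sq_lower_pos[OF \<sigma> ij] Re_dist_sq_ge[OF _ \<sigma> ij]])
     (intro lipschitz_dotc lipschitz_posn_diff ij)

lemma lipschitz_K: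
  assumes \<sigma>: "0 \<le> \<sigma>" and i: "i \<in> {1..N}"
  shows "lipschitz_bounded (Dom \<sigma>) state_dist (\<lambda>x. KC (posn x) i)"
  unfolding KC_def
  by (intro lipschitz_bounded_sum lipschitz_bounded_mult lipschitz_bounded_const lipschitz_bounded_power
      lipschitz_inv_dist[OF \<sigma>] state_dist_nonneg) (use i in auto)

lemma lipschitz_S:
  assumes \<sigma>: "0 \<le> \<sigma>"
  shows "lipschitz_bounded (Dom \<sigma>) state_dist (\<lambda>x. SC (posn x) (vel x))"
proof -
  have "lipschitz_bounded (Dom \<sigma>) state_dist
          (\<lambda>x. dotc (vel x i - vel x j) (vel x i - vel x j) * inv_distC (posn x) i j ^ 2)"
    "lipschitz_bounded (Dom \<sigma>) state_dist (\<lambda>x. (KC (posn x) i + KC (posn x) j) * inv_distC (posn x) i j)"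
    if "i \<in> {1..N}" "j \<in> {i+1..N}" for i j
  proof -
    have ij: "i \<in> {1..N}" "j \<in> {1..N}" "i \<noteq> j" using that by auto
    have "lipschitz_bounded (Dom \<sigma>) state_dist (\<lambda>x. vel x i $ k + (- 1) * vel x j $ k)" for k
      by (intro lipschitz_bounded_add lipschitz_bounded_mult lipschitz_bounded_const state_dist_nonneg
          lipschitz_vel ij)
    then have "lipschitz_bounded (Dom \<sigma>) state_dist (\<lambda>x. (vel x i - vel x j) $ k)" for k
      by simp
    then show "lipschitz_bounded (Dom \<sigma>) state_dist
          (\<lambda>x. dotc (vel x i - vel x j) (vel x i - vel x j) * inv_distC (posn x) i j ^ 2)"
      by (intro lipschitz_bounded_mult lipschitz_bounded_power lipschitz_inv_dist[OF \<sigma> ij] lipschitz_dotc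
          state_dist_nonneg)
    show "lipschitz_bounded (Dom \<sigma>) state_dist (\<lambda>x. (KC (posn x) i + KC (posn x) j) * inv_distC (posn x) i j)"
      by (intro lipschitz_bounded_mult lipschitz_bounded_add lipschitz_K[OF \<sigma>] lipschitz_inv_dist[OF \<sigma> ij] ij)
  qed
  then show ?thesis unfolding SC_def
    by (intro lipschitz_bounded_add lipschitz_bounded_sum state_dist_nonneg)
qed

lemma lipschitz_field:
  assumes \<sigma>: "0 \<le> \<sigma>" "\<sigma> < v_plus" and "i \<in> {1..N}"
  shows "lipschitz_bounded (Dom \<sigma>) state_dist (\<lambda>x. field x (b, i, k))"
proof -
  have s: "lipschitz_bounded (Dom \<sigma>) state_dist (\<lambda>x. rsqrt (SC (posn x) (vel x)))"
    by (rule lipschitz_bounded_rsqrt[OF lipschitz_S[OF \<sigma>(1)] S_slack(2)[OF \<sigma>] Re_S_ge[OF _ \<sigma>]])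
  have "lipschitz_bounded (Dom \<sigma>) state_dist (\<lambda>x. accelC (posn x) i $ k)"
    unfolding accelC_def sum_component vector_smult_component
    by (intro lipschitz_bounded_sum lipschitz_bounded_mult lipschitz_bounded_const lipschitz_bounded_power
      lipschitz_inv_dist[OF \<sigma>(1)] lipschitz_posn_diff state_dist_nonneg) (use assms in auto)
  then show ?thesis unfolding field_def prod.case
    using lipschitz_bounded_mult[OF s] lipschitz_vel[OF assms(3)] by (cases b) (auto simp del: vel_nth)
qed

lemma field_lipschitz_constant:
  assumes \<sigma>: "0 \<le> \<sigma>" "\<sigma> < v_plus"
  obtains L where "\<And>x y k. x \<in> Dom \<sigma> \<Longrightarrow> y \<in> Dom \<sigma> \<Longrightarrow> k \<in> coords \<Longrightarrow>
     cmod (field x k - field y k) \<le> L * (\<Sum>i\<in>coords. cmod (x i - y i))"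
proof -
  have "\<exists>L. \<forall>x\<in>Dom \<sigma>. \<forall>y\<in>Dom \<sigma>. cmod (field x k - field y k) \<le> L * state_dist x y" if "k \<in> coords" for k
    using lipschitz_field[OF \<sigma>, of "fst (snd k)" "fst k" "snd (snd k)"] that
    unfolding lipschitz_bounded_def by (cases k) fastforce
  then obtain L where L: "\<And>k x y. k \<in> coords \<Longrightarrow> x \<in> Dom \<sigma> \<Longrightarrow> y \<in> Dom \<sigma> \<Longrightarrow>
     cmod (field x k - field y k) \<le> L k * state_dist x y" by metis
  show ?thesis
  proof (rule that[of "\<Sum>k\<in>coords. \<bar>L k\<bar>"])
    fix x y k assume xy: "x \<in> Dom \<sigma>" "y \<in> Dom \<sigma>" and k: "k \<in> coords"
    have "L k \<le> \<bar>L k\<bar>" by simp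
    also have "\<dots> \<le> (\<Sum>k\<in>coords. \<bar>L k\<bar>)" using k finite_coords by (intro member_le_sum) auto
    finally have "L k * state_dist x y \<le> (\<Sum>k\<in>coords. \<bar>L k\<bar>) * state_dist x y"
      by (rule mult_right_mono) (rule state_dist_nonneg)
    then show "cmod (field x k - field y k) \<le> (\<Sum>k\<in>coords. \<bar>L k\<bar>) * (\<Sum>i\<in>coords. cmod (x i - y i))"
      using L[OF k xy] by (simp add: state_dist_def)
  qed
qed

lemma field_holomorphic:
  fixes x :: "complex \<Rightarrow> state"
  assumes hol: "\<And>k. k \<in> coords \<Longrightarrow> (\<lambda>z. x z k) holomorphic_on S"
    and dom: "\<And>z. z \<in> S \<Longrightarrow> x z \<in> Dom (\<sigma> z)" and \<sigma>: "\<And>z. z \<in> S \<Longrightarrow> 0 \<le> \<sigma> z \<and> \<sigma> z < v_plus"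
    and k: "k \<in> coords"
  shows "(\<lambda>z. field (x z) k) holomorphic_on S"
proof -
  have inv: "(\<lambda>z. inv_distC (posn (x z)) i j) holomorphic_on S"
    if ij: "i \<in> {1..N}" "j \<in> {1..N}" "i \<noteq> j" for i j
    unfolding inv_distC_def
  proof (rule holomorphic_on_rsqrt)
    show "(\<lambda>z. dotc (posn (x z) i - posn (x z) j) (posn (x z) i - posn (x z) j)) holomorphic_on S"
      unfolding dotc_def vector_minus_component posn_nth
      by (intro holomorphic_on_sum holomorphic_on_mult holomorphic_on_diff hol) (use ij in auto)
    fix z assume z: "z \<in> S"
    show "Re (dotc (posn (x z) i - posn (x z) j) (posn (x z) i - posn (x z) j)) > 0"
      using Re_dist_sq_ge[OF dom[OF z] _ ij] dist_sq_lower_pos[OF _ ij] \<sigma>[OF z] by (meson less_le_trans)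
  qed
  have KC: "(\<lambda>z. KC (posn (x z)) i) holomorphic_on S" if "i \<in> {1..N}" for i
    unfolding KC_def using that
    by (intro holomorphic_on_sum holomorphic_on_mult holomorphic_on_power holomorphic_on_const inv) auto
  have s: "(\<lambda>z. rsqrt (SC (posn (x z)) (vel (x z)))) holomorphic_on S"
  proof (rule holomorphic_on_rsqrt)
    show "(\<lambda>z. SC (posn (x z)) (vel (x z))) holomorphic_on S"
      unfolding SC_def dotc_def vector_minus_component vel_nth
      by (intro holomorphic_on_add holomorphic_on_sum holomorphic_on_mult holomorphic_on_diff
          holomorphic_on_power inv hol KC) auto
    fix z assume z: "z \<in> S"
    show "Re (SC (posn (x z)) (vel (x z))) > 0"
      using Re_S_ge[OF dom[OF z]] S_slack(2) \<sigma>[OF z] by (meson less_le_trans)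
  qed
  obtain b i l where kb: "k = (b, i, l)" by (cases k)
  have i: "i \<in> {1..N}" using k kb by simp
  have "(\<lambda>z. accelC (posn (x z)) i $ l) holomorphic_on S"
    unfolding accelC_def sum_component vector_smult_component vector_minus_component posn_nth
    by (intro holomorphic_on_sum holomorphic_on_mult holomorphic_on_diff holomorphic_on_const
        holomorphic_on_power inv hol) (use i in auto)
  moreover have "(\<lambda>z. vel (x z) i $ l) holomorphic_on S" using hol i by simp
  ultimately show ?thesis
    unfolding field_def kb prod.case by (cases b) (auto intro!: holomorphic_on_mult s simp del: vel_nth)
qed

definition real_posn :: "state \<Rightarrow> nat \<Rightarrow> real^3" where
  "real_posn x i = (\<chi> k. Re (x (False, i, k)))"

definition real_vel :: "state \<Rightarrow> nat \<Rightarrow> real^3" where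
  "real_vel x i = (\<chi> k. Re (x (True, i, k)))"

lemma real_parts:
  assumes real: "\<And>k. k \<in> coords \<Longrightarrow> x k \<in> \<real>" and i: "i \<in> {1..N}"
  shows "posn x i = cvec (real_posn x i)" "vel x i = cvec (real_vel x i)"
  using real i by (auto simp: vec_eq_iff real_posn_def real_vel_def of_real_Re)

text \<open>
  The bound \<open>dist_maj \<sigma> < 2\<close> keeps the change of every relative position below its initial length.
\<close>

lemma Dom_collision_free:
  assumes x: "x \<in> Dom \<sigma>" and \<sigma>: "0 \<le> \<sigma>" and real: "\<And>k. k \<in> coords \<Longrightarrow> x k \<in> \<real>"
  shows "collision_free (real_posn x)"
  unfolding collision_free_def
proof (intro ballI impI notI)
  fix i j assume ij: "i \<in> {1..N}" "j \<in> {1..N}" "i \<noteq> j" and "real_posn x i = real_posn x j"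
  then have "posn x i - posn x j = 0" using real_parts[OF real] by simp
  then have "norm (q0 i - q0 j) \<le> norm (q0 i - q0 j) * (dist_maj \<sigma> - 1)"
    using DomD(2)[OF x ij] by simp
  moreover have "norm (q0 i - q0 j) * (dist_maj \<sigma> - 1) < norm (q0 i - q0 j) * 1"
    using dist_pos[OF ij] dist_maj_bounds(3)[OF \<sigma>] by (intro mult_strict_left_mono) auto
  ultimately show False by simp
qed

lemma field_in_Reals:
  assumes "x \<in> Dom \<sigma>" "0 \<le> \<sigma>" and real: "\<And>k. k \<in> coords \<Longrightarrow> x k \<in> \<real>" and "k \<in> coords"
  shows "field x k \<in> \<real>"
  using field_real[OF real_parts[OF real] Dom_collision_free[OF assms(1,2) real]] assms(4)
  by (cases k) auto

text \<open>
  The sets \<open>D z\<close> of the Picard iteration consist of the states in \<open>Dom (\<sigma> |z|)\<close> that are real if \<open>z\<close> is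
  real, with \<open>\<sigma>\<close> the solution of the scalar equation. They are respected by the iteration because
  the a priori bounds make the velocity of body \<open>i\<close> change at a rate of at most \<open>s\<^sub>0 K\<^sub>i \<sigma>'\<close>, and
  the relative positions at a rate of at most \<open>r\<^sub>i\<^sub>j \<kappa> (1 + \<sigma>) = r\<^sub>i\<^sub>j (X \<circ> \<sigma>)'\<close>.
\<close>

lemma holomorphic_solution:
  obtains y :: "complex \<Rightarrow> state" and \<sigma> :: "real \<Rightarrow> real" where
    "\<And>z. z \<in> ball 0 beta \<Longrightarrow> 0 \<le> \<sigma> (cmod z) \<and> y z \<in> Dom (\<sigma> (cmod z))"
    "\<And>k. k \<in> coords \<Longrightarrow> y 0 k = real_state q0 v0 k"
    "\<And>k z. k \<in> coords \<Longrightarrow> z \<in> ball 0 beta \<Longrightarrow> ((\<lambda>z. y z k) has_field_derivative field (y z) k) (at z)"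
    "\<And>t k. \<bar>t\<bar> < beta \<Longrightarrow> k \<in> coords \<Longrightarrow> y (of_real t) k \<in> \<real>"
proof -
  obtain \<sigma> :: "real \<Rightarrow> real" where
    b: "beta > 0" and \<sigma>0: "\<sigma> 0 = 0" and c\<sigma>: "continuous_on {0..<beta} \<sigma>"
    and mono: "mono_on {0..<beta} \<sigma>"
    and rng: "\<And>t. 0 \<le> t \<Longrightarrow> t < beta \<Longrightarrow> 0 \<le> \<sigma> t \<and> \<sigma> t < v_plus"
    and d\<sigma>: "\<And>t. 0 < t \<Longrightarrow> t < beta \<Longrightarrow>
       (\<sigma> has_real_derivative renorm_maj (\<sigma> t) * dist_maj (\<sigma> t) * inv_dist_maj (\<sigma> t) ^ 3) (at t)"
    using majorant_solution by blast
  define D where "D = (\<lambda>z. {x \<in> Dom (\<sigma> (cmod z)). z \<in> \<real> \<longrightarrow> (\<forall>k\<in>coords. x k \<in> \<real>)})"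
  have rngz: "0 \<le> \<sigma> (cmod z) \<and> \<sigma> (cmod z) < v_plus" if "z \<in> ball 0 beta" for z
    using rng[of "cmod z"] that by simp
  have invariant: "y z \<in> D z" if x: "\<And>z. z \<in> ball 0 beta \<Longrightarrow> x z \<in> D z"
    and dy: "\<And>k z. k \<in> coords \<Longrightarrow> z \<in> ball 0 beta \<Longrightarrow> ((\<lambda>z. y z k) has_field_derivative field (x z) k) (at z)"
    and y0: "\<And>k. k \<in> coords \<Longrightarrow> y 0 k = real_state q0 v0 k" and z: "z \<in> ball 0 beta" for x y z
  proof -
    have xD: "x z \<in> Dom (\<sigma> (cmod z))" if "z \<in> ball 0 beta" for z using x[OF that] by (simp add: D_def)
    have vel0: "vel (y 0) i = cvec (v0 i)" and pos0: "posn (y 0) i = cvec (q0 i)" if "i \<in> {1..N}" for i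
      using y0 that by (auto simp: vec_eq_iff real_state_def)
    have sl: "cmod (rsqrt (SC (posn (x z)) (vel (x z)))) \<le> s0 * renorm_maj (\<sigma> (cmod z))"
      if "z \<in> ball 0 beta" for z using norm_renormC_le[OF xD[OF that]] rngz[OF that] by blast
    have rm: "renorm_maj (\<sigma> (cmod z)) \<ge> 0" if "z \<in> ball 0 beta" for z
      using renorm_maj_pos[of "\<sigma> (cmod z)"] rngz[OF that] by simp
    (* The derivative of \<phi> is the majorant equation multiplied by s0 * K_i. *)
    have velb: "norm (vel (y z) i - cvec (v0 i)) \<le> s0 * K N G m q0 i * \<sigma> (cmod z)" if i: "i \<in> {1..N}" for i
    proof -
      define \<phi> where "\<phi> = (\<lambda>t. s0 * K N G m q0 i * \<sigma> t)"
      have "norm (vel (y z) i - vel (y 0) i) \<le> \<phi> (cmod z) - \<phi> 0"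
      proof (rule radial_bound_vec[where h="\<lambda>z. vel (y z) i" and r=beta
            and h'="\<lambda>z. rsqrt (SC (posn (x z)) (vel (x z))) *s accelC (posn (x z)) i"
            and \<phi>'="\<lambda>t. s0 * K N G m q0 i * (renorm_maj (\<sigma> t) * dist_maj (\<sigma> t) * inv_dist_maj (\<sigma> t) ^ 3)"])
        show "((\<lambda>z. vel (y z) i $ k) has_field_derivative
            (rsqrt (SC (posn (x z)) (vel (x z))) *s accelC (posn (x z)) i) $ k) (at z)"
          if "z \<in> ball 0 beta" for z k
          using dy[of "(True, i, k)", OF _ that] i by (simp add: field_def)
        show "continuous_on {0..<beta} \<phi>" unfolding \<phi>_def by (intro continuous_intros c\<sigma>)
        show "(\<phi> has_real_derivative s0 * K N G m q0 i *
            (renorm_maj (\<sigma> t) * dist_maj (\<sigma> t) * inv_dist_maj (\<sigma> t) ^ 3)) (at t)"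
          if "0 < t" "t < beta" for t
          unfolding \<phi>_def by (intro DERIV_cmult d\<sigma> that)
        fix z :: complex assume z: "z \<in> ball 0 beta"
        have "norm (rsqrt (SC (posn (x z)) (vel (x z))) *s accelC (posn (x z)) i)
          \<le> (s0 * renorm_maj (\<sigma> (cmod z))) * (K N G m q0 i * (dist_maj (\<sigma> (cmod z)) * inv_dist_maj (\<sigma> (cmod z)) ^ 3))"
          unfolding norm_vector_smult
          using s0 rm[OF z] norm_accelC_le[OF xD[OF z] _ i] rngz[OF z]
          by (intro mult_mono sl z) auto
        then show "norm (rsqrt (SC (posn (x z)) (vel (x z))) *s accelC (posn (x z)) i)
          \<le> s0 * K N G m q0 i * (renorm_maj (\<sigma> (cmod z)) * dist_maj (\<sigma> (cmod z)) * inv_dist_maj (\<sigma> (cmod z)) ^ 3)"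
          by (simp add: mult_ac)
      qed (rule z)
      then show ?thesis by (simp add: vel0[OF i] \<phi>_def \<sigma>0)
    qed
    have posb: "norm (posn (y z) i - posn (y z) j - cvec (q0 i - q0 j)) \<le> norm (q0 i - q0 j) * (dist_maj (\<sigma> (cmod z)) - 1)"
      if ij: "i \<in> {1..N}" "j \<in> {1..N}" "i \<noteq> j" for i j
    proof -
      define r where "r = norm (q0 i - q0 j)"
      define \<phi> where "\<phi> = (\<lambda>t. r * dist_maj (\<sigma> t))"
      have "norm ((posn (y z) i - posn (y z) j) - (posn (y 0) i - posn (y 0) j)) \<le> \<phi> (cmod z) - \<phi> 0"
      proof (rule radial_bound_vec[where h="\<lambda>z. posn (y z) i - posn (y z) j" and r=beta
            and h'="\<lambda>z. rsqrt (SC (posn (x z)) (vel (x z))) *s (vel (x z) i - vel (x z) j)"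
            and \<phi>'="\<lambda>t. r * ((1 + \<sigma> t) * renorm_maj (\<sigma> t))"])
        show "((\<lambda>z. (posn (y z) i - posn (y z) j) $ k) has_field_derivative
            (rsqrt (SC (posn (x z)) (vel (x z))) *s (vel (x z) i - vel (x z) j)) $ k) (at z)"
          if "z \<in> ball 0 beta" for z k
          using DERIV_diff[OF dy[of "(False, i, k)", OF _ that] dy[of "(False, j, k)", OF _ that]] ij
          by (simp add: field_def algebra_simps)
        have "continuous_on {0..} dist_maj"
          by (intro continuous_at_imp_continuous_on ballI DERIV_isCont[OF dist_maj_deriv]) simp
        then have "continuous_on {0..<beta} (\<lambda>t. dist_maj (\<sigma> t))"
          by (rule continuous_on_compose2[OF _ c\<sigma>]) (use rng in auto)
        then show "continuous_on {0..<beta} \<phi>" unfolding \<phi>_def by (intro continuous_intros)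
        show "(\<phi> has_real_derivative r * ((1 + \<sigma> t) * renorm_maj (\<sigma> t))) (at t)"
          if t: "0 < t" "t < beta" for t
        proof -
          have s: "0 \<le> \<sigma> t" using rng[of t] t by simp
          have nz: "dist_maj (\<sigma> t) \<noteq> 0" "inv_dist_maj (\<sigma> t) \<noteq> 0"
            using dist_maj_bounds(1)[OF s] inv_dist_maj_ge_1[OF s] by auto
          have "((\<lambda>t. dist_maj (\<sigma> t)) has_real_derivative
             (1 + \<sigma> t) / (dist_maj (\<sigma> t) * inv_dist_maj (\<sigma> t) ^ 3) *
             (renorm_maj (\<sigma> t) * dist_maj (\<sigma> t) * inv_dist_maj (\<sigma> t) ^ 3)) (at t)"
            by (rule DERIV_chain2[OF dist_maj_deriv[OF s] d\<sigma>[OF t]])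
          also have "(1 + \<sigma> t) / (dist_maj (\<sigma> t) * inv_dist_maj (\<sigma> t) ^ 3) *
             (renorm_maj (\<sigma> t) * dist_maj (\<sigma> t) * inv_dist_maj (\<sigma> t) ^ 3) = (1 + \<sigma> t) * renorm_maj (\<sigma> t)"
            using nz by simp
          finally show ?thesis unfolding \<phi>_def by (rule DERIV_cmult)
        qed
        fix z :: complex assume z: "z \<in> ball 0 beta"
        have "norm (rsqrt (SC (posn (x z)) (vel (x z))) *s (vel (x z) i - vel (x z) j))
          \<le> (s0 * renorm_maj (\<sigma> (cmod z))) * norm (vel (x z) i - vel (x z) j)"
          unfolding norm_vector_smult by (intro mult_right_mono sl z) simp
        also have "\<dots> = renorm_maj (\<sigma> (cmod z)) * (s0 * norm (vel (x z) i - vel (x z) j))" by simp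
        also have "\<dots> \<le> renorm_maj (\<sigma> (cmod z)) * (r * (1 + \<sigma> (cmod z)))"
          unfolding r_def using norm_vel_diff_le[OF xD[OF z] _ ij] rngz[OF z] rm[OF z]
          by (intro mult_left_mono) auto
        finally show "norm (rsqrt (SC (posn (x z)) (vel (x z))) *s (vel (x z) i - vel (x z) j))
          \<le> r * ((1 + \<sigma> (cmod z)) * renorm_maj (\<sigma> (cmod z)))" by (simp add: mult_ac)
      qed (rule z)
      moreover have "dist_maj 0 = 1" by (simp add: dist_maj_def inv_dist_maj_def)
      ultimately show ?thesis
        by (simp add: pos0[OF ij(1)] pos0[OF ij(2)] cvec_diff \<phi>_def \<sigma>0 r_def right_diff_distrib)
    qed
    have "y z k \<in> \<real>" if "z \<in> \<real>" and k: "k \<in> coords" for k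
    proof -
      obtain t where t: "z = of_real t" using \<open>z \<in> \<real>\<close> by (auto elim: Reals_cases)
      have "y (of_real t) k \<in> \<real>"
      proof (rule real_on_real_axis[OF dy[OF k]])
        show "field (x (of_real u)) k \<in> \<real>" if "\<bar>u\<bar> < beta" for u
          using x[of "of_real u"] rngz[of "of_real u"] that k
          by (intro field_in_Reals[where \<sigma>="\<sigma> (cmod (of_real u))"]) (auto simp: D_def)
        show "y 0 k \<in> \<real>" unfolding y0[OF k] by (cases k) (simp add: real_state_def)
        show "\<bar>t\<bar> < beta" using z t by simp
      qed
      then show ?thesis by (simp add: t)
    qed
    then show "y z \<in> D z" using velb posb by (simp add: D_def Dom_def)
  qed
  obtain y where y: "\<And>z. z \<in> ball 0 beta \<Longrightarrow> y z \<in> D z" "\<And>k. k \<in> coords \<Longrightarrow> y 0 k = real_state q0 v0 k"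
    "\<And>k z. k \<in> coords \<Longrightarrow> z \<in> ball 0 beta \<Longrightarrow> ((\<lambda>z. y z k) has_field_derivative field (y z) k) (at z)"
  proof (rule holomorphic_Picard[of coords beta "real_state q0 v0" D field])
    show "real_state q0 v0 \<in> D z" if "z \<in> ball 0 beta" for z
      using initial_in_Dom rngz[OF that] by (auto simp: D_def real_state_def)
    show "(\<lambda>z. field (x z) k) holomorphic_on ball 0 beta"
      if "\<And>k. k \<in> coords \<Longrightarrow> (\<lambda>z. x z k) holomorphic_on ball 0 beta"
        "\<And>z. z \<in> ball 0 beta \<Longrightarrow> x z \<in> D z" "k \<in> coords" for x k
      by (rule field_holomorphic[where \<sigma>="\<lambda>z. \<sigma> (cmod z)"]) (use that rngz in \<open>auto simp: D_def\<close>)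
    show "\<exists>L. \<forall>z\<in>cball 0 \<rho>. \<forall>x\<in>D z. \<forall>y\<in>D z. \<forall>k\<in>coords.
        cmod (field x k - field y k) \<le> L * (\<Sum>i\<in>coords. cmod (x i - y i))"
      if \<rho>: "0 < \<rho>" "\<rho> < beta" for \<rho>
    proof -
      obtain L where L: "\<And>x y k. x \<in> Dom (\<sigma> \<rho>) \<Longrightarrow> y \<in> Dom (\<sigma> \<rho>) \<Longrightarrow> k \<in> coords \<Longrightarrow>
         cmod (field x k - field y k) \<le> L * (\<Sum>i\<in>coords. cmod (x i - y i))"
        using field_lipschitz_constant[of "\<sigma> \<rho>"] rng[of \<rho>] \<rho> by auto
      have "D z \<subseteq> Dom (\<sigma> \<rho>)" if "z \<in> cball 0 \<rho>" for z
      proof -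
        have "\<sigma> (cmod z) \<le> \<sigma> \<rho>" using mono_onD[OF mono, of "cmod z" \<rho>] that \<rho> by simp
        then have "Dom (\<sigma> (cmod z)) \<subseteq> Dom (\<sigma> \<rho>)"
          using rng[of "cmod z"] that \<rho> by (intro Dom_mono) auto
        then show ?thesis by (auto simp: D_def)
      qed
      then show ?thesis using L by (intro exI[of _ L]) blast
    qed
    show "x \<in> D z" if z: "z \<in> ball 0 beta" and X: "\<And>n. X n \<in> D z"
      and lim: "\<And>k. k \<in> coords \<Longrightarrow> (\<lambda>n. X n k) \<longlonglongrightarrow> x k" for X x z
    proof -
      have XD: "X n \<in> Dom (\<sigma> (cmod z))" for n using X[of n] by (simp add: D_def)
      have lv: "(\<lambda>n. vel (X n) i) \<longlonglongrightarrow> vel x i" and lp: "(\<lambda>n. posn (X n) i) \<longlonglongrightarrow> posn x i"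
        if "i \<in> {1..N}" for i using lim that by (auto intro!: vec_tendstoI)
      have "norm (vel x i - cvec (v0 i)) \<le> s0 * K N G m q0 i * \<sigma> (cmod z)" if i: "i \<in> {1..N}" for i
        by (rule Lim_bounded[where M=0, OF tendsto_norm[OF tendsto_diff[OF lv[OF i] tendsto_const]]])
           (use DomD(1)[OF XD i] in auto)
      moreover have "norm (posn x i - posn x j - cvec (q0 i - q0 j)) \<le> norm (q0 i - q0 j) * (dist_maj (\<sigma> (cmod z)) - 1)"
        if ij: "i \<in> {1..N}" "j \<in> {1..N}" "i \<noteq> j" for i j
        by (rule Lim_bounded[where M=0, OF tendsto_norm[OF tendsto_diff[OF tendsto_diff[OF lp[OF ij(1)] lp[OF ij(2)]] tendsto_const]]])
           (use DomD(2)[OF XD ij] in auto)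
      moreover have "x k \<in> \<real>" if "z \<in> \<real>" and k: "k \<in> coords" for k
        by (rule closed_sequentially[OF closed_complex_Reals _ lim[OF k]]) (use X that in \<open>auto simp: D_def\<close>)
      ultimately show ?thesis by (simp add: D_def Dom_def)
    qed
  qed (use finite_coords b invariant in blast)+
  show ?thesis
  proof (rule that[of \<sigma> y, OF _ y(2,3)])
    show "0 \<le> \<sigma> (cmod z) \<and> y z \<in> Dom (\<sigma> (cmod z))" if "z \<in> ball 0 beta" for z
      using y(1)[OF that] rngz[OF that] by (simp add: D_def)
    show "y (of_real t) k \<in> \<real>" if "\<bar>t\<bar> < beta" "k \<in> coords" for t k
      using y(1)[of "of_real t"] that by (simp add: D_def)
  qed
qed

end

section \<open>Uniqueness and gluing of real solutions\<close>

lemma has_vector_derivative_vec_componentwise: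
  fixes f :: "real \<Rightarrow> real^'n"
  assumes "\<And>k. ((\<lambda>t. f t $ k) has_vector_derivative d $ k) (at t)"
  shows "(f has_vector_derivative d) (at t)"
  unfolding has_vector_derivative_def has_derivative_componentwise_within[of f]
proof
  fix b :: "real^'n" assume "b \<in> Basis"
  then obtain k where b: "b = axis k 1" by (auto simp: Basis_vec_def)
  show "((\<lambda>x. f x \<bullet> b) has_derivative (\<lambda>x. (x *\<^sub>R d) \<bullet> b)) (at t)"
    using assms[of k] by (simp add: b inner_axis has_vector_derivative_def)
qed

lemma dist_maj_gt_1:
  assumes "\<sigma> > 0"
  shows "dist_maj \<sigma> > 1"
proof -
  have "inv_dist_maj \<sigma> > 1" using assms by (simp add: inv_dist_maj_def add_pos_nonneg)
  then have "1 / inv_dist_maj \<sigma> ^ 2 < 1" by simp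
  then show ?thesis by (simp add: dist_maj_def)
qed

context nbody
begin

text \<open>
  The differential equations without an initial condition, so that solutions can be shifted in time and
  restarted at any state.
\<close>

definition solves :: "real set \<Rightarrow> (real \<Rightarrow> nat \<Rightarrow> real^3) \<Rightarrow> (real \<Rightarrow> nat \<Rightarrow> real^3) \<Rightarrow> bool" where
  "solves T Q V \<longleftrightarrow> (\<forall>\<tau>\<in>T. collision_free (Q \<tau>) \<and> (\<forall>i\<in>{1..N}.
     ((\<lambda>t. Q t i) has_vector_derivative renorm N G m (Q \<tau>) (V \<tau>) *\<^sub>R V \<tau> i) (at \<tau>) \<and>
     ((\<lambda>t. V t i) has_vector_derivative renorm N G m (Q \<tau>) (V \<tau>) *\<^sub>R accel N G m (Q \<tau>) i) (at \<tau>)))"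

text \<open>
  Configurations carry irrelevant values outside \<open>{1..N}\<close>, so equality is too strong a notion of coincidence.
\<close>

definition agree :: "(nat \<Rightarrow> real^3) \<Rightarrow> (nat \<Rightarrow> real^3) \<Rightarrow> (nat \<Rightarrow> real^3) \<Rightarrow> (nat \<Rightarrow> real^3) \<Rightarrow> bool" where
  "agree Q V Q' V' \<longleftrightarrow> (\<forall>i\<in>{1..N}. Q i = Q' i \<and> V i = V' i)"

lemma agree_refl: "agree Q V Q V"
  and agree_sym: "agree Q V Q' V' \<Longrightarrow> agree Q' V' Q V"
  and agree_trans: "agree Q V Q' V' \<Longrightarrow> agree Q' V' Q'' V'' \<Longrightarrow> agree Q V Q'' V''"
  by (auto simp: agree_def)

lemma renormalized_solution_iff:
  "renormalized_solution N G m q v T Q V \<longleftrightarrow> agree (Q 0) (V 0) q v \<and> solves T Q V"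
  unfolding renormalized_solution_def solves_def agree_def collision_free_def by blast

lemma solves_subset: "solves T Q V \<Longrightarrow> S \<subseteq> T \<Longrightarrow> solves S Q V"
  by (auto simp: solves_def)

lemma solves_Un: "solves S Q V \<Longrightarrow> solves T Q V \<Longrightarrow> solves (S \<union> T) Q V"
  by (auto simp: solves_def)

lemma solves_tendsto:
  assumes "solves T Q V" "s \<in> T" "i \<in> {1..N}"
  shows "((\<lambda>t. Q t i) \<longlongrightarrow> Q s i) (nhds s)" "((\<lambda>t. V t i) \<longlongrightarrow> V s i) (nhds s)"
proof -
  have lim: "(f \<longlongrightarrow> f s) (nhds s)" if "(f has_vector_derivative d) (at s)" for f :: "real \<Rightarrow> real^3" and d
    using has_vector_derivative_continuous[OF that] tendsto_at_iff_tendsto_nhds[of f s] by (simp add: isCont_def)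
  show "((\<lambda>t. Q t i) \<longlongrightarrow> Q s i) (nhds s)" "((\<lambda>t. V t i) \<longlongrightarrow> V s i) (nhds s)"
    using assms unfolding solves_def
    by (blast intro: lim[of "\<lambda>t. Q t i"] lim[of "\<lambda>t. V t i"])+
qed

lemma agree_vector_field:
  assumes "agree Q V Q' V'"
  shows "collision_free Q \<longleftrightarrow> collision_free Q'" "renorm N G m Q V = renorm N G m Q' V'"
    "i \<in> {1..N} \<Longrightarrow> accel N G m Q i = accel N G m Q' i"
proof -
  have eq: "Q i = Q' i" "V i = V' i" if "i \<in> {1..N}" for i using assms that by (auto simp: agree_def)
  show "collision_free Q \<longleftrightarrow> collision_free Q'" using eq by (simp add: collision_free_def)
  show "i \<in> {1..N} \<Longrightarrow> accel N G m Q i = accel N G m Q' i"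
    unfolding accel_def by (rule sum.cong) (auto simp: eq)
  have K: "K N G m Q i = K N G m Q' i" if "i \<in> {1..N}" for i
    unfolding K_def by (rule sum.cong) (use that in \<open>auto simp: eq\<close>)
  show "renorm N G m Q V = renorm N G m Q' V'"
    unfolding renorm_def M_def
    by (intro arg_cong2[where f="(powr)"] arg_cong2[where f="(+)"] sum.cong refl) (auto simp: eq K)
qed

lemma solves_cong:
  assumes sol: "solves T Q V" and T: "open T" and eq: "\<And>t. t \<in> T \<Longrightarrow> agree (Q t) (V t) (Q' t) (V' t)"
  shows "solves T Q' V'"
  unfolding solves_def
proof (intro ballI conjI)
  fix \<tau> assume \<tau>: "\<tau> \<in> T"
  note same = agree_vector_field[OF eq[OF \<tau>]]
  show "collision_free (Q' \<tau>)" using sol \<tau> same(1) by (simp add: solves_def)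
  fix i assume i: "i \<in> {1..N}"
  have ev: "Q t i = Q' t i" "V t i = V' t i" if "t \<in> T" for t using eq[OF that] i by (auto simp: agree_def)
  have d: "((\<lambda>t. Q t i) has_vector_derivative renorm N G m (Q \<tau>) (V \<tau>) *\<^sub>R V \<tau> i) (at \<tau>)"
    "((\<lambda>t. V t i) has_vector_derivative renorm N G m (Q \<tau>) (V \<tau>) *\<^sub>R accel N G m (Q \<tau>) i) (at \<tau>)"
    using sol \<tau> i by (auto simp: solves_def)
  show "((\<lambda>t. Q' t i) has_vector_derivative renorm N G m (Q' \<tau>) (V' \<tau>) *\<^sub>R V' \<tau> i) (at \<tau>)"
    using has_vector_derivative_transform_within_open[OF d(1) T \<tau> ev(1)] same(2) ev(2)[OF \<tau>] by simp
  show "((\<lambda>t. V' t i) has_vector_derivative renorm N G m (Q' \<tau>) (V' \<tau>) *\<^sub>R accel N G m (Q' \<tau>) i) (at \<tau>)"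
    using has_vector_derivative_transform_within_open[OF d(2) T \<tau> ev(2)] same(2) same(3)[OF i] by simp
qed

lemma solves_shift:
  assumes "solves T Q V"
  shows "solves {t. t - c \<in> T} (\<lambda>t. Q (t - c)) (\<lambda>t. V (t - c))"
  unfolding solves_def
proof (intro ballI conjI)
  fix \<tau> assume \<tau>: "\<tau> \<in> {t. t - c \<in> T}"
  show "collision_free (Q (\<tau> - c))" using assms \<tau> by (simp add: solves_def)
  fix i assume i: "i \<in> {1..N}"
  have shift: "((\<lambda>t. t - c) has_vector_derivative 1) (at \<tau>)" by (auto intro!: derivative_eq_intros)
  have d: "((\<lambda>t. Q t i) has_vector_derivative renorm N G m (Q (\<tau> - c)) (V (\<tau> - c)) *\<^sub>R V (\<tau> - c) i) (at (\<tau> - c))"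
    "((\<lambda>t. V t i) has_vector_derivative renorm N G m (Q (\<tau> - c)) (V (\<tau> - c)) *\<^sub>R accel N G m (Q (\<tau> - c)) i) (at (\<tau> - c))"
    using assms \<tau> i by (auto simp: solves_def)
  show "((\<lambda>t. Q (t - c) i) has_vector_derivative renorm N G m (Q (\<tau> - c)) (V (\<tau> - c)) *\<^sub>R V (\<tau> - c) i) (at \<tau>)"
    using vector_diff_chain_at[OF shift d(1)] by (simp add: o_def)
  show "((\<lambda>t. V (t - c) i) has_vector_derivative renorm N G m (Q (\<tau> - c)) (V (\<tau> - c)) *\<^sub>R accel N G m (Q (\<tau> - c)) i) (at \<tau>)"
    using vector_diff_chain_at[OF shift d(2)] by (simp add: o_def)
qed

lemma real_state_solves:
  assumes sol: "solves T Q V" and t: "t \<in> T" and k: "k \<in> coords"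
  shows "((\<lambda>t. real_state (Q t) (V t) k) has_vector_derivative field (real_state (Q t) (V t)) k) (at t)"
proof -
  obtain b i l where kb: "k = (b, i, l)" by (cases k)
  have i: "i \<in> {1..N}" using k kb by simp
  have cf: "collision_free (Q t)" using sol t by (simp add: solves_def)
  have lin: "bounded_linear (\<lambda>v :: real^3. complex_of_real (v $ l))"
    by (rule bounded_linear_compose[OF bounded_linear_of_real bounded_linear_vec_nth])
  have "((\<lambda>t. if b then V t i else Q t i) has_vector_derivative
     renorm N G m (Q t) (V t) *\<^sub>R (if b then accel N G m (Q t) i else V t i)) (at t)"
    using sol t i by (cases b) (auto simp: solves_def)
  note bounded_linear.has_vector_derivative[OF lin this]
  moreover have "field (real_state (Q t) (V t)) (b, i, l) =
      of_real ((renorm N G m (Q t) (V t) *\<^sub>R (if b then accel N G m (Q t) i else V t i)) $ l)"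
    by (rule field_real[OF _ _ cf i]) simp_all
  moreover have "real_state Q V (b, i, l) = of_real ((if b then V i else Q i) $ l)" for Q V
    by (simp add: real_state_def)
  ultimately show ?thesis by (simp only: kb)
qed

text \<open>
  The confining region has nonempty interior around its initial state: \<open>K\<^sub>i > 0\<close> and \<open>dist_maj \<sigma> > 1\<close>.
  Near their starting time, real solutions therefore stay where the vector field is Lipschitz.
\<close>

lemma eventually_in_Dom:
  assumes sol: "solves T Q V" and a: "a \<in> T" and eq: "agree (Q a) (V a) q v"
    and init: "nbody_initial N G m q" and \<sigma>: "\<sigma> > 0"
  shows "\<forall>\<^sub>F t in nhds a. real_state (Q t) (V t) \<in> nbody_initial.Dom N G m q v \<sigma>"
proof -
  interpret nbody_initial N G m q v by (fact init)
  have lim: "((\<lambda>t. Q t i) \<longlongrightarrow> q i) (nhds a)" "((\<lambda>t. V t i) \<longlongrightarrow> v i) (nhds a)" if "i \<in> {1..N}" for i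
    using solves_tendsto[OF sol a that] eq that by (auto simp: agree_def)
  have vel: "\<forall>\<^sub>F t in nhds a. norm (V t i - v i) < s0 * K N G m q i * \<sigma>" if i: "i \<in> {1..N}" for i
  proof (rule order_tendstoD(2))
    show "((\<lambda>t. norm (V t i - v i)) \<longlongrightarrow> norm (v i - v i)) (nhds a)"
      by (intro tendsto_intros lim i)
    show "norm (v i - v i) < s0 * K N G m q i * \<sigma>" using s0 K_pos[OF cf i] \<sigma> by simp
  qed
  have pos: "\<forall>\<^sub>F t in nhds a. i \<noteq> j \<longrightarrow>
      norm (Q t i - Q t j - (q i - q j)) < norm (q i - q j) * (dist_maj \<sigma> - 1)"
    if ij: "i \<in> {1..N}" "j \<in> {1..N}" for i j
  proof (cases "i = j")
    case False
    have "\<forall>\<^sub>F t in nhds a. norm (Q t i - Q t j - (q i - q j)) < norm (q i - q j) * (dist_maj \<sigma> - 1)"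
    proof (rule order_tendstoD(2))
      show "((\<lambda>t. norm (Q t i - Q t j - (q i - q j))) \<longlongrightarrow> norm (q i - q j - (q i - q j))) (nhds a)"
        by (intro tendsto_intros lim ij)
      show "norm (q i - q j - (q i - q j)) < norm (q i - q j) * (dist_maj \<sigma> - 1)"
        using dist_pos[OF ij False] dist_maj_gt_1[OF \<sigma>] by simp
    qed
    then show ?thesis by eventually_elim simp
  qed simp
  have "\<forall>\<^sub>F t in nhds a. (\<forall>i\<in>{1..N}. norm (V t i - v i) < s0 * K N G m q i * \<sigma>) \<and>
     (\<forall>i\<in>{1..N}. \<forall>j\<in>{1..N}. i \<noteq> j \<longrightarrow>
       norm (Q t i - Q t j - (q i - q j)) < norm (q i - q j) * (dist_maj \<sigma> - 1))"
    by (intro eventually_conj eventually_ball_finite ballI vel pos) auto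
  then show ?thesis
  proof eventually_elim
    case (elim t)
    have "norm (cvec (V t i) - cvec (v i)) = norm (V t i - v i)"
      "norm (cvec (Q t i) - cvec (Q t j) - cvec (q i - q j)) = norm (Q t i - Q t j - (q i - q j))" for i j
      by (simp_all only: norm_cvec flip: cvec_diff)
    then show ?case using elim unfolding Dom_def by (auto intro: less_imp_le)
  qed
qed

lemma solves_locally_unique:
  assumes sol: "solves T Q V" "solves T Q' V'" and T: "open T" and a: "a \<in> T"
    and eq: "agree (Q a) (V a) (Q' a) (V' a)"
  shows "\<forall>\<^sub>F t in nhds a. agree (Q t) (V t) (Q' t) (V' t)"
proof -
  have init: "nbody_initial N G m (Q a)"
    using sol(1) a by unfold_locales (simp add: solves_def)
  interpret nbody_initial N G m "Q a" "V a" by (fact init)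
  (* Any size strictly between 0 and v_plus of the confining region would do. *)
  have \<sigma>: "0 < v_plus / 2" "v_plus / 2 < v_plus" using v_plus_cubic(2) by auto
  have "\<forall>\<^sub>F t in nhds a. t \<in> T \<and> real_state (Q t) (V t) \<in> Dom (v_plus / 2) \<and> real_state (Q' t) (V' t) \<in> Dom (v_plus / 2)"
    by (intro eventually_conj eventually_nhds_in_open T a
        eventually_in_Dom[OF sol(1) a agree_refl init \<sigma>(1)]
        eventually_in_Dom[OF sol(2) a agree_sym[OF eq] init \<sigma>(1)])
  then obtain \<delta> where \<delta>: "\<delta> > 0" "\<And>t. \<bar>t - a\<bar> < \<delta> \<Longrightarrow> t \<in> T \<and>
      real_state (Q t) (V t) \<in> Dom (v_plus / 2) \<and> real_state (Q' t) (V' t) \<in> Dom (v_plus / 2)"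
    unfolding eventually_nhds_metric dist_real_def by blast
  obtain L where L: "\<And>x y k. x \<in> Dom (v_plus / 2) \<Longrightarrow> y \<in> Dom (v_plus / 2) \<Longrightarrow> k \<in> coords \<Longrightarrow>
     cmod (field x k - field y k) \<le> L * (\<Sum>i\<in>coords. cmod (x i - y i))"
    using field_lipschitz_constant[of "v_plus / 2"] \<sigma> by auto
  obtain \<epsilon> where \<epsilon>: "\<epsilon> > 0" "\<And>t k. \<bar>t - a\<bar> < \<epsilon> \<Longrightarrow> k \<in> coords \<Longrightarrow>
      real_state (Q t) (V t) k = real_state (Q' t) (V' t) k"
  proof (rule ode_locally_unique[OF finite_coords \<delta>(1) L])
    show "real_state (Q a) (V a) k = real_state (Q' a) (V' a) k" if "k \<in> coords" for k
      using eq that by (cases k) (auto simp: real_state_def agree_def)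
  qed (use \<delta>(2) real_state_solves[OF sol(1)] real_state_solves[OF sol(2)] in auto)
  have "agree (Q t) (V t) (Q' t) (V' t)" if "\<bar>t - a\<bar> < \<epsilon>" for t
  proof -
    have "Q t i $ k = Q' t i $ k" "V t i $ k = V' t i $ k" if i: "i \<in> {1..N}" for i k
      using \<epsilon>(2)[OF \<open>\<bar>t - a\<bar> < \<epsilon>\<close>, of "(False, i, k)"] \<epsilon>(2)[OF \<open>\<bar>t - a\<bar> < \<epsilon>\<close>, of "(True, i, k)"] i
      by (simp_all add: real_state_def)
    then show ?thesis by (simp add: agree_def vec_eq_iff)
  qed
  then show ?thesis unfolding eventually_nhds_metric dist_real_def using \<epsilon>(1) by blast
qed

text \<open>
  The set of times at which two solutions agree is open by local uniqueness and closed by continuity.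
\<close>

lemma solves_unique:
  assumes sol: "solves T Q V" "solves T Q' V'" and T: "open T" "connected T"
    and a: "a \<in> T" "agree (Q a) (V a) (Q' a) (V' a)" and t: "t \<in> T"
  shows "agree (Q t) (V t) (Q' t) (V' t)"
proof -
  define A where "A = {t\<in>T. agree (Q t) (V t) (Q' t) (V' t)}"
  have "open A" unfolding open_subopen[of A]
  proof
    fix s assume s: "s \<in> A"
    then have "\<forall>\<^sub>F t in nhds s. t \<in> T \<and> agree (Q t) (V t) (Q' t) (V' t)"
      by (intro eventually_conj eventually_nhds_in_open solves_locally_unique[OF sol T(1)] T(1)) (auto simp: A_def)
    then show "\<exists>U. open U \<and> s \<in> U \<and> U \<subseteq> A" unfolding eventually_nhds A_def by blast
  qed
  moreover have "open (T - A)" unfolding open_subopen[of "T - A"]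
  proof
    fix s assume "s \<in> T - A"
    then have s: "s \<in> T" "\<not> agree (Q s) (V s) (Q' s) (V' s)" by (auto simp: A_def)
    then obtain i where i: "i \<in> {1..N}" "Q s i \<noteq> Q' s i \<or> V s i \<noteq> V' s i" by (auto simp: agree_def)
    have lim: "((\<lambda>t. Q t i - Q' t i) \<longlongrightarrow> Q s i - Q' s i) (nhds s)" "((\<lambda>t. V t i - V' t i) \<longlongrightarrow> V s i - V' s i) (nhds s)"
      by (intro tendsto_diff solves_tendsto[OF sol(1) s(1) i(1)] solves_tendsto[OF sol(2) s(1) i(1)])+
    have "\<forall>\<^sub>F t in nhds s. Q t i - Q' t i \<noteq> 0 \<or> V t i - V' t i \<noteq> 0"
    proof (cases "Q s i = Q' s i")
      case False
      then have "\<forall>\<^sub>F t in nhds s. Q t i - Q' t i \<noteq> 0" by (intro tendsto_imp_eventually_ne[OF lim(1)]) simp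
      then show ?thesis by eventually_elim simp
    next
      case True
      then have "\<forall>\<^sub>F t in nhds s. V t i - V' t i \<noteq> 0" using i by (intro tendsto_imp_eventually_ne[OF lim(2)]) simp
      then show ?thesis by eventually_elim simp
    qed
    then have "\<forall>\<^sub>F t in nhds s. t \<in> T \<and> \<not> agree (Q t) (V t) (Q' t) (V' t)"
      using eventually_nhds_in_open[OF T(1) s(1)] by eventually_elim (use i(1) in \<open>auto simp: agree_def\<close>)
    then show "\<exists>U. open U \<and> s \<in> U \<and> U \<subseteq> T - A" unfolding eventually_nhds A_def by blast
  qed
  ultimately have "A \<inter> T = {} \<or> (T - A) \<inter> T = {}"
    using T(2) by (intro connectedD) auto
  then show ?thesis using a t by (auto simp: A_def)
qed

lemma solves_glue:
  assumes sol: "solves A Q V" "solves B Q' V'" and AB: "open A" "open B" "connected (A \<inter> B)"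
    and p: "p \<in> A \<inter> B" "agree (Q p) (V p) (Q' p) (V' p)"
  obtains Q'' V'' where "solves (A \<union> B) Q'' V''" "\<And>t. t \<in> A \<Longrightarrow> agree (Q'' t) (V'' t) (Q t) (V t)"
proof -
  define Q'' where "Q'' = (\<lambda>t. if t \<in> A then Q t else Q' t)"
  define V'' where "V'' = (\<lambda>t. if t \<in> A then V t else V' t)"
  have eq: "agree (Q t) (V t) (Q' t) (V' t)" if "t \<in> A \<inter> B" for t
    by (rule solves_unique[OF solves_subset[OF sol(1)] solves_subset[OF sol(2)] _ AB(3) p that]) (use AB in auto)
  have "solves A Q'' V''"
    by (rule solves_cong[OF sol(1) AB(1)]) (simp add: Q''_def V''_def agree_refl)
  moreover have "solves B Q'' V''"
    by (rule solves_cong[OF sol(2) AB(2)]) (use eq agree_sym agree_refl in \<open>auto simp: Q''_def V''_def\<close>)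
  ultimately show ?thesis
    by (intro that[OF solves_Un]) (auto simp: Q''_def V''_def agree_refl)
qed

text \<open>
  The holomorphic solution restricted to the real axis is real, collision-free and solves the original
  equations; its existence interval has a length that is the same for all initial states.
\<close>

lemma local_solution:
  assumes cf: "collision_free q"
  obtains F :: "complex \<Rightarrow> state" and Q V where
    "\<And>k. k \<in> coords \<Longrightarrow> (\<lambda>z. F z k) holomorphic_on ball 0 beta"
    "solves {-beta<..<beta} Q V" "agree (Q 0) (V 0) q v"
    "\<And>t k. \<bar>t\<bar> < beta \<Longrightarrow> k \<in> coords \<Longrightarrow> F (of_real t) k = real_state (Q t) (V t) k"
proof -
  interpret nbody_initial N G m q v by unfold_locales (fact cf)
  obtain y :: "complex \<Rightarrow> state" and \<sigma> :: "real \<Rightarrow> real" where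
    dom: "\<And>z. z \<in> ball 0 beta \<Longrightarrow> 0 \<le> \<sigma> (cmod z) \<and> y z \<in> Dom (\<sigma> (cmod z))"
    and y0: "\<And>k. k \<in> coords \<Longrightarrow> y 0 k = real_state q v k"
    and dy: "\<And>k z. k \<in> coords \<Longrightarrow> z \<in> ball 0 beta \<Longrightarrow> ((\<lambda>z. y z k) has_field_derivative field (y z) k) (at z)"
    and real: "\<And>t k. \<bar>t\<bar> < beta \<Longrightarrow> k \<in> coords \<Longrightarrow> y (of_real t) k \<in> \<real>"
    by (rule holomorphic_solution) (rule that)
  define Q where "Q = (\<lambda>t. real_posn (y (of_real t)))"
  define V where "V = (\<lambda>t. real_vel (y (of_real t)))"
  show ?thesis
  proof (rule that[of y Q V])
    show "(\<lambda>z. y z k) holomorphic_on ball 0 beta" if "k \<in> coords" for k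
      using dy[OF that] holomorphic_on_open open_ball by blast
    show "agree (Q 0) (V 0) q v"
      using y0 by (auto simp: agree_def Q_def V_def real_posn_def real_vel_def real_state_def vec_eq_iff)
    show "y (of_real t) k = real_state (Q t) (V t) k" if "\<bar>t\<bar> < beta" "k \<in> coords" for t k
      using real[OF that] by (cases k) (auto simp: real_state_def Q_def V_def real_posn_def real_vel_def)
    show "solves {-beta<..<beta} Q V"
      unfolding solves_def
    proof (intro ballI conjI)
      fix \<tau> assume "\<tau> \<in> {-beta<..<beta}"
      then have \<tau>: "\<bar>\<tau>\<bar> < beta" by auto
      then have \<tau>b: "complex_of_real \<tau> \<in> ball 0 beta" by simp
      note parts = real_parts[of "y (of_real \<tau>)", OF real[OF \<tau>], folded Q_def V_def]
      have cfQ: "collision_free (Q \<tau>)"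
        unfolding Q_def using dom[OF \<tau>b] by (intro Dom_collision_free[where \<sigma>="\<sigma> (cmod (of_real \<tau>))"] real[OF \<tau>]) auto
      then show "collision_free (Q \<tau>)" .
      fix i assume i: "i \<in> {1..N}"
      have d: "((\<lambda>t. Re (y (of_real t) (b, i, k))) has_vector_derivative
          (renorm N G m (Q \<tau>) (V \<tau>) *\<^sub>R (if b then accel N G m (Q \<tau>) i else V \<tau> i)) $ k) (at \<tau>)" for b k
      proof -
        have "((\<lambda>t. y (of_real t) (b, i, k)) has_vector_derivative field (y (of_real \<tau>)) (b, i, k)) (at \<tau>)"
          using i by (intro has_vector_derivative_real_field dy \<tau>b) simp
        from bounded_linear.has_vector_derivative[OF bounded_linear_Re this]
        show ?thesis
          using field_real[of "y (of_real \<tau>)" "Q \<tau>" "V \<tau>" i b k] parts cfQ i by (simp add: Q_def V_def)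
      qed
      show "((\<lambda>t. Q t i) has_vector_derivative renorm N G m (Q \<tau>) (V \<tau>) *\<^sub>R V \<tau> i) (at \<tau>)"
        by (rule has_vector_derivative_vec_componentwise) (use d[of False] in \<open>simp add: Q_def real_posn_def\<close>)
      show "((\<lambda>t. V t i) has_vector_derivative renorm N G m (Q \<tau>) (V \<tau>) *\<^sub>R accel N G m (Q \<tau>) i) (at \<tau>)"
        by (rule has_vector_derivative_vec_componentwise) (use d[of True] in \<open>simp add: V_def real_vel_def\<close>)
    qed
  qed
qed

end

section \<open>Global continuation and the strip\<close>

lemma beta_pos: "beta > 0"
  by (rule majorant_solution)

text \<open>
  The strip is the union of the discs of radius \<open>r\<close> with real centres. The value at \<open>z\<close> is taken from the disc
  centred at \<open>Re z\<close>, the one that contains \<open>z\<close> whenever any of them does. Two of the given functions agree on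
  the real points common to their discs, hence on the whole (convex) intersection if the centres have distance
  less than \<open>r\<close>; so the glued function coincides near \<open>z\<close> with the one belonging to \<open>Re z\<close>.
\<close>

lemma holomorphic_glue_strip:
  fixes f :: "real \<Rightarrow> complex"
  assumes r: "r > 0" and loc: "\<And>s. \<exists>F. F holomorphic_on ball (of_real s) r \<and> (\<forall>t. \<bar>t - s\<bar> < r \<longrightarrow> F (of_real t) = f t)"
  obtains F where "F holomorphic_on {z. \<bar>Im z\<bar> < r}" "\<And>t. F (of_real t) = f t"
proof -
  obtain F where F: "\<And>s. F s holomorphic_on ball (of_real s) r" "\<And>s t. \<bar>t - s\<bar> < r \<Longrightarrow> F s (of_real t) = f t"
    using loc by metis
  have same: "F s z = F t z" if st: "\<bar>s - t\<bar> < r" and z: "z \<in> ball (of_real s) r \<inter> ball (of_real t) r" for s t z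
  proof -
    define S where "S = ball (complex_of_real s) r \<inter> ball (of_real t) r"
    define U where "U = complex_of_real ` (ball s r \<inter> ball t r)"
    have "F s z - F t z = 0"
    proof (rule analytic_continuation[of "\<lambda>z. F s z - F t z" S U "of_real s"])
      show "(\<lambda>z. F s z - F t z) holomorphic_on S"
        unfolding S_def by (intro holomorphic_on_diff holomorphic_on_subset[OF F(1)]) auto
      show "open S" "connected S" unfolding S_def by (auto intro: convex_connected convex_Int)
      show "U \<subseteq> S" by (auto simp: U_def S_def dist_of_real)
      show "of_real s \<in> S" using st r by (auto simp: S_def dist_of_real dist_real_def abs_minus_commute)
      show "z \<in> S" using z by (simp add: S_def)
      show "F s w - F t w = 0" if "w \<in> U" for w
        using that F(2) by (auto simp: U_def dist_real_def abs_minus_commute)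
      have "s islimpt (ball s r \<inter> ball t r)"
        using st r by (intro interior_limit_point) (auto simp: interior_open open_Int dist_real_def abs_minus_commute)
      then show "complex_of_real s islimpt U"
        unfolding islimpt_approachable U_def by (auto simp: dist_of_real)
    qed
    then show ?thesis by simp
  qed
  define H where "H = (\<lambda>z. F (Re z) z)"
  have "H holomorphic_on {z. \<bar>Im z\<bar> < r}"
    unfolding holomorphic_on_def
  proof
    fix z assume "z \<in> {z. \<bar>Im z\<bar> < r}"
    then have z: "\<bar>Im z\<bar> < r" by simp
    have inball: "w \<in> ball (of_real (Re w)) r" if "\<bar>Im w\<bar> < r" for w
    proof -
      have "of_real (Re w) - w = - (\<i> * of_real (Im w))" by (simp add: complex_eq_iff)
      then show ?thesis using that by (simp add: dist_norm norm_mult)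
    qed
    define W where "W = ball (complex_of_real (Re z)) r \<inter> ball z r \<inter> {w. \<bar>Im w\<bar> < r}"
    have oW: "open W" unfolding W_def
      by (intro open_Int open_ball open_Collect_less continuous_intros)
    have zW: "z \<in> W" using inball[OF z] z r by (simp add: W_def)
    have "F (Re z) field_differentiable at z"
      using F(1)[of "Re z"] inball[OF z] by (auto simp: holomorphic_on_open field_differentiable_def)
    then obtain d where d: "(F (Re z) has_field_derivative d) (at z)" by (auto simp: field_differentiable_def)
    have "H w = F (Re z) w" if "w \<in> W" for w
    proof -
      have "\<bar>Re w - Re z\<bar> \<le> cmod (w - z)" using abs_Re_le_cmod[of "w - z"] by simp
      then have "\<bar>Re w - Re z\<bar> < r" using that by (simp add: W_def dist_norm norm_minus_commute)
      then show ?thesis unfolding H_def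
        by (rule same) (use that inball[of w] in \<open>auto simp: W_def\<close>)
    qed
    then have "(H has_field_derivative d) (at z)"
      using has_field_derivative_transform_within_open[OF d oW zW] by metis
    then show "H field_differentiable at z within {z. \<bar>Im z\<bar> < r}"
      by (meson field_differentiable_def field_differentiable_at_within)
  qed
  moreover have "H (of_real t) = f t" for t using F(2)[of t t] r by (simp add: H_def)
  ultimately show ?thesis by (rule that)
qed

context nbody
begin

lemma solves_extend:
  assumes sol: "solves {a<..<b} Q V" and c: "c \<in> {a<..<b}"
  obtains Q' V' where "solves ({a<..<b} \<union> {c - beta<..<c + beta}) Q' V'"
    "\<And>t. t \<in> {a<..<b} \<Longrightarrow> agree (Q' t) (V' t) (Q t) (V t)"
proof -
  have cf: "collision_free (Q c)" using sol c by (simp add: solves_def)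
  obtain F :: "complex \<Rightarrow> state" and P W where PW: "solves {-beta<..<beta} P W" "agree (P 0) (W 0) (Q c) (V c)"
    by (rule local_solution[OF cf]) (rule that)
  have "{t. t - c \<in> {-beta<..<beta}} = {c - beta<..<c + beta}" by auto
  then have "solves {c - beta<..<c + beta} (\<lambda>t. P (t - c)) (\<lambda>t. W (t - c))"
    using solves_shift[OF PW(1), of c] by simp
  then show ?thesis
    by (rule solves_glue[OF sol]) (use that c beta_pos agree_sym[OF PW(2)] in auto)
qed

text \<open>
  Restarting at distance \<open>\<beta> / 2\<close> from either end of the current interval of existence lengthens it
  by \<open>\<beta> / 2\<close> at that end.
\<close>

lemma solution_on_large_intervals:
  assumes cf: "collision_free q"
  shows "\<exists>Q V. solves {-(beta + real n * (beta / 2))<..<beta + real n * (beta / 2)} Q V \<and> agree (Q 0) (V 0) q v"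
proof (induction n)
  case 0
  obtain F :: "complex \<Rightarrow> state" and P W where "solves {-beta<..<beta} P W" "agree (P 0) (W 0) q v"
    by (rule local_solution[OF cf]) (rule that)
  then show ?case by auto
next
  case (Suc n)
  define R where "R = beta + real n * (beta / 2)"
  (* Restart at distance beta / 2 from the end, so that the new disc still overlaps the old interval. *)
  define c where "c = R - beta / 2"
  have R: "R \<ge> beta" using beta_pos by (simp add: R_def)
  obtain Q V where QV: "solves {-R<..<R} Q V" "agree (Q 0) (V 0) q v" using Suc by (auto simp: R_def)
  obtain Q1 V1 where 1: "solves ({-R<..<R} \<union> {c - beta<..<c + beta}) Q1 V1"
    "\<And>t. t \<in> {-R<..<R} \<Longrightarrow> agree (Q1 t) (V1 t) (Q t) (V t)"
    by (rule solves_extend[OF QV(1), of c]) (use R beta_pos in \<open>auto simp: c_def\<close>)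
  have U1: "{-R<..<R} \<union> {c - beta<..<c + beta} = {-R<..<R + beta / 2}"
    using R beta_pos by (auto simp: c_def)
  obtain Q2 V2 where 2: "solves ({-R<..<R + beta / 2} \<union> {- c - beta<..<- c + beta}) Q2 V2"
    "\<And>t. t \<in> {-R<..<R + beta / 2} \<Longrightarrow> agree (Q2 t) (V2 t) (Q1 t) (V1 t)"
    by (rule solves_extend[OF 1(1)[unfolded U1], of "- c"]) (use R beta_pos in \<open>auto simp: c_def\<close>)
  have U2: "{-R<..<R + beta / 2} \<union> {- c - beta<..<- c + beta} = {-(R + beta / 2)<..<R + beta / 2}"
    using R beta_pos by (auto simp: c_def)
  have "agree (Q2 0) (V2 0) q v"
    using 2(2)[of 0] 1(2)[of 0] QV(2) R beta_pos by (auto intro: agree_trans)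
  moreover have "R + beta / 2 = beta + real (Suc n) * (beta / 2)" by (simp add: R_def field_simps)
  ultimately show ?case using 2(1) unfolding U2 by metis
qed

lemma global_solution:
  assumes cf: "collision_free q"
  obtains Q V where "solves UNIV Q V" "agree (Q 0) (V 0) q v"
proof -
  define R where "R = (\<lambda>n. beta + real n * (beta / 2))"
  obtain P W where PW: "\<And>n. solves {-R n<..<R n} (P n) (W n)" "\<And>n. agree (P n 0) (W n 0) q v"
    using solution_on_large_intervals[OF cf, of _ v] unfolding R_def by metis
  have R0: "R n > 0" for n using beta_pos by (simp add: R_def add_pos_nonneg)
  have large: "\<exists>n. \<bar>t\<bar> < R n" for t
  proof -
    obtain n where "\<bar>t\<bar> < real n * (beta / 2)" using reals_Archimedean3[of "beta / 2"] beta_pos by auto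
    then have "\<bar>t\<bar> < R n" using beta_pos by (simp add: R_def)
    then show ?thesis ..
  qed
  have same: "agree (P k t) (W k t) (P n t) (W n t)" if "\<bar>t\<bar> < R k" "\<bar>t\<bar> < R n" for k n t
  proof (rule solves_unique[where T="{-min (R k) (R n)<..<min (R k) (R n)}" and a=0])
    show "agree (P k 0) (W k 0) (P n 0) (W n 0)" using PW(2) agree_sym agree_trans by blast
    show "solves {-min (R k) (R n)<..<min (R k) (R n)} (P k) (W k)"
      by (rule solves_subset[OF PW(1)]) auto
    show "solves {-min (R k) (R n)<..<min (R k) (R n)} (P n) (W n)"
      by (rule solves_subset[OF PW(1)]) auto
  qed (use that R0 in auto)
  define n where "n = (\<lambda>t. SOME n. \<bar>t\<bar> < R n)"
  have n: "\<bar>t\<bar> < R (n t)" for t unfolding n_def by (rule someI_ex) (rule large)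
  define Q where "Q = (\<lambda>t. P (n t) t)"
  define V where "V = (\<lambda>t. W (n t) t)"
  have "solves {-R k<..<R k} Q V" for k
    by (rule solves_cong[OF PW(1)[of k]]) (auto simp: Q_def V_def intro!: same n)
  then have "solves UNIV Q V" unfolding solves_def
    using large by (meson abs_less_iff greaterThanLessThan_iff minus_less_iff)
  moreover have "agree (Q 0) (V 0) q v" unfolding Q_def V_def by (rule PW(2))
  ultimately show ?thesis by (rule that)
qed

text \<open>
  Every real time \<open>s\<close> is the centre of a disc of radius \<open>\<beta>\<close> with a holomorphic solution that
  starts at the state of the real solution; by uniqueness it agrees with the real solution on the real diameter.
\<close>

lemma holomorphic_extension_coordinate:
  assumes sol: "solves UNIV Q V" and k: "k \<in> coords"
  obtains F where "F holomorphic_on {z. \<bar>Im z\<bar> < beta}" "\<And>t. F (of_real t) = real_state (Q t) (V t) k"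
proof (rule holomorphic_glue_strip[OF beta_pos])
  fix s
  have cf: "collision_free (Q s)" using sol by (simp add: solves_def)
  obtain F :: "complex \<Rightarrow> state" and P W where F: "\<And>k. k \<in> coords \<Longrightarrow> (\<lambda>z. F z k) holomorphic_on ball 0 beta"
    and PW: "solves {-beta<..<beta} P W" "agree (P 0) (W 0) (Q s) (V s)"
    and FP: "\<And>t k. \<bar>t\<bar> < beta \<Longrightarrow> k \<in> coords \<Longrightarrow> F (of_real t) k = real_state (P t) (W t) k"
    by (rule local_solution[OF cf]) (rule that)
  have sol': "solves {-beta<..<beta} (\<lambda>t. Q (t - (- s))) (\<lambda>t. V (t - (- s)))"
    by (rule solves_subset[OF solves_shift[OF sol]]) auto
  have eq: "agree (P t) (W t) (Q (t + s)) (V (t + s))" if "\<bar>t\<bar> < beta" for t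
    using solves_unique[OF PW(1) sol', of 0 t] PW(2) that beta_pos by (auto simp: abs_less_iff)
  have "(\<lambda>z. F (z - of_real s) k) holomorphic_on ball (of_real s) beta"
  proof -
    have "(\<lambda>z. F z k) \<circ> (\<lambda>z. z - of_real s) holomorphic_on ball (of_real s) beta"
      by (rule holomorphic_on_compose_gen[OF _ F[OF k]])
         (auto simp: dist_norm norm_minus_commute intro!: holomorphic_intros)
    then show ?thesis by (simp add: o_def)
  qed
  moreover have "F (of_real t - of_real s) k = real_state (Q t) (V t) k" if "\<bar>t - s\<bar> < beta" for t
  proof -
    have "F (of_real t - of_real s) k = real_state (P (t - s)) (W (t - s)) k"
      using FP[OF that k] by simp
    also have "\<dots> = real_state (Q t) (V t) k"
      using eq[OF that] k by (cases k) (auto simp: real_state_def agree_def)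
    finally show ?thesis .
  qed
  ultimately show "\<exists>F. F holomorphic_on ball (of_real s) beta \<and>
      (\<forall>t. \<bar>t - s\<bar> < beta \<longrightarrow> F (of_real t) = real_state (Q t) (V t) k)"
    by blast
qed (rule that)

lemma holomorphic_extensions:
  assumes sol: "solves UNIV Q V" and i: "i \<in> {1..N}"
  shows "has_holomorphic_extension (\<lambda>t. Q t i) {\<tau>. \<bar>Im \<tau>\<bar> < beta}"
    and "has_holomorphic_extension (\<lambda>t. V t i) {\<tau>. \<bar>Im \<tau>\<bar> < beta}"
proof -
  have ext: "has_holomorphic_extension (\<lambda>t. if b then V t i else Q t i) {\<tau>. \<bar>Im \<tau>\<bar> < beta}" for b
  proof -
    have "\<exists>F. F holomorphic_on {z. \<bar>Im z\<bar> < beta} \<and> (\<forall>t. F (of_real t) = real_state (Q t) (V t) (b, i, k))" for k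
      by (rule holomorphic_extension_coordinate[OF sol, of "(b, i, k)"]) (use i in auto)
    then obtain F where F: "\<And>k. F k holomorphic_on {z. \<bar>Im z\<bar> < beta}"
      "\<And>k t. F k (of_real t) = real_state (Q t) (V t) (b, i, k)" by metis
    show ?thesis unfolding has_holomorphic_extension_def
      by (rule exI[of _ "\<lambda>z. \<chi> k. F k z"]) (use F beta_pos in \<open>auto simp: real_state_def\<close>)
  qed
  show "has_holomorphic_extension (\<lambda>t. Q t i) {\<tau>. \<bar>Im \<tau>\<bar> < beta}"
    "has_holomorphic_extension (\<lambda>t. V t i) {\<tau>. \<bar>Im \<tau>\<bar> < beta}"
    using ext[of False] ext[of True] by simp_all
qed

end

theorem corollary2:
  fixes N :: nat and G :: real and m :: "nat \<Rightarrow> real" and q0 v0 :: "nat \<Rightarrow> real^3"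
  assumes "N \<ge> 2" and "G > 0"
    and "\<And>i. 1 \<le> i \<Longrightarrow> i \<le> N \<Longrightarrow> m i > 0"
    and "\<And>i j. 1 \<le> i \<Longrightarrow> i < j \<Longrightarrow> j \<le> N \<Longrightarrow> q0 i \<noteq> q0 j"
  shows "\<exists>Q V. renormalized_solution N G m q0 v0 UNIV Q V \<and>
    (\<forall>T Q' V'. open T \<and> is_interval T \<and> 0 \<in> T \<and> renormalized_solution N G m q0 v0 T Q' V' \<longrightarrow>
       (\<forall>\<tau>\<in>T. \<forall>i\<in>{1..N}. Q' \<tau> i = Q \<tau> i \<and> V' \<tau> i = V \<tau> i)) \<and>
    (\<forall>i\<in>{1..N}.
       has_holomorphic_extension (\<lambda>\<tau>. Q \<tau> i) {\<tau>. \<bar>Im \<tau>\<bar> < beta} \<and>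
       has_holomorphic_extension (\<lambda>\<tau>. V \<tau> i) {\<tau>. \<bar>Im \<tau>\<bar> < beta})"
proof -
  interpret nbody N G m by unfold_locales (use assms(1-3) in auto)
  have cf: "collision_free q0" unfolding collision_free_def
  proof (intro ballI impI)
    fix i j assume "i \<in> {1..N}" "j \<in> {1..N}" "i \<noteq> j"
    then show "q0 i \<noteq> q0 j" using assms(4)[of i j] assms(4)[of j i] by (cases "i < j") auto
  qed
  obtain Q V where QV: "solves UNIV Q V" "agree (Q 0) (V 0) q0 v0"
    by (rule global_solution[OF cf]) (rule that)
  have unique: "agree (Q' \<tau>) (V' \<tau>) (Q \<tau>) (V \<tau>)"
    if T: "open T" "is_interval T" "0 \<in> T" "renormalized_solution N G m q0 v0 T Q' V'" "\<tau> \<in> T" for T Q' V' \<tau>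
  proof (rule solves_unique[OF _ solves_subset[OF QV(1)] T(1) is_interval_connected[OF T(2)] T(3) _ T(5)])
    show "solves T Q' V'" "agree (Q' 0) (V' 0) (Q 0) (V 0)"
      using T(4) agree_trans[OF _ agree_sym[OF QV(2)]] by (auto simp: renormalized_solution_iff)
  qed simp
  show ?thesis
  proof (rule exI[of _ Q], rule exI[of _ V], intro conjI allI impI ballI)
    show "renormalized_solution N G m q0 v0 UNIV Q V"
      using QV by (simp add: renormalized_solution_iff)
  qed (use unique holomorphic_extensions[OF QV(1)] in \<open>auto simp: agree_def\<close>)
qed

end
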